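(* Let $\Omega\subset\mathbb{R}^N$ be a smooth bounded domain with $0\in\Omega$, let $\mu_0=-\frac{(N-2)^2}{4}$ and $D_0=\max_{x\in\partial\Omega}|x|$. For $\mu\ge\mu_0$ let $\{\lambda_{\mu,i}\}_{i\ge1}$ be the increasing sequence of Dirichlet eigenvalues of $\mathcal{L}_\mu=-\Delta+\frac{\mu}{|x|^2}$ in $\Omega$ (so $\lambda_{0,1}$ is the first Dirichlet eigenvalue of $-\Delta$ in $\Omega$). (i) If $N\ge2$ and $\mu\ge0$, then for every integer $k\ge1$, $$\lambda_{\mu,k}\le\Big(1+\frac4N\Big)k^{\frac2N}\lambda_{\mu,1}.$$ (ii) If $N\ge3$ and $\mu\in[\mu_0,0)$, then for every integer $k\ge1$, $$\lambda_{\mu,k}\le\Big(1+\frac4N\Big)k^{\frac2N}\lambda_{0,1}+\mu D_0^{-2}.$$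
   Context: Eigenvalues: for $\mu\ge\mu_0$, $H_\mu(\Omega)$ is the completion of the set of $u\in C_0^\infty(\Omega)$ with finite norm (finiteness is automatic unless $N=2$ and $\mu>0$) under $\|u\|_\mu=\left(\int_\Omega|\nabla u|^2dx+\mu\int_\Omega\frac{u^2}{|x|^2}dx\right)^{1/2}$. The Dirichlet problem $\mathcal{L}_\mu u=\lambda u$ in $\Omega$, $u=0$ on $\partial\Omega$, is understood through the self-adjoint operator on $L^2(\Omega)$ associated with this quadratic form (Friedrichs extension). It has compact resolvent; $\lambda_{\mu,1}\le\lambda_{\mu,2}\le\cdots$ are its eigenvalues repeated according to multiplicity, given by $\lambda_{\mu,k}=\min\{\|u\|_\mu^2: u\in H_\mu(\Omega),\ \|u\|_{L^2(\Omega)}=1,\ \int_\Omega u\phi_j\,dx=0 \text{ for } j<k\}$ with $L^2$-orthonormal eigenfunctions $\phi_j$. *)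

theory Defs
  imports "HOL-Analysis.Analysis"
begin

section \<open>Smooth functions and smooth domains\<close>

text \<open>Intended for open sets \<open>S\<close>: continuity of all partial derivatives up to order \<open>k\<close>.\<close>

primrec Ck_on :: "nat \<Rightarrow> ('a::euclidean_space \<Rightarrow> real) \<Rightarrow> 'a set \<Rightarrow> bool" where
  "Ck_on 0 f S \<longleftrightarrow> continuous_on S f"
| "Ck_on (Suc k) f S \<longleftrightarrow>
     (\<forall>x\<in>S. f differentiable (at x)) \<and>
     (\<forall>b\<in>Basis. Ck_on k (\<lambda>x. frechet_derivative f (at x) b) S)"

definition smooth_on :: "('a::euclidean_space \<Rightarrow> real) \<Rightarrow> 'a set \<Rightarrow> bool" where
  "smooth_on f S \<longleftrightarrow> (\<forall>k. Ck_on k f S)"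

definition grad :: "('a::euclidean_space \<Rightarrow> real) \<Rightarrow> 'a \<Rightarrow> 'a" where
  "grad f x = (\<Sum>b\<in>Basis. frechet_derivative f (at x) b *\<^sub>R b)"

text \<open>The boundary is smooth: near each boundary point, \<open>\<Omega>\<close> is a strict sublevel set of a smooth
  function with non-vanishing gradient.\<close>

definition smooth_bounded_domain :: "'a::euclidean_space set \<Rightarrow> bool" where
  "smooth_bounded_domain \<Omega> \<longleftrightarrow>
     open \<Omega> \<and> connected \<Omega> \<and> \<Omega> \<noteq> {} \<and> bounded \<Omega> \<and>
     (\<forall>p\<in>frontier \<Omega>. \<exists>U \<rho>. open U \<and> p \<in> U \<and> smooth_on \<rho> U \<and>
        (\<forall>x\<in>U. grad \<rho> x \<noteq> 0) \<and> \<Omega> \<inter> U = {x\<in>U. \<rho> x < 0})"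

definition test_functions :: "'a::euclidean_space set \<Rightarrow> ('a \<Rightarrow> real) set" where
  "test_functions \<Omega> =
     {u. smooth_on u UNIV \<and> compact (closure {x. u x \<noteq> 0}) \<and> closure {x. u x \<noteq> 0} \<subseteq> \<Omega>}"


section \<open>Real \<open>L\<^sup>2\<close> on a domain\<close>

text \<open>Elements are functions, not classes; their values outside \<open>\<Omega>\<close> are irrelevant.\<close>

definition L2_on :: "'a::euclidean_space set \<Rightarrow> ('a \<Rightarrow> real) set" where
  "L2_on \<Omega> = {u. u \<in> borel_measurable (lebesgue_on \<Omega>) \<and> integrable (lebesgue_on \<Omega>) (\<lambda>x. (u x)\<^sup>2)}"

definition L2_inner :: "'a::euclidean_space set \<Rightarrow> ('a \<Rightarrow> real) \<Rightarrow> ('a \<Rightarrow> real) \<Rightarrow> real" where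
  "L2_inner \<Omega> u v = (LINT x|lebesgue_on \<Omega>. u x * v x)"

definition L2_norm :: "'a::euclidean_space set \<Rightarrow> ('a \<Rightarrow> real) \<Rightarrow> real" where
  "L2_norm \<Omega> u = sqrt (L2_inner \<Omega> u u)"


section \<open>The Hardy form, its completion and the associated operator\<close>

text \<open>Test functions of finite norm. The gradient term is always finite. For \<open>\<mu> = 0\<close> the singular
  term is absent, so integrability of \<open>u\<^sup>2/|x|\<^sup>2\<close> is not demanded then (it can fail if \<open>N = 2\<close>).\<close>

definition hardy_core :: "'a::euclidean_space set \<Rightarrow> real \<Rightarrow> ('a \<Rightarrow> real) set" where
  "hardy_core \<Omega> \<mu> = {u \<in> test_functions \<Omega>.
     \<mu> \<noteq> 0 \<longrightarrow> integrable (lebesgue_on \<Omega>) (\<lambda>x. (u x)\<^sup>2 / (norm x)\<^sup>2)}"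

definition hardy_form :: "'a::euclidean_space set \<Rightarrow> real \<Rightarrow> ('a \<Rightarrow> real) \<Rightarrow> ('a \<Rightarrow> real) \<Rightarrow> real" where
  "hardy_form \<Omega> \<mu> u v =
     (LINT x|lebesgue_on \<Omega>. grad u x \<bullet> grad v x) +
     \<mu> * (LINT x|lebesgue_on \<Omega>. u x * v x / (norm x)\<^sup>2)"

definition hardy_norm :: "'a::euclidean_space set \<Rightarrow> real \<Rightarrow> ('a \<Rightarrow> real) \<Rightarrow> real" where
  "hardy_norm \<Omega> \<mu> u = sqrt (hardy_form \<Omega> \<mu> u u)"

text \<open>The completion \<open>H\<^sub>\<mu>(\<Omega>)\<close> is realised inside \<open>L\<^sup>2(\<Omega>)\<close>: for \<open>\<mu> \<ge> -(N-2)\<^sup>2/4\<close> the norm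
  controls the \<open>L\<^sup>2\<close> norm and the form is closable, so that an element of the completion is
  determined by the \<open>L\<^sup>2\<close> limit of a Cauchy sequence representing it.\<close>

definition hardy_approx ::
  "'a::euclidean_space set \<Rightarrow> real \<Rightarrow> (nat \<Rightarrow> 'a \<Rightarrow> real) \<Rightarrow> ('a \<Rightarrow> real) \<Rightarrow> bool" where
  "hardy_approx \<Omega> \<mu> w u \<longleftrightarrow>
     (\<forall>n. w n \<in> hardy_core \<Omega> \<mu>) \<and>
     (\<forall>e>0. \<exists>M. \<forall>m\<ge>M. \<forall>n\<ge>M. hardy_norm \<Omega> \<mu> (\<lambda>x. w m x - w n x) < e) \<and>
     u \<in> L2_on \<Omega> \<and> (\<lambda>n. L2_norm \<Omega> (\<lambda>x. w n x - u x)) \<longlonglongrightarrow> 0"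

definition hardy_space :: "'a::euclidean_space set \<Rightarrow> real \<Rightarrow> ('a \<Rightarrow> real) set" where
  "hardy_space \<Omega> \<mu> = {u. \<exists>w. hardy_approx \<Omega> \<mu> w u}"

text \<open>\<open>c\<close> is the value at \<open>(u, v)\<close> of the continuous extension of the form to \<open>H\<^sub>\<mu>(\<Omega>)\<close>. A relation,
  because the extension is a limit that is independent of the approximating sequences.\<close>

definition hardy_form_value ::
  "'a::euclidean_space set \<Rightarrow> real \<Rightarrow> ('a \<Rightarrow> real) \<Rightarrow> ('a \<Rightarrow> real) \<Rightarrow> real \<Rightarrow> bool" where
  "hardy_form_value \<Omega> \<mu> u v c \<longleftrightarrow>
     u \<in> hardy_space \<Omega> \<mu> \<and> v \<in> hardy_space \<Omega> \<mu> \<and>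
     (\<forall>w z. hardy_approx \<Omega> \<mu> w u \<longrightarrow> hardy_approx \<Omega> \<mu> z v \<longrightarrow>
        (\<lambda>n. hardy_form \<Omega> \<mu> (w n) (z n)) \<longlonglongrightarrow> c)"

text \<open>Graph of the Friedrichs operator: \<open>u\<close> is in its domain and is mapped to \<open>f\<close>.\<close>

definition hardy_operator ::
  "'a::euclidean_space set \<Rightarrow> real \<Rightarrow> ('a \<Rightarrow> real) \<Rightarrow> ('a \<Rightarrow> real) \<Rightarrow> bool" where
  "hardy_operator \<Omega> \<mu> u f \<longleftrightarrow>
     u \<in> hardy_space \<Omega> \<mu> \<and> f \<in> L2_on \<Omega> \<and>
     (\<forall>v\<in>hardy_space \<Omega> \<mu>. hardy_form_value \<Omega> \<mu> u v (L2_inner \<Omega> f v))"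

text \<open>The increasing sequence \<open>lam 1 \<le> lam 2 \<le> \<dots>\<close> of eigenvalues with multiplicity (the value
  \<open>lam 0\<close> is irrelevant). The resolvent is compact, so the eigenfunctions contain an orthonormal basis of
  \<open>L\<^sup>2(\<Omega>)\<close>. Totality of \<open>\<phi>\<close> is what forces every eigenvalue to be listed with its full
  multiplicity: eigenfunctions for distinct eigenvalues are orthogonal, hence the \<open>\<phi> k\<close> with
  \<open>lam k = t\<close> form a basis of the eigenspace of \<open>t\<close>.\<close>

definition dirichlet_eigenvalues ::
  "'a::euclidean_space set \<Rightarrow> real \<Rightarrow> (nat \<Rightarrow> real) \<Rightarrow> bool" where
  "dirichlet_eigenvalues \<Omega> \<mu> lam \<longleftrightarrow>
     (\<forall>k\<ge>1. lam k \<le> lam (Suc k)) \<and>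
     (\<exists>\<phi>. (\<forall>k\<ge>1. hardy_operator \<Omega> \<mu> (\<phi> k) (\<lambda>x. lam k * \<phi> k x)) \<and>
          (\<forall>i\<ge>1. \<forall>j\<ge>1. L2_inner \<Omega> (\<phi> i) (\<phi> j) = (if i = j then 1 else 0)) \<and>
          (\<forall>u\<in>L2_on \<Omega>. (\<forall>k\<ge>1. L2_inner \<Omega> u (\<phi> k) = 0) \<longrightarrow>
             (AE x in lebesgue_on \<Omega>. u x = 0)))"

text \<open>The critical Hardy constant \<open>\<mu>\<^sub>0\<close> in dimension \<open>N\<close>.\<close>

definition hardy_const :: "nat \<Rightarrow> real" where
  "hardy_const N = - (real N - 2)\<^sup>2 / 4"

end

theory Submission imports Defs begin

text \<open>For \<open>\<mu> \<ge> 0\<close> the functions \<open>x\<^sub>b \<phi>\<^sub>i\<close>, projected away from \<open>\<phi>\<^sub>1, \<dots>, \<phi>\<^sub>k\<close>, are admissible in the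
  variational characterisation of \<open>\<lambda>\<^sub>k\<^sub>+\<^sub>1\<close>. The potential commutes with multiplication by \<open>x\<^sub>b\<close>, so their
  Rayleigh quotients involve \<open>\<partial>\<^sub>b \<phi>\<^sub>i\<close> only, and since the potential is nonnegative one arrives at
  Yang's inequality \<open>N \<Sum>\<^sub>i (\<lambda>\<^sub>k\<^sub>+\<^sub>1 - \<lambda>\<^sub>i)\<^sup>2 \<le> 4 \<Sum>\<^sub>i (\<lambda>\<^sub>k\<^sub>+\<^sub>1 - \<lambda>\<^sub>i) \<lambda>\<^sub>i\<close>, exactly as for the Laplacian. The
  recursion of Cheng and Yang turns it into \<open>\<lambda>\<^sub>k\<^sub>+\<^sub>1 \<le> (1 + 4/N) k\<^bsup>2/N\<^esup> \<lambda>\<^sub>1\<close>. For \<open>\<mu> < 0\<close> the form is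
  at most the Dirichlet form plus \<open>\<mu> D\<^sub>0\<^sup>-\<^sup>2\<close> times the squared \<open>L\<^sup>2\<close> norm, so by min-max the eigenvalues are at most
  \<open>\<lambda>\<^sub>0\<^sub>,\<^sub>k + \<mu> D\<^sub>0\<^sup>-\<^sup>2\<close>; Hardy's inequality provides the nonnegativity of the form that min-max needs.\<close>

subsection \<open>The space of square-integrable functions\<close>

text \<open>The eigenfunctions are known only as elements of the form completion, without any
  regularity. Hence every identity is proved for test functions and passed to the limit along
  approximating sequences: the eigenvalue equation enters as a limit of values of the form, and
  \<partial>_b \<phi>_i is the L^2 limit of the derivatives of the approximants. That limit, and
  membership of x_b \<phi>_i in the form domain, rest on the form dominating the Dirichlet form. For
  \<mu> < 0 the inequality between the two forms reverses, which is why negative potentials are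
  compared with the Laplacian. The spectrum is specified by an operator and a total orthonormal
  system, so the variational inequality is itself derived, from a Bessel inequality for the form and
  Parseval's identity. The factor 4 is the square of the 2 in the commutator [L, x_b] = -2
  \<partial>_b; the factor N comes from summing over the coordinates. In the recursion, (1 + 2/N)
  (mean)^2 - (mean of squares) of the first k eigenvalues grows at most like k^(4/N), and a square
  root turns this into k^(2/N).\<close>

lemma quadratic_nonneg_imp_discriminant:
  fixes a b c :: real
  assumes "\<And>t. 0 \<le> a + 2 * t * b + t\<^sup>2 * c"
  shows "b\<^sup>2 \<le> a * c"
proof (cases "c = 0")
  case True
  have "b = 0"
  proof (rule ccontr)
    assume "b \<noteq> 0"
    \<comment> \<open>The expression is affine in t, and at this t it equals -1.\<close>
    then show False
      using assms[of "- (a + 1) / (2 * b)"] True by (simp add: field_simps)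
  qed
  with True show ?thesis by simp
next
  case False
  have "c \<ge> 0"
  proof (rule ccontr)
    assume n: "\<not> c \<ge> 0"
    \<comment> \<open>Chosen so large that \<open>t * \<bar>c\<bar>\<close> exceeds
      \<open>2 * \<bar>b\<bar> + \<bar>a\<bar>\<close>; the negative square then dominates the other
      terms.\<close>
    define t where "t = 2 * \<bar>b\<bar> / \<bar>c\<bar> + \<bar>a\<bar> / \<bar>c\<bar> + 1"
    have t1: "t \<ge> 1" unfolding t_def by simp
    have e: "t * \<bar>c\<bar> = 2 * \<bar>b\<bar> + \<bar>a\<bar> + \<bar>c\<bar>"
      using n unfolding t_def by (simp add: field_simps)
    have "a + 2 * t * b + t\<^sup>2 * c \<le> \<bar>a\<bar> + 2 * t * \<bar>b\<bar> - t * (t * \<bar>c\<bar>)"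
    proof -
      have "t * b \<le> t * \<bar>b\<bar>" using t1 by (intro mult_left_mono) auto
      then show ?thesis using n by (simp add: power2_eq_square algebra_simps)
    qed
    also have "\<dots> = \<bar>a\<bar> * (1 - t) - t * \<bar>c\<bar>" by (subst e) (simp add: algebra_simps)
    also have "\<dots> < 0"
      using t1 n mult_nonneg_nonpos[of "\<bar>a\<bar>" "1 - t"] by (smt (verit) mult_pos_pos)
    finally show False using assms[of t] by simp
  qed
  with False have c: "c > 0" by simp
  \<comment> \<open>t = -b/c is the minimiser of the parabola.\<close>
  have "0 \<le> a + 2 * (-b/c) * b + (-b/c)\<^sup>2 * c" by (rule assms)
  also have "\<dots> = a - b\<^sup>2 / c" using c by (simp add: power2_eq_square field_simps)
  finally show ?thesis using c by (simp add: field_simps)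
qed

section \<open>Linear structure, inner product and norm of L^2\<close>

lemma L2_on_measurable: "u \<in> L2_on \<Omega> \<Longrightarrow> u \<in> borel_measurable (lebesgue_on \<Omega>)"
  by (simp add: L2_on_def)

lemma L2_on_integrable_square: "u \<in> L2_on \<Omega> \<Longrightarrow> integrable (lebesgue_on \<Omega>) (\<lambda>x. (u x)\<^sup>2)"
  by (simp add: L2_on_def)

lemma abs_mult_le_sum_squares: "\<bar>a * b\<bar> \<le> a\<^sup>2 + (b::real)\<^sup>2"
proof -
  have "2 * (\<bar>a\<bar> * \<bar>b\<bar>) \<le> a\<^sup>2 + b\<^sup>2"
    using sum_squares_bound[of "\<bar>a\<bar>" "\<bar>b\<bar>"] by simp
  moreover have "0 \<le> \<bar>a\<bar> * \<bar>b\<bar>" by simp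
  ultimately show ?thesis unfolding abs_mult by linarith
qed

lemma L2_on_integrable_mult:
  assumes "u \<in> L2_on \<Omega>" "v \<in> L2_on \<Omega>"
  shows "integrable (lebesgue_on \<Omega>) (\<lambda>x. u x * v x)"
proof (rule Bochner_Integration.integrable_bound)
  show "integrable (lebesgue_on \<Omega>) (\<lambda>x. (u x)\<^sup>2 + (v x)\<^sup>2)"
    using assms by (auto simp: L2_on_def)
  show "(\<lambda>x. u x * v x) \<in> borel_measurable (lebesgue_on \<Omega>)"
    using assms[THEN L2_on_measurable] by simp
  show "AE x in lebesgue_on \<Omega>. norm (u x * v x) \<le> norm ((u x)\<^sup>2 + (v x)\<^sup>2)"
    using abs_mult_le_sum_squares by (intro AE_I2) (metis real_norm_def abs_ge_self order_trans)
qed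

lemma L2_on_add:
  assumes "u \<in> L2_on \<Omega>" "v \<in> L2_on \<Omega>"
  shows "(\<lambda>x. u x + v x) \<in> L2_on \<Omega>"
proof -
  have "integrable (lebesgue_on \<Omega>) (\<lambda>x. (u x)\<^sup>2 + (v x)\<^sup>2 + 2 * (u x * v x))"
    by (intro Bochner_Integration.integrable_add integrable_mult_right L2_on_integrable_square
        L2_on_integrable_mult assms)
  then show ?thesis
    using assms by (auto simp: L2_on_def power2_sum mult.assoc)
qed

lemma L2_on_scale: "u \<in> L2_on \<Omega> \<Longrightarrow> (\<lambda>x. c * u x) \<in> L2_on \<Omega>"
  by (auto simp: L2_on_def power_mult_distrib)

lemma L2_on_zero: "(\<lambda>x. 0) \<in> L2_on \<Omega>"
  by (simp add: L2_on_def)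

lemma L2_on_diff:
  assumes "u \<in> L2_on \<Omega>" "v \<in> L2_on \<Omega>"
  shows "(\<lambda>x. u x - v x) \<in> L2_on \<Omega>"
  using L2_on_add[OF assms(1) L2_on_scale[OF assms(2), of "-1"]] by simp

lemma L2_on_sum:
  "(\<And>i. i \<in> I \<Longrightarrow> u i \<in> L2_on \<Omega>) \<Longrightarrow> (\<lambda>x. \<Sum>i\<in>I. u i x) \<in> L2_on \<Omega>"
  by (induction I rule: infinite_finite_induct) (auto simp: L2_on_zero L2_on_add)

lemma L2_on_bounded_mult:
  assumes u: "u \<in> L2_on \<Omega>" and g: "g \<in> borel_measurable (lebesgue_on \<Omega>)"
    and B: "\<And>x. x \<in> \<Omega> \<Longrightarrow> \<bar>g x\<bar> \<le> B"
  shows "(\<lambda>x. g x * u x) \<in> L2_on \<Omega>"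
proof -
  have "integrable (lebesgue_on \<Omega>) (\<lambda>x. (g x * u x)\<^sup>2)"
  proof (rule Bochner_Integration.integrable_bound)
    show "integrable (lebesgue_on \<Omega>) (\<lambda>x. B\<^sup>2 * (u x)\<^sup>2)"
      using u by (auto simp: L2_on_def)
    show "(\<lambda>x. (g x * u x)\<^sup>2) \<in> borel_measurable (lebesgue_on \<Omega>)"
      using u[THEN L2_on_measurable] g by simp
    have "(g x)\<^sup>2 \<le> B\<^sup>2" if "x \<in> \<Omega>" for x
      using power_mono[OF B[OF that], of 2] by simp
    then show "AE x in lebesgue_on \<Omega>. norm ((g x * u x)\<^sup>2) \<le> norm (B\<^sup>2 * (u x)\<^sup>2)"
      by (intro AE_I2) (auto simp: power_mult_distrib mult_right_mono)
  qed
  then show ?thesis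
    using u g by (auto simp: L2_on_def)
qed

lemmas L2_on_intros = L2_on_add L2_on_scale L2_on_diff L2_on_sum L2_on_zero

lemma L2_inner_commute: "L2_inner \<Omega> u v = L2_inner \<Omega> v u"
  by (simp add: L2_inner_def mult.commute)

lemma L2_inner_scale_left: "L2_inner \<Omega> (\<lambda>x. c * u x) v = c * L2_inner \<Omega> u v"
  by (simp add: L2_inner_def mult.assoc)

lemma L2_inner_scale_right: "L2_inner \<Omega> v (\<lambda>x. c * u x) = c * L2_inner \<Omega> v u"
  by (simp add: L2_inner_commute[of _ v] L2_inner_scale_left)

lemma L2_inner_add_left:
  assumes "u \<in> L2_on \<Omega>" "v \<in> L2_on \<Omega>" "w \<in> L2_on \<Omega>"
  shows "L2_inner \<Omega> (\<lambda>x. u x + v x) w = L2_inner \<Omega> u w + L2_inner \<Omega> v w"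
  using assms by (simp add: L2_inner_def distrib_right L2_on_integrable_mult)

lemma L2_inner_diff_left:
  assumes "u \<in> L2_on \<Omega>" "v \<in> L2_on \<Omega>" "w \<in> L2_on \<Omega>"
  shows "L2_inner \<Omega> (\<lambda>x. u x - v x) w = L2_inner \<Omega> u w - L2_inner \<Omega> v w"
  using assms by (simp add: L2_inner_def left_diff_distrib L2_on_integrable_mult)

lemma L2_inner_add_right:
  assumes "u \<in> L2_on \<Omega>" "v \<in> L2_on \<Omega>" "w \<in> L2_on \<Omega>"
  shows "L2_inner \<Omega> w (\<lambda>x. u x + v x) = L2_inner \<Omega> w u + L2_inner \<Omega> w v"
  using L2_inner_add_left[OF assms] by (simp add: L2_inner_commute[of _ w])

lemma L2_inner_diff_right:
  assumes "u \<in> L2_on \<Omega>" "v \<in> L2_on \<Omega>" "w \<in> L2_on \<Omega>"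
  shows "L2_inner \<Omega> w (\<lambda>x. u x - v x) = L2_inner \<Omega> w u - L2_inner \<Omega> w v"
  using L2_inner_diff_left[OF assms] by (simp add: L2_inner_commute[of _ w])

lemma L2_inner_sum_left:
  assumes "\<And>i. i \<in> I \<Longrightarrow> u i \<in> L2_on \<Omega>" "w \<in> L2_on \<Omega>"
  shows "L2_inner \<Omega> (\<lambda>x. \<Sum>i\<in>I. u i x) w = (\<Sum>i\<in>I. L2_inner \<Omega> (u i) w)"
  using assms by (simp add: L2_inner_def sum_distrib_right L2_on_integrable_mult)

lemma L2_inner_sum_right:
  assumes "\<And>i. i \<in> I \<Longrightarrow> u i \<in> L2_on \<Omega>" "w \<in> L2_on \<Omega>"
  shows "L2_inner \<Omega> w (\<lambda>x. \<Sum>i\<in>I. u i x) = (\<Sum>i\<in>I. L2_inner \<Omega> w (u i))"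
  using L2_inner_sum_left[OF assms] by (simp add: L2_inner_commute[of _ w])

lemma L2_inner_self_nonneg: "0 \<le> L2_inner \<Omega> u u"
  by (simp add: L2_inner_def)

lemma L2_norm_nonneg: "0 \<le> L2_norm \<Omega> u"
  by (simp add: L2_norm_def L2_inner_self_nonneg)

lemma L2_norm_power2: "(L2_norm \<Omega> u)\<^sup>2 = L2_inner \<Omega> u u"
  by (simp add: L2_norm_def L2_inner_self_nonneg)

lemma L2_Cauchy_Schwarz_power2:
  assumes u: "u \<in> L2_on \<Omega>" and v: "v \<in> L2_on \<Omega>"
  shows "(L2_inner \<Omega> u v)\<^sup>2 \<le> L2_inner \<Omega> u u * L2_inner \<Omega> v v"
proof (rule quadratic_nonneg_imp_discriminant)
  fix t
  have "0 \<le> L2_inner \<Omega> (\<lambda>x. u x + t * v x) (\<lambda>x. u x + t * v x)"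
    by (rule L2_inner_self_nonneg)
  then show "0 \<le> L2_inner \<Omega> u u + 2 * t * L2_inner \<Omega> u v + t\<^sup>2 * L2_inner \<Omega> v v"
    using u v
    by (simp add: L2_inner_add_left L2_inner_add_right L2_inner_scale_left L2_inner_scale_right
        L2_on_intros L2_inner_commute[of _ v u] power2_eq_square algebra_simps)
qed

lemma L2_Cauchy_Schwarz:
  assumes "u \<in> L2_on \<Omega>" "v \<in> L2_on \<Omega>"
  shows "\<bar>L2_inner \<Omega> u v\<bar> \<le> L2_norm \<Omega> u * L2_norm \<Omega> v"
  using L2_Cauchy_Schwarz_power2[OF assms]
  by (metis L2_norm_def real_sqrt_abs real_sqrt_le_iff real_sqrt_mult)

lemma L2_norm_triangle:
  assumes u: "u \<in> L2_on \<Omega>" and v: "v \<in> L2_on \<Omega>"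
  shows "L2_norm \<Omega> (\<lambda>x. u x + v x) \<le> L2_norm \<Omega> u + L2_norm \<Omega> v"
proof (rule power2_le_imp_le)
  show "(L2_norm \<Omega> (\<lambda>x. u x + v x))\<^sup>2 \<le> (L2_norm \<Omega> u + L2_norm \<Omega> v)\<^sup>2"
    using L2_Cauchy_Schwarz[OF u v] u v
    by (simp add: L2_norm_power2 power2_sum L2_inner_add_left L2_inner_add_right
        L2_on_intros L2_inner_commute[of _ v u])
  show "0 \<le> L2_norm \<Omega> u + L2_norm \<Omega> v" by (simp add: L2_norm_nonneg)
qed

lemma L2_norm_scale: "L2_norm \<Omega> (\<lambda>x. c * u x) = \<bar>c\<bar> * L2_norm \<Omega> u"
  by (simp add: L2_norm_def L2_inner_scale_left L2_inner_scale_right real_sqrt_mult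
      flip: mult.assoc)

lemma L2_norm_minus_commute: "L2_norm \<Omega> (\<lambda>x. u x - v x) = L2_norm \<Omega> (\<lambda>x. v x - u x)"
  using L2_norm_scale[of \<Omega> "-1" "\<lambda>x. u x - v x"] by simp

lemma L2_norm_zero: "L2_norm \<Omega> (\<lambda>x. 0) = 0"
  by (simp add: L2_norm_def L2_inner_def)

lemma L2_norm_bounded_mult:
  assumes u: "u \<in> L2_on \<Omega>" and g: "g \<in> borel_measurable (lebesgue_on \<Omega>)"
    and B: "\<And>x. x \<in> \<Omega> \<Longrightarrow> \<bar>g x\<bar> \<le> B" "0 \<le> B"
  shows "L2_norm \<Omega> (\<lambda>x. g x * u x) \<le> B * L2_norm \<Omega> u"
proof (rule power2_le_imp_le)
  have *: "(g x)\<^sup>2 \<le> B\<^sup>2" if "x \<in> \<Omega>" for x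
    using power_mono[OF B(1)[OF that], of 2] by simp
  have "L2_inner \<Omega> (\<lambda>x. g x * u x) (\<lambda>x. g x * u x) \<le> (LINT x|lebesgue_on \<Omega>. B\<^sup>2 * (u x)\<^sup>2)"
    unfolding L2_inner_def
  proof (rule integral_mono)
    show "integrable (lebesgue_on \<Omega>) (\<lambda>x. g x * u x * (g x * u x))"
      by (rule L2_on_integrable_mult) (rule L2_on_bounded_mult[OF u g B(1)]; simp)+
    show "integrable (lebesgue_on \<Omega>) (\<lambda>x. B\<^sup>2 * (u x)\<^sup>2)"
      using u by (auto simp: L2_on_def)
    show "g x * u x * (g x * u x) \<le> B\<^sup>2 * (u x)\<^sup>2" if "x \<in> space (lebesgue_on \<Omega>)" for x
      using *[of x] that
      by (simp add: power2_eq_square[symmetric] power_mult_distrib mult_right_mono)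
  qed
  also have "\<dots> = B\<^sup>2 * L2_inner \<Omega> u u" by (simp add: L2_inner_def power2_eq_square)
  finally show "(L2_norm \<Omega> (\<lambda>x. g x * u x))\<^sup>2 \<le> (B * L2_norm \<Omega> u)\<^sup>2"
    by (simp add: L2_norm_power2 power_mult_distrib)
  show "0 \<le> B * L2_norm \<Omega> u" using B(2) by (simp add: L2_norm_nonneg)
qed

section \<open>Convergence in L^2\<close>

definition L2_lim :: "'a::euclidean_space set \<Rightarrow> (nat \<Rightarrow> 'a \<Rightarrow> real) \<Rightarrow> ('a \<Rightarrow> real) \<Rightarrow> bool" where
  "L2_lim \<Omega> w u \<longleftrightarrow> (\<forall>n. w n \<in> L2_on \<Omega>) \<and> u \<in> L2_on \<Omega> \<and>
     (\<lambda>n. L2_norm \<Omega> (\<lambda>x. w n x - u x)) \<longlonglongrightarrow> 0"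

lemma L2_lim_const: "u \<in> L2_on \<Omega> \<Longrightarrow> L2_lim \<Omega> (\<lambda>n. u) u"
  by (simp add: L2_lim_def L2_norm_zero)

lemma L2_lim_add:
  assumes "L2_lim \<Omega> w u" "L2_lim \<Omega> z v"
  shows "L2_lim \<Omega> (\<lambda>n x. w n x + z n x) (\<lambda>x. u x + v x)"
proof -
  have "(\<lambda>n. L2_norm \<Omega> (\<lambda>x. w n x + z n x - (u x + v x))) \<longlonglongrightarrow> 0"
  proof (rule tendsto_sandwich[OF _ _ tendsto_const])
    show "(\<lambda>n. L2_norm \<Omega> (\<lambda>x. w n x - u x) + L2_norm \<Omega> (\<lambda>x. z n x - v x)) \<longlonglongrightarrow> 0"
      using tendsto_add[of _ 0 _ _ 0] assms by (fastforce simp: L2_lim_def)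
    show "\<forall>\<^sub>F n in sequentially. L2_norm \<Omega> (\<lambda>x. w n x + z n x - (u x + v x))
       \<le> L2_norm \<Omega> (\<lambda>x. w n x - u x) + L2_norm \<Omega> (\<lambda>x. z n x - v x)"
    proof (rule always_eventually, rule allI)
      fix n
      have "L2_norm \<Omega> (\<lambda>x. (w n x - u x) + (z n x - v x))
        \<le> L2_norm \<Omega> (\<lambda>x. w n x - u x) + L2_norm \<Omega> (\<lambda>x. z n x - v x)"
        using assms by (intro L2_norm_triangle L2_on_intros) (auto simp: L2_lim_def)
      then show "L2_norm \<Omega> (\<lambda>x. w n x + z n x - (u x + v x))
       \<le> L2_norm \<Omega> (\<lambda>x. w n x - u x) + L2_norm \<Omega> (\<lambda>x. z n x - v x)"
        by (simp add: algebra_simps)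
    qed
  qed (simp add: L2_norm_nonneg)
  with assms show ?thesis by (auto simp: L2_lim_def intro: L2_on_intros)
qed

lemma L2_lim_bounded_mult:
  assumes w: "L2_lim \<Omega> w u" and g: "g \<in> borel_measurable (lebesgue_on \<Omega>)"
    and B: "\<And>x. x \<in> \<Omega> \<Longrightarrow> \<bar>g x\<bar> \<le> B" "0 \<le> B"
  shows "L2_lim \<Omega> (\<lambda>n x. g x * w n x) (\<lambda>x. g x * u x)"
proof -
  have "(\<lambda>n. L2_norm \<Omega> (\<lambda>x. g x * w n x - g x * u x)) \<longlonglongrightarrow> 0"
  proof (rule tendsto_sandwich[OF _ _ tendsto_const])
    show "(\<lambda>n. B * L2_norm \<Omega> (\<lambda>x. w n x - u x)) \<longlonglongrightarrow> 0"
      using w tendsto_mult_left[of _ 0 _ B] by (fastforce simp: L2_lim_def)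
    have "L2_norm \<Omega> (\<lambda>x. g x * w n x - g x * u x) \<le> B * L2_norm \<Omega> (\<lambda>x. w n x - u x)" for n
      using L2_norm_bounded_mult[OF _ g B, of "\<lambda>x. w n x - u x"] w
      by (simp add: L2_lim_def L2_on_diff right_diff_distrib)
    then show "\<forall>\<^sub>F n in sequentially. L2_norm \<Omega> (\<lambda>x. g x * w n x - g x * u x)
       \<le> B * L2_norm \<Omega> (\<lambda>x. w n x - u x)"
      by simp
  qed (simp add: L2_norm_nonneg)
  with w show ?thesis
    by (auto simp: L2_lim_def intro: L2_on_bounded_mult[OF _ g B(1)])
qed

lemma L2_lim_scale: "L2_lim \<Omega> w u \<Longrightarrow> L2_lim \<Omega> (\<lambda>n x. c * w n x) (\<lambda>x. c * u x)"
  using L2_lim_bounded_mult[of \<Omega> w u "\<lambda>x. c" "\<bar>c\<bar>"] by simp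

lemma L2_lim_inner:
  assumes "L2_lim \<Omega> w u" "L2_lim \<Omega> z v"
  shows "(\<lambda>n. L2_inner \<Omega> (w n) (z n)) \<longlonglongrightarrow> L2_inner \<Omega> u v"
proof -
  have L: "w n \<in> L2_on \<Omega>" "z n \<in> L2_on \<Omega>" "u \<in> L2_on \<Omega>" "v \<in> L2_on \<Omega>" for n
    using assms by (auto simp: L2_lim_def)
  define a where "a n = L2_norm \<Omega> (\<lambda>x. w n x - u x)" for n
  define b where "b n = L2_norm \<Omega> (\<lambda>x. z n x - v x)" for n
  have ab: "a \<longlonglongrightarrow> 0" "b \<longlonglongrightarrow> 0"
    using assms unfolding a_def b_def by (auto simp: L2_lim_def)
  have "(\<lambda>n. L2_inner \<Omega> (w n) (z n) - L2_inner \<Omega> u v) \<longlonglongrightarrow> 0"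
  proof (rule Lim_null_comparison)
    show "(\<lambda>n. a n * b n + a n * L2_norm \<Omega> v + L2_norm \<Omega> u * b n) \<longlonglongrightarrow> 0"
      by (rule tendsto_eq_intros ab | simp)+
    have "norm (L2_inner \<Omega> (w n) (z n) - L2_inner \<Omega> u v)
        \<le> a n * b n + a n * L2_norm \<Omega> v + L2_norm \<Omega> u * b n" for n
    proof -
      \<comment> \<open>Expanding around the limits leaves one quadratic and two linear error terms,
        each controlled by Cauchy-Schwarz.\<close>
      have "L2_inner \<Omega> (w n) (z n) - L2_inner \<Omega> u v =
        L2_inner \<Omega> (\<lambda>x. w n x - u x) (\<lambda>x. z n x - v x)
        + L2_inner \<Omega> (\<lambda>x. w n x - u x) v + L2_inner \<Omega> u (\<lambda>x. z n x - v x)"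
        using L by (simp add: L2_inner_diff_left L2_inner_diff_right L2_on_diff)
      then show ?thesis
        using L2_Cauchy_Schwarz[of "\<lambda>x. w n x - u x" \<Omega> "\<lambda>x. z n x - v x"]
          L2_Cauchy_Schwarz[of "\<lambda>x. w n x - u x" \<Omega> v]
          L2_Cauchy_Schwarz[of u \<Omega> "\<lambda>x. z n x - v x"] L
        unfolding a_def b_def by (simp add: L2_on_diff)
    qed
    then show "\<forall>\<^sub>F n in sequentially. norm (L2_inner \<Omega> (w n) (z n) - L2_inner \<Omega> u v)
        \<le> a n * b n + a n * L2_norm \<Omega> v + L2_norm \<Omega> u * b n" by simp
  qed
  then show ?thesis by (rule LIM_zero_cancel)
qed

lemma L2_lim_Cauchy:
  assumes "L2_lim \<Omega> w u" "e > 0"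
  shows "\<exists>M. \<forall>m\<ge>M. \<forall>n\<ge>M. L2_norm \<Omega> (\<lambda>x. w m x - w n x) < e"
proof -
  have "\<forall>\<^sub>F n in sequentially. L2_norm \<Omega> (\<lambda>x. w n x - u x) < e / 2"
    using assms by (intro order_tendstoD) (auto simp: L2_lim_def)
  then obtain M where M: "\<And>n. n \<ge> M \<Longrightarrow> L2_norm \<Omega> (\<lambda>x. w n x - u x) < e / 2"
    by (auto simp: eventually_sequentially)
  have "L2_norm \<Omega> (\<lambda>x. w m x - w n x) < e" if "m \<ge> M" "n \<ge> M" for m n
  proof -
    have "L2_norm \<Omega> (\<lambda>x. (w m x - u x) + (u x - w n x))
      \<le> L2_norm \<Omega> (\<lambda>x. w m x - u x) + L2_norm \<Omega> (\<lambda>x. u x - w n x)"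
      using assms by (intro L2_norm_triangle L2_on_diff) (auto simp: L2_lim_def)
    then show ?thesis
      using M[OF that(1)] M[OF that(2)] L2_norm_minus_commute[of \<Omega> u "w n"] by simp
  qed
  then show ?thesis by blast
qed

section \<open>Completeness of L^2 on sets of finite measure\<close>

lemma L2_nn_integral_square:
  assumes "u \<in> L2_on \<Omega>"
  shows "(\<integral>\<^sup>+x. ennreal ((u x)\<^sup>2) \<partial>lebesgue_on \<Omega>) = ennreal ((L2_norm \<Omega> u)\<^sup>2)"
  using assms by (subst nn_integral_eq_integral)
    (auto simp: L2_on_def L2_norm_power2, simp add: L2_inner_def power2_eq_square)

text \<open>A geometric rate is what makes the increments along the subsequence summable;
  \<open>q\<close> will be the L^2 distance between two members of a sequence.\<close>

lemma Cauchy_fast_subseq: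
  assumes "\<And>e. e > 0 \<Longrightarrow> \<exists>M. \<forall>m\<ge>M. \<forall>n\<ge>M. q m n < (e::real)"
  obtains r :: "nat \<Rightarrow> nat" where "strict_mono r" "\<And>k n m. r k \<le> n \<Longrightarrow> r k \<le> m \<Longrightarrow> q n m < (1/2) ^ k"
proof -
  have "\<forall>k. \<exists>M. \<forall>m\<ge>M. \<forall>n\<ge>M. q m n < (1/2) ^ k"
    using assms by simp
  then obtain M where M: "\<And>k m n. m \<ge> M k \<Longrightarrow> n \<ge> M k \<Longrightarrow> q m n < (1/2)^k"
    by metis
  \<comment> \<open>Summing the thresholds makes \<open>r k\<close> dominate \<open>M k\<close>;
    adding \<open>k\<close> makes the sequence strictly increasing.\<close>
  define r where "r k = (\<Sum>i\<le>k. M i) + k" for k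
  have "strict_mono r"
    unfolding strict_mono_Suc_iff r_def by simp
  moreover have "M k \<le> r k" for k
    unfolding r_def by (metis member_le_sum atMost_iff finite_atMost le_refl trans_le_add1 zero_le)
  ultimately show ?thesis using M that by (meson order_trans)
qed

text \<open>Riesz-Fischer. As the measure is finite, Cauchy-Schwarz against the constant 1 makes the
  increments of a fast subsequence summable in L^1, so the subsequence converges almost everywhere.
  Fatou's lemma transfers the Cauchy estimate to the pointwise limit, for all late members of the
  original sequence at once.\<close>

theorem L2_complete:
  assumes \<Omega>: "\<Omega> \<in> lmeasurable" and w: "\<And>n. w n \<in> L2_on \<Omega>"
    and C: "\<And>e. e > 0 \<Longrightarrow> \<exists>M. \<forall>m\<ge>M. \<forall>n\<ge>M. L2_norm \<Omega> (\<lambda>x. w m x - w n x) < e"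
  shows "\<exists>u. L2_lim \<Omega> w u"
proof -
  interpret finite_measure "lebesgue_on \<Omega>" using \<Omega> by (rule finite_measure_lebesgue_on)
  let ?M = "lebesgue_on \<Omega>"
  obtain r :: "nat \<Rightarrow> nat" where r: "strict_mono r"
    "\<And>k n m. r k \<le> n \<Longrightarrow> r k \<le> m \<Longrightarrow> L2_norm \<Omega> (\<lambda>x. w n x - w m x) < (1/2) ^ k"
    using Cauchy_fast_subseq[OF C] by metis
  define d where "d k x = w (r (Suc k)) x - w (r k) x" for k x
  have dL: "d k \<in> L2_on \<Omega>" for k unfolding d_def using w by (intro L2_on_diff)
  have oneL: "(\<lambda>x. 1) \<in> L2_on \<Omega>" by (simp add: L2_on_def)
  have wm [measurable]: "w n \<in> borel_measurable ?M" for n by (rule L2_on_measurable[OF w])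
  have dm [measurable]: "d n \<in> borel_measurable ?M" for n by (rule L2_on_measurable[OF dL])
  define K where "K = L2_norm \<Omega> (\<lambda>x. 1)"
  have K: "K \<ge> 0" unfolding K_def by (rule L2_norm_nonneg)
  have absL: "(\<lambda>x. \<bar>d k x\<bar>) \<in> L2_on \<Omega>" for k
    using dL[of k] by (simp add: L2_on_def)
  have "(\<integral>\<^sup>+x. ennreal \<bar>d k x\<bar> \<partial>?M) \<le> ennreal (K * (1/2)^k)" for k
  proof -
    have "integrable ?M (\<lambda>x. \<bar>d k x\<bar> * 1)" by (rule L2_on_integrable_mult[OF absL oneL])
    then have "(\<integral>\<^sup>+x. ennreal \<bar>d k x\<bar> \<partial>?M) = ennreal (L2_inner \<Omega> (\<lambda>x. \<bar>d k x\<bar>) (\<lambda>x. 1))"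
      by (subst nn_integral_eq_integral) (auto simp: L2_inner_def)
    also have "L2_inner \<Omega> (\<lambda>x. \<bar>d k x\<bar>) (\<lambda>x. 1) \<le> L2_norm \<Omega> (\<lambda>x. \<bar>d k x\<bar>) * K"
      unfolding K_def using L2_Cauchy_Schwarz[OF absL oneL, of k] by simp
    also have "L2_norm \<Omega> (\<lambda>x. \<bar>d k x\<bar>) = L2_norm \<Omega> (d k)"
      by (simp add: L2_norm_def L2_inner_def)
    also have "L2_norm \<Omega> (d k) * K \<le> (1/2)^k * K"
      using r(2)[of k "r (Suc k)" "r k"] r(1) K unfolding d_def
      by (intro mult_right_mono) (auto simp: strict_mono_less_eq)
    finally show ?thesis by (simp add: mult.commute ennreal_leI)
  qed
  then have "(\<Sum>k. \<integral>\<^sup>+x. ennreal \<bar>d k x\<bar> \<partial>?M) \<le> (\<Sum>k. ennreal (K * (1/2)^k))"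
    by (intro suminf_le) auto
  also have "\<dots> = ennreal (\<Sum>k. K * (1/2)^k)"
    using K by (intro suminf_ennreal2) (auto intro!: summable_mult summable_geometric)
  also have "\<dots> < \<infinity>" by simp
  finally have "(\<integral>\<^sup>+x. (\<Sum>k. ennreal \<bar>d k x\<bar>) \<partial>?M) < \<infinity>"
    by (subst nn_integral_suminf) auto
  then have "AE x in ?M. (\<Sum>k. ennreal \<bar>d k x\<bar>) \<noteq> \<infinity>"
    by (intro nn_integral_noteq_infinite) auto
  then have AEsum: "AE x in ?M. summable (\<lambda>k. d k x)"
  proof eventually_elim
    fix x assume "(\<Sum>k. ennreal \<bar>d k x\<bar>) \<noteq> \<infinity>"
    then have "summable (\<lambda>k. \<bar>d k x\<bar>)"
      by (intro summable_suminf_not_top) auto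
    then show "summable (\<lambda>k. d k x)" by (rule summable_rabs_cancel)
  qed
  \<comment> \<open>On the null set where the series diverges the value of \<open>suminf\<close> is
    unspecified; only measurability matters there.\<close>
  define u where "u x = w (r 0) x + (\<Sum>k. d k x)" for x
  have um [measurable]: "u \<in> borel_measurable ?M" unfolding u_def by measurable
  have AElim: "AE x in ?M. (\<lambda>k. w (r k) x) \<longlonglongrightarrow> u x"
    using AEsum
  proof eventually_elim
    fix x assume "summable (\<lambda>k. d k x)"
    then have "(\<lambda>n. w (r 0) x + (\<Sum>k<n. d k x)) \<longlonglongrightarrow> u x"
      unfolding u_def by (intro tendsto_intros summable_LIMSEQ)
    moreover have "(\<Sum>k<n. d k x) = w (r n) x - w (r 0) x" for n
      unfolding d_def by (rule sum_lessThan_telescope)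
    ultimately show "(\<lambda>k. w (r k) x) \<longlonglongrightarrow> u x" by simp
  qed
  have key: "(\<integral>\<^sup>+x. ennreal ((u x - w n x)\<^sup>2) \<partial>?M) \<le> ennreal (((1/2)^k)\<^sup>2)" if n: "r k \<le> n" for k n
  proof -
    have "(\<integral>\<^sup>+x. ennreal ((u x - w n x)\<^sup>2) \<partial>?M)
      = (\<integral>\<^sup>+x. liminf (\<lambda>l. ennreal ((w (r l) x - w n x)\<^sup>2)) \<partial>?M)"
    proof (rule nn_integral_cong_AE)
      show "AE x in ?M. ennreal ((u x - w n x)\<^sup>2) = liminf (\<lambda>l. ennreal ((w (r l) x - w n x)\<^sup>2))"
        using AElim
      proof eventually_elim
        fix x assume "(\<lambda>k. w (r k) x) \<longlonglongrightarrow> u x"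
        then have "(\<lambda>l. ennreal ((w (r l) x - w n x)\<^sup>2)) \<longlonglongrightarrow> ennreal ((u x - w n x)\<^sup>2)"
          by (intro tendsto_intros)
        then show "ennreal ((u x - w n x)\<^sup>2) = liminf (\<lambda>l. ennreal ((w (r l) x - w n x)\<^sup>2))"
          by (rule lim_imp_Liminf[symmetric, rotated]) simp
      qed
    qed
    also have "\<dots> \<le> liminf (\<lambda>l. \<integral>\<^sup>+x. ennreal ((w (r l) x - w n x)\<^sup>2) \<partial>?M)"
      by (intro nn_integral_liminf) measurable
    also have "\<dots> \<le> liminf (\<lambda>l. ennreal (((1/2)^k)\<^sup>2))"
    proof (rule Liminf_mono)
      show "\<forall>\<^sub>F l in sequentially. (\<integral>\<^sup>+x. ennreal ((w (r l) x - w n x)\<^sup>2) \<partial>?M) \<le> ennreal (((1/2)^k)\<^sup>2)"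
      proof (rule eventually_sequentiallyI)
        fix l assume "l \<ge> k"
        then have "L2_norm \<Omega> (\<lambda>x. w (r l) x - w n x) < (1/2)^k"
          using r n by (intro r(2)) (auto simp: strict_mono_less_eq)
        then show "(\<integral>\<^sup>+x. ennreal ((w (r l) x - w n x)\<^sup>2) \<partial>?M) \<le> ennreal (((1/2)^k)\<^sup>2)"
          using w by (subst L2_nn_integral_square)
            (auto intro!: L2_on_diff ennreal_leI power_mono L2_norm_nonneg)
      qed
    qed
    also have "\<dots> = ennreal (((1/2)^k)\<^sup>2)" by (simp add: Liminf_const)
    finally show ?thesis .
  qed
  have uwL: "(\<lambda>x. u x - w n x) \<in> L2_on \<Omega>" if "r 0 \<le> n" for n
    unfolding L2_on_def mem_Collect_eq
  proof
    show "(\<lambda>x. u x - w n x) \<in> borel_measurable ?M" by measurable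
    show "integrable ?M (\<lambda>x. (u x - w n x)\<^sup>2)"
      using key[OF that] by (intro integrableI_bounded) (auto simp: ennreal_less_top intro: le_less_trans)
  qed
  have uL: "u \<in> L2_on \<Omega>"
    using L2_on_add[OF uwL[of "r 0"] w[of "r 0"]] by simp
  have small: "L2_norm \<Omega> (\<lambda>x. u x - w n x) \<le> (1/2)^k" if "r k \<le> n" for k n
  proof -
    have "ennreal ((L2_norm \<Omega> (\<lambda>x. u x - w n x))\<^sup>2) \<le> ennreal (((1/2)^k)\<^sup>2)"
      using key[OF that] uL w by (subst L2_nn_integral_square[symmetric]) (auto intro: L2_on_diff)
    then have "(L2_norm \<Omega> (\<lambda>x. u x - w n x))\<^sup>2 \<le> ((1/2)^k)\<^sup>2"
      by (subst (asm) ennreal_le_iff) auto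
    then show ?thesis by (rule power2_le_imp_le) simp
  qed
  have "(\<lambda>n. L2_norm \<Omega> (\<lambda>x. w n x - u x)) \<longlonglongrightarrow> 0"
  proof (rule LIMSEQ_I)
    fix e :: real assume "e > 0"
    then obtain k where k: "(1/2)^k < e" using real_arch_pow_inv[of e "1/2"] by auto
    have "norm (L2_norm \<Omega> (\<lambda>x. w n x - u x) - 0) < e" if "n \<ge> r k" for n
      using small[OF that] k L2_norm_nonneg[of \<Omega>] L2_norm_minus_commute[of \<Omega> u "w n"] by simp
    then show "\<exists>no. \<forall>n\<ge>no. norm (L2_norm \<Omega> (\<lambda>x. w n x - u x) - 0) < e" by blast
  qed
  then show ?thesis using w uL by (auto simp: L2_lim_def)
qed

section \<open>Orthonormal bases: Bessel and Parseval\<close>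

lemma L2_inner_AE_zero:
  assumes "AE x in lebesgue_on \<Omega>. u x = 0"
  shows "L2_inner \<Omega> u v = 0"
proof -
  have "AE x in lebesgue_on \<Omega>. u x * v x = 0"
    using assms by eventually_elim simp
  then show ?thesis unfolding L2_inner_def by (rule integral_eq_zero_AE)
qed

locale L2_orthonormal_basis =
  fixes \<Omega> :: "'a::euclidean_space set" and \<phi> :: "nat \<Rightarrow> 'a \<Rightarrow> real"
  assumes lmeas: "\<Omega> \<in> lmeasurable"
    and \<phi>_L2: "\<And>k. k \<ge> 1 \<Longrightarrow> \<phi> k \<in> L2_on \<Omega>"
    and orthonormal: "\<And>i j. i \<ge> 1 \<Longrightarrow> j \<ge> 1 \<Longrightarrow> L2_inner \<Omega> (\<phi> i) (\<phi> j) = (if i = j then 1 else 0)"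
    and total: "\<And>u. u \<in> L2_on \<Omega> \<Longrightarrow> (\<And>k. k \<ge> 1 \<Longrightarrow> L2_inner \<Omega> u (\<phi> k) = 0) \<Longrightarrow>
      AE x in lebesgue_on \<Omega>. u x = 0"
begin

lemma inner_sum_basis:
  assumes "finite I" "\<And>i. i \<in> I \<Longrightarrow> i \<ge> 1" "k \<ge> 1"
  shows "L2_inner \<Omega> (\<lambda>x. \<Sum>i\<in>I. c i * \<phi> i x) (\<phi> k) = (if k \<in> I then c k else 0)"
proof -
  have "L2_inner \<Omega> (\<lambda>x. \<Sum>i\<in>I. c i * \<phi> i x) (\<phi> k) = (\<Sum>i\<in>I. c i * (if i = k then 1 else 0))"
    using assms by (subst L2_inner_sum_left)
      (auto simp: \<phi>_L2 L2_on_scale L2_inner_scale_left orthonormal intro!: sum.cong)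
  also have "\<dots> = (if k \<in> I then c k else 0)"
    using assms by (simp add: if_distrib[of "\<lambda>t. _ * t"] cong: if_cong)
  finally show ?thesis .
qed

lemma inner_sum_self:
  assumes "finite I" "\<And>i. i \<in> I \<Longrightarrow> i \<ge> 1"
  shows "L2_inner \<Omega> (\<lambda>x. \<Sum>i\<in>I. c i * \<phi> i x) (\<lambda>x. \<Sum>i\<in>I. c i * \<phi> i x) = (\<Sum>i\<in>I. (c i)\<^sup>2)"
proof -
  have "L2_inner \<Omega> (\<lambda>x. \<Sum>i\<in>I. c i * \<phi> i x) (\<lambda>x. \<Sum>i\<in>I. c i * \<phi> i x)
    = (\<Sum>k\<in>I. c k * L2_inner \<Omega> (\<lambda>x. \<Sum>i\<in>I. c i * \<phi> i x) (\<phi> k))"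
    using assms by (subst L2_inner_sum_right)
      (auto simp: \<phi>_L2 L2_on_scale L2_on_sum L2_inner_scale_right)
  also have "\<dots> = (\<Sum>i\<in>I. (c i)\<^sup>2)"
    using assms by (intro sum.cong) (auto simp: inner_sum_basis power2_eq_square)
  finally show ?thesis .
qed

lemma Bessel_identity:
  fixes u
  assumes I: "finite I" "\<And>i. i \<in> I \<Longrightarrow> i \<ge> 1" and u: "u \<in> L2_on \<Omega>"
  defines "r \<equiv> \<lambda>x. u x - (\<Sum>i\<in>I. L2_inner \<Omega> u (\<phi> i) * \<phi> i x)"
  shows "L2_inner \<Omega> r r = L2_inner \<Omega> u u - (\<Sum>i\<in>I. (L2_inner \<Omega> u (\<phi> i))\<^sup>2)"
proof -
  let ?s = "\<lambda>x. \<Sum>i\<in>I. L2_inner \<Omega> u (\<phi> i) * \<phi> i x"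
  have s: "?s \<in> L2_on \<Omega>" using I by (intro L2_on_intros \<phi>_L2) auto
  have us: "L2_inner \<Omega> u ?s = (\<Sum>i\<in>I. (L2_inner \<Omega> u (\<phi> i))\<^sup>2)"
    using I u by (subst L2_inner_sum_right)
      (auto simp: \<phi>_L2 L2_on_scale L2_inner_scale_right power2_eq_square)
  show ?thesis
    unfolding r_def using u s us inner_sum_self[OF I] L2_inner_commute[of \<Omega> ?s u]
    by (simp add: L2_inner_diff_left L2_inner_diff_right L2_on_diff)
qed

text \<open>Totality is given only as triviality of the orthogonal complement. Bessel makes the sums
  of squares convergent, completeness gives the partial sums of the expansion a limit, and the
  difference between \<open>u\<close> and that limit is orthogonal to the whole basis.\<close>

lemma Parseval:
  assumes u: "u \<in> L2_on \<Omega>"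
  shows "(\<lambda>M. \<Sum>i\<in>{1..M}. (L2_inner \<Omega> u (\<phi> i))\<^sup>2) \<longlonglongrightarrow> L2_inner \<Omega> u u"
proof -
  define c where "c i = L2_inner \<Omega> u (\<phi> i)" for i
  define s where "s M = (\<lambda>x. \<Sum>i\<in>{1..M}. c i * \<phi> i x)" for M :: nat
  define p where "p M = (\<Sum>i\<in>{1..M}. (c i)\<^sup>2)" for M :: nat
  have sL: "s M \<in> L2_on \<Omega>" for M unfolding s_def by (intro L2_on_intros \<phi>_L2) auto
  have "p M \<le> L2_inner \<Omega> u u" for M
    using Bessel_identity[of "{1..M}" u] u L2_inner_self_nonneg[of \<Omega>]
    unfolding p_def c_def by (smt (verit) atLeastAtMost_iff finite_atLeastAtMost)
  moreover have "incseq p" unfolding p_def by (intro incseq_SucI) simp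
  ultimately have "convergent p"
    using incseq_convergent[of p "L2_inner \<Omega> u u"] unfolding convergent_def by metis
  then have "Cauchy p" by (simp add: Cauchy_convergent_iff)
  have diff: "L2_inner \<Omega> (\<lambda>x. s m x - s n x) (\<lambda>x. s m x - s n x) = p m - p n" if "n \<le> m" for m n
  proof -
    have U: "{1..m} = {1..n} \<union> {n<..m}" "{1..n} \<inter> {n<..m} = {}" using that by auto
    have "s m x - s n x = (\<Sum>i\<in>{n<..m}. c i * \<phi> i x)" for x
      unfolding s_def U(1) by (subst sum.union_disjoint) auto
    moreover have "p m - p n = (\<Sum>i\<in>{n<..m}. (c i)\<^sup>2)"
      unfolding p_def U(1) by (subst sum.union_disjoint) auto
    ultimately show ?thesis using inner_sum_self[of "{n<..m}" c] by auto
  qed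
  have "\<exists>f. L2_lim \<Omega> s f"
  proof (rule L2_complete[OF lmeas sL])
    fix e :: real assume "e > 0"
    then obtain M where M: "\<And>m n. m \<ge> M \<Longrightarrow> n \<ge> M \<Longrightarrow> norm (p m - p n) < e\<^sup>2"
      using \<open>Cauchy p\<close> unfolding Cauchy_iff by (metis zero_less_power)
    have a: "L2_norm \<Omega> (\<lambda>x. s m x - s n x) < e" if "m \<ge> M" "n \<ge> M" "n \<le> m" for m n
    proof (rule power2_less_imp_less)
      show "(L2_norm \<Omega> (\<lambda>x. s m x - s n x))\<^sup>2 < e\<^sup>2"
        using M[OF that(1,2)] diff[OF that(3)] by (simp add: L2_norm_power2)
    qed (use \<open>e > 0\<close> in simp)
    then have "L2_norm \<Omega> (\<lambda>x. s m x - s n x) < e" if "m \<ge> M" "n \<ge> M" for m n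
      using that L2_norm_minus_commute[of \<Omega> "s m" "s n"] by (metis nle_le)
    then show "\<exists>M. \<forall>m\<ge>M. \<forall>n\<ge>M. L2_norm \<Omega> (\<lambda>x. s m x - s n x) < e" by blast
  qed
  then obtain f where f: "L2_lim \<Omega> s f" by blast
  have fL: "f \<in> L2_on \<Omega>" using f by (simp add: L2_lim_def)
  have fc: "L2_inner \<Omega> f (\<phi> k) = c k" if k: "k \<ge> 1" for k
  proof (rule LIMSEQ_unique)
    show "(\<lambda>n. L2_inner \<Omega> (s n) (\<phi> k)) \<longlonglongrightarrow> L2_inner \<Omega> f (\<phi> k)"
      by (intro L2_lim_inner f L2_lim_const \<phi>_L2 k)
    have "L2_inner \<Omega> (s n) (\<phi> k) = c k" if "n \<ge> k" for n
      unfolding s_def using k that by (subst inner_sum_basis) auto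
    then show "(\<lambda>n. L2_inner \<Omega> (s n) (\<phi> k)) \<longlonglongrightarrow> c k"
      by (intro tendsto_eventually eventually_sequentiallyI)
  qed
  have "AE x in lebesgue_on \<Omega>. u x - f x = 0"
    using u fL fc by (intro total) (auto simp: L2_on_diff L2_inner_diff_left \<phi>_L2 c_def)
  then have z: "L2_inner \<Omega> (\<lambda>x. u x - f x) v = 0" for v by (rule L2_inner_AE_zero)
  have "L2_inner \<Omega> u u = L2_inner \<Omega> f f"
    using z[of u] z[of f] u fL L2_inner_commute[of \<Omega> f u] by (simp add: L2_inner_diff_left)
  moreover have "(\<lambda>n. L2_inner \<Omega> (s n) (s n)) \<longlonglongrightarrow> L2_inner \<Omega> f f"
    by (intro L2_lim_inner f)
  moreover have "L2_inner \<Omega> (s n) (s n) = p n" for n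
    unfolding s_def p_def by (rule inner_sum_self) auto
  ultimately show ?thesis unfolding p_def c_def by simp
qed

end

subsection \<open>Test functions\<close>

abbreviation pd :: "'a::euclidean_space \<Rightarrow> ('a \<Rightarrow> real) \<Rightarrow> 'a \<Rightarrow> real" where
  "pd b u \<equiv> \<lambda>x. frechet_derivative u (at x) b"

lemma pd_eqI: "(f has_derivative f') (at x) \<Longrightarrow> pd b f x = f' b"
  using frechet_derivative_at by metis

lemma pd_add:
  "f differentiable at x \<Longrightarrow> g differentiable at x \<Longrightarrow> pd b (\<lambda>x. f x + g x) x = pd b f x + pd b g x"
  by (rule pd_eqI) (auto intro!: derivative_eq_intros simp: frechet_derivative_works)

lemma pd_mult:
  "f differentiable at x \<Longrightarrow> g differentiable at x \<Longrightarrow>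
    pd b (\<lambda>x. f x * g x) x = f x * pd b g x + pd b f x * g x"
  by (rule pd_eqI) (auto intro!: derivative_eq_intros simp: frechet_derivative_works)

lemma pd_const: "pd b (\<lambda>x. c) x = 0"
  by (rule pd_eqI) (auto intro!: derivative_eq_intros)

lemma pd_scale: "f differentiable at x \<Longrightarrow> pd b (\<lambda>x. c * f x) x = c * pd b f x"
  by (simp add: pd_mult pd_const)

lemma pd_diff:
  "f differentiable at x \<Longrightarrow> g differentiable at x \<Longrightarrow> pd b (\<lambda>x. f x - g x) x = pd b f x - pd b g x"
  by (rule pd_eqI) (auto intro!: derivative_eq_intros simp: frechet_derivative_works)

lemma pd_coord: "pd b (\<lambda>x. x \<bullet> c) x = b \<bullet> c"
  by (rule pd_eqI) (auto intro!: derivative_eq_intros)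

lemma Ck_on_differentiable: "Ck_on (Suc k) f UNIV \<Longrightarrow> f differentiable at x"
  by simp

lemma Ck_on_pd: "Ck_on (Suc k) f UNIV \<Longrightarrow> b \<in> Basis \<Longrightarrow> Ck_on k (pd b f) UNIV"
  by simp

lemma Ck_on_continuous: "Ck_on k f UNIV \<Longrightarrow> continuous_on UNIV f"
  by (cases k) (auto simp: continuous_on_eq_continuous_at differentiable_imp_continuous_within)

lemma Ck_on_Suc_imp: "Ck_on (Suc k) f UNIV \<Longrightarrow> Ck_on k f UNIV"
proof (induction k arbitrary: f)
  case 0
  then show ?case using Ck_on_continuous by (metis Ck_on.simps(1))
next
  case (Suc k)
  then show ?case by (metis Ck_on.simps(2))
qed

lemma Ck_on_const: "Ck_on k (\<lambda>x. c) UNIV"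
  by (induction k arbitrary: c) (auto simp: pd_const)

lemma Ck_on_coord: "Ck_on k (\<lambda>x. x \<bullet> c) UNIV"
  by (cases k) (auto simp: pd_coord Ck_on_const intro!: continuous_intros)

lemma Ck_on_add: "Ck_on k f UNIV \<Longrightarrow> Ck_on k g UNIV \<Longrightarrow> Ck_on k (\<lambda>x. f x + g x) UNIV"
  by (induction k arbitrary: f g) (auto simp: pd_add intro: continuous_on_add)

text \<open>The product rule lowers the order of one factor only, so \<open>Ck_on_Suc_imp\<close>
  has to bring the other down to order k before the induction hypothesis applies.\<close>

lemma Ck_on_mult: "Ck_on k f UNIV \<Longrightarrow> Ck_on k g UNIV \<Longrightarrow> Ck_on k (\<lambda>x. f x * g x) UNIV"
proof (induction k arbitrary: f g)
  case 0
  then show ?case by (auto intro: continuous_on_mult)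
next
  case (Suc k)
  have fg: "f differentiable at x" "g differentiable at x" for x
    using Suc.prems by auto
  have "Ck_on k (\<lambda>x. f x * pd b g x + pd b f x * g x) UNIV" if "b \<in> Basis" for b
    by (intro Ck_on_add Suc.IH Ck_on_pd[OF _ that] Suc.prems Ck_on_Suc_imp[OF Suc.prems(1)]
        Ck_on_Suc_imp[OF Suc.prems(2)])
  then show ?case using fg by (auto simp: pd_mult)
qed

lemma smooth_on_add: "smooth_on f UNIV \<Longrightarrow> smooth_on g UNIV \<Longrightarrow> smooth_on (\<lambda>x. f x + g x) UNIV"
  by (simp add: smooth_on_def Ck_on_add)

lemma smooth_on_mult: "smooth_on f UNIV \<Longrightarrow> smooth_on g UNIV \<Longrightarrow> smooth_on (\<lambda>x. f x * g x) UNIV"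
  by (simp add: smooth_on_def Ck_on_mult)

text \<open>An arbitrary compact set stands in for the closed support, so that sums, products and
  derivatives can be treated without computing supports.\<close>

definition cont_supp :: "'a::euclidean_space set \<Rightarrow> ('a \<Rightarrow> real) \<Rightarrow> bool" where
  "cont_supp \<Omega> f \<longleftrightarrow> continuous_on UNIV f \<and> (\<exists>K. compact K \<and> K \<subseteq> \<Omega> \<and> (\<forall>x. x \<notin> K \<longrightarrow> f x = 0))"

lemma cont_supp_add: "cont_supp \<Omega> f \<Longrightarrow> cont_supp \<Omega> g \<Longrightarrow> cont_supp \<Omega> (\<lambda>x. f x + g x)"
  unfolding cont_supp_def
proof (elim conjE exE, intro conjI)
  fix K L
  assume *: "compact K" "K \<subseteq> \<Omega>" "\<forall>x. x \<notin> K \<longrightarrow> f x = 0"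
    "compact L" "L \<subseteq> \<Omega>" "\<forall>x. x \<notin> L \<longrightarrow> g x = 0"
  show "\<exists>K. compact K \<and> K \<subseteq> \<Omega> \<and> (\<forall>x. x \<notin> K \<longrightarrow> f x + g x = 0)"
    using * by (intro exI[of _ "K \<union> L"]) auto
qed (auto intro: continuous_on_add)

lemma cont_supp_mult: "cont_supp \<Omega> f \<Longrightarrow> continuous_on UNIV g \<Longrightarrow> cont_supp \<Omega> (\<lambda>x. g x * f x)"
  unfolding cont_supp_def by (auto intro!: continuous_on_mult)

lemma cont_supp_lborel:
  assumes "cont_supp \<Omega> f"
  shows "integrable lborel f"
proof -
  obtain K where K: "compact K" "\<And>x. x \<notin> K \<Longrightarrow> f x = 0" and f: "continuous_on UNIV f"
    using assms by (auto simp: cont_supp_def)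
  have "integrable lborel (\<lambda>x. indicator K x *\<^sub>R f x)"
    using K f by (intro borel_integrable_compact) (auto intro: continuous_on_subset)
  also have "(\<lambda>x. indicator K x *\<^sub>R f x) = f"
    using K by (auto simp: fun_eq_iff indicator_def)
  finally show ?thesis .
qed

text \<open>Passes from the measure of the form to \<open>lborel\<close>, where translation
  invariance is available; the support in \<Omega> makes the restriction invisible.\<close>

lemma cont_supp_lebesgue_on:
  assumes "cont_supp \<Omega> f" "open \<Omega>"
  shows "integrable (lebesgue_on \<Omega>) f" "integral\<^sup>L (lebesgue_on \<Omega>) f = integral\<^sup>L lborel f"
proof -
  have eq: "(\<lambda>x. indicator \<Omega> x *\<^sub>R f x) = f"
    using assms by (auto simp: cont_supp_def fun_eq_iff indicator_def)
  have \<Omega>: "\<Omega> \<inter> space lebesgue \<in> sets lebesgue" using assms by simp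
  have I: "integrable lborel f" by (rule cont_supp_lborel[OF assms(1)])
  have fm: "f \<in> borel_measurable lborel" using I by simp
  show "integrable (lebesgue_on \<Omega>) f"
    using I integrable_completion[OF fm] by (simp only: integrable_restrict_space[OF \<Omega>] eq)
  show "integral\<^sup>L (lebesgue_on \<Omega>) f = integral\<^sup>L lborel f"
    using integral_completion[OF fm] by (simp only: integral_restrict_space[OF \<Omega>] eq)
qed

lemma cont_supp_L2_on:
  assumes "cont_supp \<Omega> f" "open \<Omega>"
  shows "f \<in> L2_on \<Omega>"
proof -
  have "cont_supp \<Omega> (\<lambda>x. f x * f x)"
    using assms by (intro cont_supp_mult) (auto simp: cont_supp_def)
  then show ?thesis
    using cont_supp_lebesgue_on[OF assms] cont_supp_lebesgue_on[of \<Omega> "\<lambda>x. f x * f x"] assms(2)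
    by (auto simp: L2_on_def power2_eq_square)
qed

lemma cont_supp_bounded:
  assumes "cont_supp \<Omega> f"
  obtains B where "B \<ge> 0" "\<And>x. \<bar>f x\<bar> \<le> B"
proof -
  obtain K where K: "compact K" "\<And>x. x \<notin> K \<Longrightarrow> f x = 0" and f: "continuous_on UNIV f"
    using assms by (auto simp: cont_supp_def)
  have "compact (f ` K)" using K f by (intro compact_continuous_image) (auto intro: continuous_on_subset)
  then have "bounded (f ` K)" by (rule compact_imp_bounded)
  then obtain B where B: "B > 0" "\<And>x. x \<in> K \<Longrightarrow> \<bar>f x\<bar> \<le> B" by (auto simp: bounded_pos)
  have "\<bar>f x\<bar> \<le> B" for x using B K(2) by (cases "x \<in> K") auto
  then show ?thesis using that[of B] B by simp
qed

lemma pd_cont_supp: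
  assumes f: "cont_supp \<Omega> f" and c: "continuous_on UNIV (pd b f)"
  shows "cont_supp \<Omega> (pd b f)"
proof -
  obtain K where K: "compact K" "K \<subseteq> \<Omega>" "\<And>x. x \<notin> K \<Longrightarrow> f x = 0"
    using f by (auto simp: cont_supp_def)
  have "pd b f x = 0" if "x \<notin> K" for x
  proof -
    have "((\<lambda>x. 0) has_derivative (\<lambda>x. 0)) (at x)" by simp
    then have "(f has_derivative (\<lambda>x. 0)) (at x)"
      by (rule has_derivative_transform_within_open[of _ _ _ _ "- K"])
        (use K that in \<open>auto simp: compact_imp_closed open_Compl\<close>)
    then show ?thesis by (rule pd_eqI)
  qed
  then show ?thesis using K c by (auto simp: cont_supp_def)
qed

text \<open>By translation invariance the difference quotients of \<open>f\<close> have integral zero.\<close>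

lemma integral_pd_eq_0:
  fixes f :: "'a::euclidean_space \<Rightarrow> real"
  assumes b: "b \<in> Basis" and f: "cont_supp \<Omega> f" and d: "\<And>x. f differentiable at x"
    and c: "continuous_on UNIV (pd b f)" and \<Omega>: "open \<Omega>"
  shows "integral\<^sup>L (lebesgue_on \<Omega>) (pd b f) = 0"
proof -
  obtain K where K: "compact K" "\<And>x. x \<notin> K \<Longrightarrow> f x = 0" and fc: "continuous_on UNIV f"
    using f by (auto simp: cont_supp_def)
  obtain R where R: "R > 0" "\<And>x. x \<in> K \<Longrightarrow> norm x \<le> R"
    using compact_imp_bounded[OF K(1)] by (auto simp: bounded_pos)
  have nb: "norm b = 1" using b by simp
  have cs: "cont_supp \<Omega> (pd b f)" by (rule pd_cont_supp[OF f c])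
  obtain B where B: "B \<ge> 0" "\<And>x. \<bar>pd b f x\<bar> \<le> B" using cont_supp_bounded[OF cs] by metis
  define t where "t n = 1 / real (Suc n)" for n
  have t: "t n > 0" "t n \<le> 1" for n unfolding t_def by (auto simp: field_simps)
  have t0: "t \<longlonglongrightarrow> 0" unfolding t_def using LIMSEQ_inverse_real_of_nat by (simp add: inverse_eq_divide)
  define s where "s n x = (f (t n *\<^sub>R b + x) - f x) / t n" for n x
  have line: "((\<lambda>r. f (r *\<^sub>R b + x)) has_real_derivative pd b f (r *\<^sub>R b + x)) (at r)" for r x
  proof -
    have "(f has_derivative frechet_derivative f (at (r *\<^sub>R b + x))) (at (r *\<^sub>R b + x))"
      using d by (simp add: frechet_derivative_works)
    moreover have "((\<lambda>r. r *\<^sub>R b + x) has_derivative (\<lambda>h. h *\<^sub>R b)) (at r)"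
      by (auto intro!: derivative_eq_intros)
    ultimately have "((\<lambda>r. f (r *\<^sub>R b + x)) has_derivative
        (\<lambda>h. frechet_derivative f (at (r *\<^sub>R b + x)) (h *\<^sub>R b))) (at r)"
      using has_derivative_compose by blast
    moreover have "linear (frechet_derivative f (at (r *\<^sub>R b + x)))"
      using d by (intro linear_frechet_derivative)
    ultimately show ?thesis
      by (simp add: has_field_derivative_def linear_cmul mult_commute_abs)
  qed
  have int: "integrable lborel f" by (rule cont_supp_lborel[OF f])
  have trans: "integrable lborel (\<lambda>x. f (a + x))" "integral\<^sup>L lborel (\<lambda>x. f (a + x)) = integral\<^sup>L lborel f" for a
  proof -
    show "integrable lborel (\<lambda>x. f (a + x))"
      using int lborel_distr_plus[of a] integrable_distr_eq[of "(+) a" lborel borel f]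
      by (simp add: borel_measurable_continuous_onI fc)
    show "integral\<^sup>L lborel (\<lambda>x. f (a + x)) = integral\<^sup>L lborel f"
      using lborel_distr_plus[of a] integral_distr[of "(+) a" lborel borel f]
      by (simp add: borel_measurable_continuous_onI fc)
  qed
  have "(\<lambda>n. integral\<^sup>L lborel (s n)) \<longlonglongrightarrow> integral\<^sup>L lborel (pd b f)"
  proof (rule integral_dominated_convergence)
    \<comment> \<open>Shifts of length at most 1 keep the supports of all quotients in this ball,
      and the mean value theorem bounds the quotients by the bound \<open>B\<close> of the partial
      derivative.\<close>
    show "integrable lborel (\<lambda>x. indicator (cball 0 (R + 1)) x *\<^sub>R B)"
      by (intro borel_integrable_compact) auto
    show "pd b f \<in> borel_measurable lborel" using c by (simp add: borel_measurable_continuous_onI)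
    have "continuous_on UNIV (s n)" for n
      unfolding s_def using t(1)[of n]
      by (intro continuous_intros fc continuous_on_compose2[OF fc]) auto
    then show "s n \<in> borel_measurable lborel" for n
      by (simp add: borel_measurable_continuous_onI)
    show "AE x in lborel. (\<lambda>n. s n x) \<longlonglongrightarrow> pd b f x"
    proof (rule AE_I2)
      fix x
      have "((\<lambda>h. (f (h *\<^sub>R b + x) - f x) / h) \<longlongrightarrow> pd b f x) (at 0)"
        using line[of x 0] by (simp add: DERIV_def)
      then show "(\<lambda>n. s n x) \<longlonglongrightarrow> pd b f x"
        unfolding s_def
        by (rule filterlim_compose)
          (use t0 less_imp_neq[OF t(1), symmetric] in \<open>auto simp: filterlim_at\<close>)
    qed
    show "AE x in lborel. norm (s n x) \<le> indicator (cball 0 (R + 1)) x *\<^sub>R B" for n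
    proof (rule AE_I2)
      fix x
      show "norm (s n x) \<le> indicator (cball 0 (R + 1)) x *\<^sub>R B"
      proof (cases "norm x \<le> R + 1")
        case True
        obtain z where "f (t n *\<^sub>R b + x) - f (0 *\<^sub>R b + x) = (t n - 0) * pd b f (z *\<^sub>R b + x)"
          using MVT2[of 0 "t n" "\<lambda>r. f (r *\<^sub>R b + x)" "\<lambda>r. pd b f (r *\<^sub>R b + x)"] line t by blast
        then have "s n x = pd b f (z *\<^sub>R b + x)" using t[of n] by (simp add: s_def)
        then show ?thesis using B True by simp
      next
        case False
        then have "x \<notin> K" using R(2)[of x] by auto
        moreover have "t n *\<^sub>R b + x \<notin> K"
        proof
          assume "t n *\<^sub>R b + x \<in> K"
          then have "norm (t n *\<^sub>R b + x) \<le> R" by (rule R(2))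
          moreover have "norm x \<le> norm (t n *\<^sub>R b + x) + norm (t n *\<^sub>R b)"
            using norm_triangle_ineq4[of "t n *\<^sub>R b + x" "t n *\<^sub>R b"] by simp
          ultimately show False using False t[of n] nb by simp
        qed
        ultimately show ?thesis using K False by (simp add: s_def)
      qed
    qed
  qed
  moreover have "integral\<^sup>L lborel (s n) = 0" for n
    unfolding s_def using trans[of "t n *\<^sub>R b"] int by simp
  ultimately have "integral\<^sup>L lborel (pd b f) = 0"
    using LIMSEQ_unique by (simp add: LIMSEQ_const_iff)
  then show ?thesis using cont_supp_lebesgue_on[OF cs \<Omega>] by simp
qed

section \<open>Algebra of test functions\<close>

lemma test_functions_iff:
  "u \<in> test_functions \<Omega> \<longleftrightarrow> smooth_on u UNIV \<and> cont_supp \<Omega> u"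
proof
  assume u: "u \<in> test_functions \<Omega>"
  then have s: "smooth_on u UNIV" by (simp add: test_functions_def)
  have "x \<notin> closure {x. u x \<noteq> 0} \<Longrightarrow> u x = 0" for x
    using closure_subset[of "{x. u x \<noteq> 0}"] by auto
  then show "smooth_on u UNIV \<and> cont_supp \<Omega> u"
    using u s Ck_on_continuous[of 0 u] unfolding test_functions_def cont_supp_def smooth_on_def by blast
next
  assume u: "smooth_on u UNIV \<and> cont_supp \<Omega> u"
  then obtain K where K: "compact K" "K \<subseteq> \<Omega>" "\<And>x. x \<notin> K \<Longrightarrow> u x = 0"
    by (auto simp: cont_supp_def)
  have sub: "closure {x. u x \<noteq> 0} \<subseteq> K"
    using K by (intro closure_minimal) (auto simp: compact_imp_closed)
  have "compact (closure {x. u x \<noteq> 0})"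
    using compact_Int_closed[OF K(1), of "closure {x. u x \<noteq> 0}"] sub by (simp add: Int_absorb1)
  then show "u \<in> test_functions \<Omega>" using u K sub by (auto simp: test_functions_def)
qed

lemma test_functions_differentiable: "u \<in> test_functions \<Omega> \<Longrightarrow> u differentiable at x"
  by (auto simp: test_functions_iff smooth_on_def intro: Ck_on_differentiable)

lemma test_functions_cont_supp: "u \<in> test_functions \<Omega> \<Longrightarrow> cont_supp \<Omega> u"
  by (simp add: test_functions_iff)

lemma test_functions_pd_cont_supp:
  assumes "u \<in> test_functions \<Omega>" "b \<in> Basis"
  shows "cont_supp \<Omega> (pd b u)"
proof (rule pd_cont_supp)
  show "continuous_on UNIV (pd b u)"
    using assms Ck_on_pd[of 0 u b] by (auto simp: test_functions_iff smooth_on_def)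
qed (use assms test_functions_cont_supp in auto)

lemma test_functions_add:
  "u \<in> test_functions \<Omega> \<Longrightarrow> v \<in> test_functions \<Omega> \<Longrightarrow> (\<lambda>x. u x + v x) \<in> test_functions \<Omega>"
  by (simp add: test_functions_iff smooth_on_add cont_supp_add)

lemma test_functions_mult:
  "u \<in> test_functions \<Omega> \<Longrightarrow> smooth_on g UNIV \<Longrightarrow> (\<lambda>x. g x * u x) \<in> test_functions \<Omega>"
  unfolding test_functions_iff
  by (auto simp: smooth_on_mult intro!: cont_supp_mult) (metis Ck_on.simps(1) smooth_on_def)

lemma test_functions_scale: "u \<in> test_functions \<Omega> \<Longrightarrow> (\<lambda>x. c * u x) \<in> test_functions \<Omega>"
  by (rule test_functions_mult) (simp_all add: smooth_on_def Ck_on_const)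

lemma test_functions_diff:
  "u \<in> test_functions \<Omega> \<Longrightarrow> v \<in> test_functions \<Omega> \<Longrightarrow> (\<lambda>x. u x - v x) \<in> test_functions \<Omega>"
  using test_functions_add[OF _ test_functions_scale[of v \<Omega> "-1"], of u] by simp

lemma test_functions_coord: "u \<in> test_functions \<Omega> \<Longrightarrow> (\<lambda>x. (x \<bullet> b) * u x) \<in> test_functions \<Omega>"
  by (rule test_functions_mult) (simp_all add: smooth_on_def Ck_on_coord)

subsection \<open>The Hardy form on test functions\<close>

text \<open>The gradient term of \<open>hardy_form\<close>, split by coordinates so that the scalar
  L^2 calculus applies to each partial derivative separately.\<close>

definition dirichlet_form :: "'a::euclidean_space set \<Rightarrow> ('a \<Rightarrow> real) \<Rightarrow> ('a \<Rightarrow> real) \<Rightarrow> real" where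
  "dirichlet_form \<Omega> u v = (\<Sum>b\<in>Basis. L2_inner \<Omega> (pd b u) (pd b v))"

locale bounded_open =
  fixes \<Omega> :: "'a::euclidean_space set"
  assumes open_\<Omega>: "open \<Omega>" and bounded_\<Omega>: "bounded \<Omega>"
begin

lemma lmeasurable_\<Omega>: "\<Omega> \<in> lmeasurable"
  using open_\<Omega> bounded_\<Omega> by (rule lmeasurable_open[rotated])

lemma tf_L2: "u \<in> test_functions \<Omega> \<Longrightarrow> u \<in> L2_on \<Omega>"
  by (intro cont_supp_L2_on test_functions_cont_supp open_\<Omega>)

lemma tf_pd_L2: "u \<in> test_functions \<Omega> \<Longrightarrow> b \<in> Basis \<Longrightarrow> pd b u \<in> L2_on \<Omega>"
  by (intro cont_supp_L2_on test_functions_pd_cont_supp open_\<Omega>)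

lemma coord_measurable: "(\<lambda>x. x \<bullet> b) \<in> borel_measurable (lebesgue_on \<Omega>)"
  by (intro measurable_restrict_space1 measurable_completion) simp

lemma coord_bound:
  obtains R where "R \<ge> 0" "\<And>x b. x \<in> \<Omega> \<Longrightarrow> b \<in> Basis \<Longrightarrow> \<bar>x \<bullet> b\<bar> \<le> R"
proof -
  obtain R where "R > 0" "\<And>x. x \<in> \<Omega> \<Longrightarrow> norm x \<le> R"
    using bounded_\<Omega> by (auto simp: bounded_pos)
  then show ?thesis
    using that[of R] by (meson Basis_le_norm order_trans less_imp_le)
qed

lemma L2_on_coord: "b \<in> Basis \<Longrightarrow> u \<in> L2_on \<Omega> \<Longrightarrow> (\<lambda>x. (x \<bullet> b) * u x) \<in> L2_on \<Omega>"
  by (metis coord_bound L2_on_bounded_mult[OF _ coord_measurable])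

lemma L2_lim_coord:
  "b \<in> Basis \<Longrightarrow> L2_lim \<Omega> w u \<Longrightarrow> L2_lim \<Omega> (\<lambda>n x. (x \<bullet> b) * w n x) (\<lambda>x. (x \<bullet> b) * u x)"
  by (metis coord_bound L2_lim_bounded_mult[OF _ coord_measurable])

text \<open>The derivative of the product has integral zero, since the product is again a test
  function.\<close>

lemma pd_integration_by_parts:
  assumes u: "u \<in> test_functions \<Omega>" and v: "v \<in> test_functions \<Omega>" and b: "b \<in> Basis"
  shows "L2_inner \<Omega> (pd b u) v = - L2_inner \<Omega> u (pd b v)"
proof -
  have d: "u differentiable at x" "v differentiable at x" for x
    using u v by (auto intro: test_functions_differentiable)
  have pd: "pd b (\<lambda>x. u x * v x) = (\<lambda>x. u x * pd b v x + pd b u x * v x)"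
    using d by (simp add: pd_mult)
  have uv: "(\<lambda>x. u x * v x) \<in> test_functions \<Omega>"
    using u v by (intro test_functions_mult) (auto simp: test_functions_iff)
  have "integral\<^sup>L (lebesgue_on \<Omega>) (pd b (\<lambda>x. u x * v x)) = 0"
  proof (rule integral_pd_eq_0[OF b _ _ _ open_\<Omega>])
    show "continuous_on UNIV (pd b (\<lambda>x. u x * v x))"
      using test_functions_pd_cont_supp[OF uv b] by (simp add: cont_supp_def)
  qed (use uv test_functions_cont_supp test_functions_differentiable in auto)
  moreover have "integral\<^sup>L (lebesgue_on \<Omega>) (pd b (\<lambda>x. u x * v x))
    = L2_inner \<Omega> u (pd b v) + L2_inner \<Omega> (pd b u) v"
    unfolding pd L2_inner_def using u v b
    by (intro Bochner_Integration.integral_add L2_on_integrable_mult tf_L2 tf_pd_L2)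
  ultimately show ?thesis by simp
qed

lemma hardy_form_eq:
  assumes "u \<in> test_functions \<Omega>" "v \<in> test_functions \<Omega>"
  shows "hardy_form \<Omega> \<mu> u v = dirichlet_form \<Omega> u v +
    \<mu> * (LINT x|lebesgue_on \<Omega>. u x * v x / (norm x)\<^sup>2)"
proof -
  have "grad u x \<bullet> grad v x = (\<Sum>b\<in>Basis. pd b u x * pd b v x)" for x
    unfolding grad_def by (subst euclidean_inner) (simp add: inner_sum_left inner_Basis if_distrib cong: if_cong)
  then have "(LINT x|lebesgue_on \<Omega>. grad u x \<bullet> grad v x) = dirichlet_form \<Omega> u v"
    using assms by (simp add: dirichlet_form_def L2_inner_def L2_on_integrable_mult tf_pd_L2)
  then show ?thesis by (simp add: hardy_form_def)
qed

section \<open>The core and bilinearity of the form\<close>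

lemma core_tf: "u \<in> hardy_core \<Omega> \<mu> \<Longrightarrow> u \<in> test_functions \<Omega>"
  by (simp add: hardy_core_def)

lemma core_L2: "u \<in> hardy_core \<Omega> \<mu> \<Longrightarrow> u \<in> L2_on \<Omega>"
  by (intro tf_L2 core_tf)

lemma core_measurable: "u \<in> hardy_core \<Omega> \<mu> \<Longrightarrow> u \<in> borel_measurable (lebesgue_on \<Omega>)"
  by (intro L2_on_measurable core_L2)

lemma norm_measurable: "norm \<in> borel_measurable (lebesgue_on \<Omega>)"
  by (intro measurable_restrict_space1 measurable_completion) simp

lemma core_singular_integrable:
  assumes "u \<in> hardy_core \<Omega> \<mu>" "v \<in> hardy_core \<Omega> \<mu>" "\<mu> \<noteq> 0"
  shows "integrable (lebesgue_on \<Omega>) (\<lambda>x. u x * v x / (norm x)\<^sup>2)"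
proof (rule Bochner_Integration.integrable_bound)
  show "integrable (lebesgue_on \<Omega>) (\<lambda>x. (u x)\<^sup>2 / (norm x)\<^sup>2 + (v x)\<^sup>2 / (norm x)\<^sup>2)"
    using assms by (auto simp: hardy_core_def)
  show "(\<lambda>x. u x * v x / (norm x)\<^sup>2) \<in> borel_measurable (lebesgue_on \<Omega>)"
    using assms(1,2)[THEN core_measurable] norm_measurable by simp
  have "\<bar>u x * v x\<bar> / (norm x)\<^sup>2 \<le> ((u x)\<^sup>2 + (v x)\<^sup>2) / (norm x)\<^sup>2" for x
    by (intro divide_right_mono abs_mult_le_sum_squares) simp
  then show "AE x in lebesgue_on \<Omega>. norm (u x * v x / (norm x)\<^sup>2)
      \<le> norm ((u x)\<^sup>2 / (norm x)\<^sup>2 + (v x)\<^sup>2 / (norm x)\<^sup>2)"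
    by (intro AE_I2) (simp add: abs_divide flip: add_divide_distrib)
qed

lemma hardy_form_commute: "hardy_form \<Omega> \<mu> u v = hardy_form \<Omega> \<mu> v u"
  by (simp add: hardy_form_def inner_commute mult.commute)

lemma core_scale: "u \<in> hardy_core \<Omega> \<mu> \<Longrightarrow> (\<lambda>x. c * u x) \<in> hardy_core \<Omega> \<mu>"
  by (simp add: hardy_core_def test_functions_scale power_mult_distrib flip: times_divide_eq_right)

lemma core_add:
  assumes "u \<in> hardy_core \<Omega> \<mu>" "v \<in> hardy_core \<Omega> \<mu>"
  shows "(\<lambda>x. u x + v x) \<in> hardy_core \<Omega> \<mu>"
proof -
  have "integrable (lebesgue_on \<Omega>) (\<lambda>x. (u x + v x)\<^sup>2 / (norm x)\<^sup>2)" if "\<mu> \<noteq> 0"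
  proof -
    have "integrable (lebesgue_on \<Omega>)
      (\<lambda>x. u x * u x / (norm x)\<^sup>2 + v x * v x / (norm x)\<^sup>2 + 2 * (u x * v x / (norm x)\<^sup>2))"
      using assms that
      by (intro Bochner_Integration.integrable_add integrable_mult_right core_singular_integrable)
    then show ?thesis by (simp add: power2_eq_square add_divide_distrib algebra_simps)
  qed
  with assms show ?thesis by (auto simp: hardy_core_def test_functions_add)
qed

lemma core_diff:
  assumes "u \<in> hardy_core \<Omega> \<mu>" "v \<in> hardy_core \<Omega> \<mu>"
  shows "(\<lambda>x. u x - v x) \<in> hardy_core \<Omega> \<mu>"
  using core_add[OF assms(1) core_scale[OF assms(2), of "-1"]] by simp

lemma core_zero: "(\<lambda>x. 0) \<in> hardy_core \<Omega> \<mu>"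
  by (auto simp: hardy_core_def test_functions_iff smooth_on_def Ck_on_const cont_supp_def intro!: exI[of _ "{}"])

lemma core_sum: "(\<And>i. i \<in> I \<Longrightarrow> u i \<in> hardy_core \<Omega> \<mu>) \<Longrightarrow> (\<lambda>x. \<Sum>i\<in>I. u i x) \<in> hardy_core \<Omega> \<mu>"
  by (induction I rule: infinite_finite_induct) (auto simp: core_add core_zero)

text \<open>Coordinates are bounded on \<Omega>, so the singular integral grows at most by the
  factor \<open>R\<^sup>2\<close>. Such products are the raw material of Yang's trial
  functions.\<close>

lemma core_coord:
  assumes "u \<in> hardy_core \<Omega> \<mu>" "b \<in> Basis"
  shows "(\<lambda>x. (x \<bullet> b) * u x) \<in> hardy_core \<Omega> \<mu>"
proof -
  obtain R where R: "R \<ge> 0" "\<And>x b. x \<in> \<Omega> \<Longrightarrow> b \<in> Basis \<Longrightarrow> \<bar>x \<bullet> b\<bar> \<le> R"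
    using coord_bound by metis
  have "integrable (lebesgue_on \<Omega>) (\<lambda>x. ((x \<bullet> b) * u x)\<^sup>2 / (norm x)\<^sup>2)" if "\<mu> \<noteq> 0"
  proof (rule Bochner_Integration.integrable_bound)
    show "integrable (lebesgue_on \<Omega>) (\<lambda>x. R\<^sup>2 * ((u x)\<^sup>2 / (norm x)\<^sup>2))"
      using assms that by (intro integrable_mult_right) (auto simp: hardy_core_def)
    show "(\<lambda>x. ((x \<bullet> b) * u x)\<^sup>2 / (norm x)\<^sup>2) \<in> borel_measurable (lebesgue_on \<Omega>)"
      using assms(1)[THEN core_measurable] norm_measurable coord_measurable[of b] by simp
    have "(x \<bullet> b)\<^sup>2 \<le> R\<^sup>2" if "x \<in> \<Omega>" for x
      using power_mono[OF R(2)[OF that assms(2)], of 2] by simp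
    then show "AE x in lebesgue_on \<Omega>. norm (((x \<bullet> b) * u x)\<^sup>2 / (norm x)\<^sup>2)
        \<le> norm (R\<^sup>2 * ((u x)\<^sup>2 / (norm x)\<^sup>2))"
      by (intro AE_I2) (auto simp: power_mult_distrib intro!: divide_right_mono mult_right_mono)
  qed
  with assms show ?thesis by (auto simp: hardy_core_def test_functions_coord)
qed

lemma dirichlet_form_scale_left:
  "u \<in> test_functions \<Omega> \<Longrightarrow> dirichlet_form \<Omega> (\<lambda>x. c * u x) v = c * dirichlet_form \<Omega> u v"
  by (simp add: dirichlet_form_def pd_scale test_functions_differentiable L2_inner_scale_left
      sum_distrib_left)

lemma dirichlet_form_add_left:
  assumes "u \<in> test_functions \<Omega>" "v \<in> test_functions \<Omega>" "w \<in> test_functions \<Omega>"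
  shows "dirichlet_form \<Omega> (\<lambda>x. u x + v x) w = dirichlet_form \<Omega> u w + dirichlet_form \<Omega> v w"
  using assms by (simp add: dirichlet_form_def pd_add test_functions_differentiable
      L2_inner_add_left tf_pd_L2 sum.distrib)

lemma hardy_form_scale_left:
  assumes "u \<in> hardy_core \<Omega> \<mu>" "v \<in> hardy_core \<Omega> \<mu>"
  shows "hardy_form \<Omega> \<mu> (\<lambda>x. c * u x) v = c * hardy_form \<Omega> \<mu> u v"
proof -
  have "(LINT x|lebesgue_on \<Omega>. c * u x * v x / (norm x)\<^sup>2)
    = c * (LINT x|lebesgue_on \<Omega>. u x * v x / (norm x)\<^sup>2)"
    by (simp add: mult.assoc flip: times_divide_eq_right)
  with assms[THEN core_tf] show ?thesis
    by (simp add: hardy_form_eq test_functions_scale dirichlet_form_scale_left algebra_simps)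
qed

lemma hardy_form_add_left:
  assumes "u \<in> hardy_core \<Omega> \<mu>" "v \<in> hardy_core \<Omega> \<mu>" "w \<in> hardy_core \<Omega> \<mu>"
  shows "hardy_form \<Omega> \<mu> (\<lambda>x. u x + v x) w = hardy_form \<Omega> \<mu> u w + hardy_form \<Omega> \<mu> v w"
proof -
  \<comment> \<open>For \<mu> = 0 the singular integrals may diverge, and the default value 0 of a
    divergent integral is not additive; the factor \<mu> is what saves the identity, so it is kept
    in front.\<close>
  have "\<mu> * (LINT x|lebesgue_on \<Omega>. (u x + v x) * w x / (norm x)\<^sup>2)
    = \<mu> * (LINT x|lebesgue_on \<Omega>. u x * w x / (norm x)\<^sup>2) + \<mu> * (LINT x|lebesgue_on \<Omega>. v x * w x / (norm x)\<^sup>2)"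
    using assms by (cases "\<mu> = 0") (simp_all add: distrib_right add_divide_distrib core_singular_integrable distrib_left)
  with assms[THEN core_tf] show ?thesis
    by (simp add: hardy_form_eq test_functions_add dirichlet_form_add_left)
qed

lemma hardy_form_add_right:
  assumes "u \<in> hardy_core \<Omega> \<mu>" "v \<in> hardy_core \<Omega> \<mu>" "w \<in> hardy_core \<Omega> \<mu>"
  shows "hardy_form \<Omega> \<mu> w (\<lambda>x. u x + v x) = hardy_form \<Omega> \<mu> w u + hardy_form \<Omega> \<mu> w v"
  using hardy_form_add_left[OF assms] by (simp add: hardy_form_commute[of _ w])

lemma hardy_form_diff_left:
  assumes "u \<in> hardy_core \<Omega> \<mu>" "v \<in> hardy_core \<Omega> \<mu>" "w \<in> hardy_core \<Omega> \<mu>"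
  shows "hardy_form \<Omega> \<mu> (\<lambda>x. u x - v x) w = hardy_form \<Omega> \<mu> u w - hardy_form \<Omega> \<mu> v w"
  using hardy_form_add_left[OF assms(1) core_scale[OF assms(2), of "-1"] assms(3)]
    hardy_form_scale_left[OF assms(2,3), of "-1"] by simp

lemma hardy_form_diff_right:
  assumes "u \<in> hardy_core \<Omega> \<mu>" "v \<in> hardy_core \<Omega> \<mu>" "w \<in> hardy_core \<Omega> \<mu>"
  shows "hardy_form \<Omega> \<mu> w (\<lambda>x. u x - v x) = hardy_form \<Omega> \<mu> w u - hardy_form \<Omega> \<mu> w v"
  using hardy_form_diff_left[OF assms] by (simp add: hardy_form_commute[of _ w])

lemma hardy_form_sum_left:
  assumes "\<And>i. i \<in> I \<Longrightarrow> u i \<in> hardy_core \<Omega> \<mu>" "w \<in> hardy_core \<Omega> \<mu>"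
  shows "hardy_form \<Omega> \<mu> (\<lambda>x. \<Sum>i\<in>I. c i * u i x) w = (\<Sum>i\<in>I. c i * hardy_form \<Omega> \<mu> (u i) w)"
  using assms(1)
proof (induction I rule: infinite_finite_induct)
  case (insert i I)
  then show ?case
    using assms(2) by (simp add: hardy_form_add_left hardy_form_scale_left core_scale core_sum)
qed (use hardy_form_scale_left[OF core_zero assms(2), of 0] in auto)

lemma hardy_form_sum_right:
  assumes "\<And>i. i \<in> I \<Longrightarrow> u i \<in> hardy_core \<Omega> \<mu>" "w \<in> hardy_core \<Omega> \<mu>"
  shows "hardy_form \<Omega> \<mu> w (\<lambda>x. \<Sum>i\<in>I. c i * u i x) = (\<Sum>i\<in>I. c i * hardy_form \<Omega> \<mu> w (u i))"
  using hardy_form_sum_left[OF assms] by (simp add: hardy_form_commute[of _ w])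

text \<open>Covers the divergent case too, where the integral has the default value 0.\<close>

lemma singular_integral_nonneg: "0 \<le> (LINT x|lebesgue_on \<Omega>. u x * u x / (norm x)\<^sup>2)"
  by (rule integral_nonneg_AE) simp

lemma dirichlet_form_self_nonneg: "0 \<le> dirichlet_form \<Omega> u u"
  unfolding dirichlet_form_def by (intro sum_nonneg L2_inner_self_nonneg)

lemma dirichlet_form_le_hardy_form:
  assumes "\<mu> \<ge> 0" "u \<in> test_functions \<Omega>"
  shows "dirichlet_form \<Omega> u u \<le> hardy_form \<Omega> \<mu> u u"
  using assms singular_integral_nonneg by (simp add: hardy_form_eq)

section \<open>Hardy's inequality and positivity of the form\<close>

lemma AE_nonzero: "AE x in lebesgue_on \<Omega>. x \<noteq> 0"
proof -
  have "AE x in lebesgue. x \<noteq> (0::'a)"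
    by (intro AE_completion AE_lborel_singleton)
  then show ?thesis
    using lmeasurable_\<Omega> by (subst AE_restrict_space_iff) (auto simp: fmeasurableD)
qed

text \<open>The field \<open>(N - 2)/2 \<cdot> x/(|x|\<^sup>2 + \<epsilon>)\<close> regularises the one that gives equality in Hardy's
  inequality.\<close>

lemma hardy_inequality_regularised:
  assumes u: "u \<in> test_functions \<Omega>" and N: "DIM('a) \<ge> 2" and e: "\<epsilon> > 0"
  defines "c \<equiv> (real DIM('a) - 2) / 2"
  shows "c\<^sup>2 * (LINT x|lebesgue_on \<Omega>. (u x)\<^sup>2 / ((norm x)\<^sup>2 + \<epsilon>)) \<le> dirichlet_form \<Omega> u u"
    and "integrable (lebesgue_on \<Omega>) (\<lambda>x. (u x)\<^sup>2 / ((norm x)\<^sup>2 + \<epsilon>))"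
proof -
  define q where "q x = x \<bullet> x + \<epsilon>" for x :: 'a
  have q: "q x > 0" "q x \<noteq> 0" "x \<bullet> x \<le> q x" for x
    using e inner_ge_zero[of x] by (auto simp: q_def add_nonneg_pos less_imp_neq[symmetric])
  have qc: "continuous_on UNIV q" unfolding q_def by (intro continuous_intros)
  define h where "h b x = (x \<bullet> b) / q x" for b x
  define f where "f b x = u x * u x * h b x" for b x
  \<comment> \<open>\<open>g b\<close> is the partial derivative of \<open>f b\<close> in direction
    \<open>b\<close>; summed over \<open>b\<close> it is the divergence of u^2 x/(|x|^2 +
    \<epsilon>), whose integral vanishes.\<close>
  define g where "g b x = 2 * u x * pd b u x * h b x + (u x)\<^sup>2 * (q x - 2 * (x \<bullet> b)\<^sup>2) / (q x)\<^sup>2" for b x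
  have c0: "c \<ge> 0" using N by (simp add: c_def)
  have uc: "continuous_on UNIV u" and ucs: "cont_supp \<Omega> u"
    using test_functions_cont_supp[OF u] by (auto simp: cont_supp_def)
  have u2: "cont_supp \<Omega> (\<lambda>x. u x * u x)" using cont_supp_mult[OF ucs uc] .
  have puc: "continuous_on UNIV (pd b u)" if "b \<in> Basis" for b
    using test_functions_pd_cont_supp[OF u that] by (simp add: cont_supp_def)
  have hc: "continuous_on UNIV (h b)" for b
    unfolding h_def using q qc by (intro continuous_intros) auto
  have qd: "(q has_derivative (\<lambda>y. 2 * (x \<bullet> y))) (at x)" for x
    unfolding q_def by (auto intro!: derivative_eq_intros simp: inner_commute)
  have hd: "(h b has_derivative (\<lambda>y. ((y \<bullet> b) * q x - (x \<bullet> b) * (2 * (x \<bullet> y))) / (q x * q x))) (at x)" for b x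
    unfolding h_def using q(2) by (auto intro!: derivative_eq_intros qd)
  have fd: "(f b has_derivative (\<lambda>y. u x * u x * ((y \<bullet> b) * q x - (x \<bullet> b) * (2 * (x \<bullet> y))) / (q x * q x)
      + 2 * u x * frechet_derivative u (at x) y * h b x)) (at x)" for b x
    unfolding f_def using test_functions_differentiable[OF u, of x]
    by (auto intro!: derivative_eq_intros hd simp: frechet_derivative_works fun_eq_iff algebra_simps)
  have fdiff: "f b differentiable at x" for b x
    using fd[of b x] unfolding differentiable_def by blast
  have pf: "pd b (f b) = g b" if "b \<in> Basis" for b
  proof
    fix x
    show "pd b (f b) x = g b x"
      using pd_eqI[OF fd, where b=b] that unfolding g_def
      by (simp add: power2_eq_square algebra_simps)
  qed
  have gc: "continuous_on UNIV (g b)" if "b \<in> Basis" for b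
    unfolding g_def using q qc uc hc puc[OF that] by (intro continuous_intros) auto
  have fcs: "cont_supp \<Omega> (f b)" for b
    using cont_supp_mult[OF u2 hc, of b] unfolding f_def by (simp add: mult.commute)
  have gcs: "cont_supp \<Omega> (g b)" if "b \<in> Basis" for b
    using pd_cont_supp[OF fcs[of b], of b] gc[OF that] unfolding pf[OF that] by simp
  have gint: "integral\<^sup>L (lebesgue_on \<Omega>) (g b) = 0" if b: "b \<in> Basis" for b
    using integral_pd_eq_0[OF b fcs[of b] fdiff _ open_\<Omega>] gc[OF b] unfolding pf[OF b] by blast
  \<comment> \<open>The inequality already holds pointwise once a multiple of the divergence is
    added, so integration finishes the proof.\<close>
  have pw: "c\<^sup>2 * ((u x)\<^sup>2 / q x) \<le> (\<Sum>b\<in>Basis. (pd b u x)\<^sup>2) + c * (\<Sum>b\<in>Basis. g b x)" for x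
  proof -
    define X where "X = x \<bullet> x"
    define Q where "Q = q x"
    have Q: "Q > 0" "X \<le> Q" "X \<ge> 0" using q[of x] by (auto simp: Q_def X_def)
    have X: "(\<Sum>b\<in>Basis. (x \<bullet> b)\<^sup>2) = X"
      unfolding X_def by (subst euclidean_inner) (simp add: power2_eq_square)
    have h2: "(\<Sum>b\<in>Basis. (h b x)\<^sup>2) = X / Q\<^sup>2"
      unfolding h_def by (simp add: power_divide X[symmetric] sum_divide_distrib Q_def)
    define A where "A = (\<Sum>b\<in>Basis. (pd b u x)\<^sup>2)"
    define B where "B = (\<Sum>b\<in>Basis. pd b u x * h b x)"
    have "(\<Sum>b\<in>Basis. (u x)\<^sup>2 * (Q - 2 * (x \<bullet> b)\<^sup>2)) = (u x)\<^sup>2 * (real DIM('a) * Q - 2 * X)"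
      by (simp add: X[symmetric] sum_subtractf flip: sum_distrib_left)
    then have "(\<Sum>b\<in>Basis. (u x)\<^sup>2 * (q x - 2 * (x \<bullet> b)\<^sup>2) / (q x)\<^sup>2)
        = (u x)\<^sup>2 * (real DIM('a) * Q - 2 * X) / Q\<^sup>2"
      by (simp add: Q_def flip: sum_divide_distrib)
    then have sg: "(\<Sum>b\<in>Basis. g b x) = 2 * u x * B + (u x)\<^sup>2 * (real DIM('a) * Q - 2 * X) / Q\<^sup>2"
      unfolding g_def B_def
      by (simp add: sum.distrib sum_distrib_left mult.assoc)
    \<comment> \<open>This is |\<nabla>u + c u h|^2. Its cross term is exactly the derivative part
      of the divergence.\<close>
    have "0 \<le> (\<Sum>b\<in>Basis. (pd b u x + c * u x * h b x)\<^sup>2)" by (intro sum_nonneg) simp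
    also have "\<dots> = A + 2 * c * u x * B + (c * u x)\<^sup>2 * (X / Q\<^sup>2)"
      unfolding h2[symmetric] A_def B_def
      by (simp add: power2_sum sum.distrib sum_distrib_left power_mult_distrib algebra_simps)
    finally have 1: "0 \<le> A + 2 * c * u x * B + (c * u x)\<^sup>2 * (X / Q\<^sup>2)" .
    have N2: "real DIM('a) = 2 * c + 2" by (simp add: c_def field_simps)
    \<comment> \<open>With N = 2c + 2 all that is left is a multiple of Q - X = \<epsilon>: the
      error of the regularisation has the favourable sign.\<close>
    have "c * (u x)\<^sup>2 * (real DIM('a) * Q - 2 * X) / Q\<^sup>2 - (c * u x)\<^sup>2 * (X / Q\<^sup>2) - c\<^sup>2 * ((u x)\<^sup>2 / Q)
      = (u x)\<^sup>2 / Q\<^sup>2 * ((c\<^sup>2 + 2 * c) * (Q - X))"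
      unfolding N2 using Q by (simp add: field_simps power2_eq_square)
    moreover have "\<dots> \<ge> 0" using Q c0 by (intro mult_nonneg_nonneg) auto
    ultimately have 2: "c\<^sup>2 * ((u x)\<^sup>2 / Q) \<le> c * (u x)\<^sup>2 * (real DIM('a) * Q - 2 * X) / Q\<^sup>2 - (c * u x)\<^sup>2 * (X / Q\<^sup>2)"
      by linarith
    have "c * (\<Sum>b\<in>Basis. g b x) = 2 * c * u x * B + c * (u x)\<^sup>2 * (real DIM('a) * Q - 2 * X) / Q\<^sup>2"
      unfolding sg by (simp add: algebra_simps)
    with 1 2 show ?thesis unfolding A_def Q_def by linarith
  qed
  have qn: "(norm x)\<^sup>2 + \<epsilon> = q x" for x by (simp add: q_def power2_norm_eq_inner)
  have "cont_supp \<Omega> (\<lambda>x. 1 / q x * (u x * u x))"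
    using q qc by (intro cont_supp_mult u2 continuous_intros) auto
  from cont_supp_lebesgue_on(1)[OF this open_\<Omega>]
  show i1: "integrable (lebesgue_on \<Omega>) (\<lambda>x. (u x)\<^sup>2 / ((norm x)\<^sup>2 + \<epsilon>))"
    unfolding qn by (simp add: power2_eq_square)
  have pint: "integrable (lebesgue_on \<Omega>) (\<lambda>x. (pd b u x)\<^sup>2)" if "b \<in> Basis" for b
    using tf_pd_L2[OF u that] by (rule L2_on_integrable_square)
  have gi: "integrable (lebesgue_on \<Omega>) (g b)" if "b \<in> Basis" for b
    using gcs[OF that] open_\<Omega> by (rule cont_supp_lebesgue_on)
  have "c\<^sup>2 * (LINT x|lebesgue_on \<Omega>. (u x)\<^sup>2 / ((norm x)\<^sup>2 + \<epsilon>))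
    = (LINT x|lebesgue_on \<Omega>. c\<^sup>2 * ((u x)\<^sup>2 / ((norm x)\<^sup>2 + \<epsilon>)))"
    by (rule integral_mult_right_zero[symmetric])
  also have "\<dots> \<le> (LINT x|lebesgue_on \<Omega>. (\<Sum>b\<in>Basis. (pd b u x)\<^sup>2) + c * (\<Sum>b\<in>Basis. g b x))"
    using i1 pint gi pw unfolding qn
    by (intro integral_mono Bochner_Integration.integrable_add integrable_mult_right
        Bochner_Integration.integrable_sum) auto
  also have "\<dots> = (\<Sum>b\<in>Basis. LINT x|lebesgue_on \<Omega>. (pd b u x)\<^sup>2) + c * (\<Sum>b\<in>Basis. integral\<^sup>L (lebesgue_on \<Omega>) (g b))"
    using pint gi by (simp add: Bochner_Integration.integral_add Bochner_Integration.integrable_sum)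
  also have "\<dots> = dirichlet_form \<Omega> u u"
    using gint by (simp add: dirichlet_form_def L2_inner_def power2_eq_square)
  finally show "c\<^sup>2 * (LINT x|lebesgue_on \<Omega>. (u x)\<^sup>2 / ((norm x)\<^sup>2 + \<epsilon>)) \<le> dirichlet_form \<Omega> u u" .
qed

text \<open>Let \<epsilon> tend to 0. Fatou's lemma yields integrability together with the bound,
  provided that one may divide by \<open>c\<^sup>2\<close>; this is where N \<ge> 3 enters.\<close>

lemma hardy_inequality:
  assumes u: "u \<in> test_functions \<Omega>" and N: "DIM('a) \<ge> 3"
  shows "integrable (lebesgue_on \<Omega>) (\<lambda>x. (u x)\<^sup>2 / (norm x)\<^sup>2)"
    and "((real DIM('a) - 2) / 2)\<^sup>2 * (LINT x|lebesgue_on \<Omega>. (u x)\<^sup>2 / (norm x)\<^sup>2) \<le> dirichlet_form \<Omega> u u"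
proof -
  define c where "c = (real DIM('a) - 2) / 2"
  have c: "c > 0" using N by (simp add: c_def)
  define \<epsilon> where "\<epsilon> n = 1 / real (Suc n)" for n
  have e: "\<epsilon> n > 0" for n by (simp add: \<epsilon>_def)
  have e0: "\<epsilon> \<longlonglongrightarrow> 0" unfolding \<epsilon>_def using LIMSEQ_inverse_real_of_nat by (simp add: inverse_eq_divide)
  define D where "D = dirichlet_form \<Omega> u u / c\<^sup>2"
  have D0: "D \<ge> 0" unfolding D_def using dirichlet_form_self_nonneg by simp
  note reg = hardy_inequality_regularised[OF u _ e, folded c_def]
  have um [measurable]: "u \<in> borel_measurable (lebesgue_on \<Omega>)" using tf_L2[OF u] by (rule L2_on_measurable)
  note norm_measurable [measurable]
  have "(\<integral>\<^sup>+x. ennreal ((u x)\<^sup>2 / (norm x)\<^sup>2) \<partial>lebesgue_on \<Omega>)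
    = (\<integral>\<^sup>+x. liminf (\<lambda>n. ennreal ((u x)\<^sup>2 / ((norm x)\<^sup>2 + \<epsilon> n))) \<partial>lebesgue_on \<Omega>)"
  proof (rule nn_integral_cong_AE)
    show "AE x in lebesgue_on \<Omega>. ennreal ((u x)\<^sup>2 / (norm x)\<^sup>2)
        = liminf (\<lambda>n. ennreal ((u x)\<^sup>2 / ((norm x)\<^sup>2 + \<epsilon> n)))"
      using AE_nonzero
    proof eventually_elim
      fix x :: 'a assume "x \<noteq> 0"
      then have "(\<lambda>n. (u x)\<^sup>2 / ((norm x)\<^sup>2 + \<epsilon> n)) \<longlonglongrightarrow> (u x)\<^sup>2 / ((norm x)\<^sup>2 + 0)"
        using e0 by (intro tendsto_intros) auto
      then have "(\<lambda>n. ennreal ((u x)\<^sup>2 / ((norm x)\<^sup>2 + \<epsilon> n))) \<longlonglongrightarrow> ennreal ((u x)\<^sup>2 / (norm x)\<^sup>2)"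
        by (intro tendsto_ennrealI) simp
      then show "ennreal ((u x)\<^sup>2 / (norm x)\<^sup>2) = liminf (\<lambda>n. ennreal ((u x)\<^sup>2 / ((norm x)\<^sup>2 + \<epsilon> n)))"
        by (rule lim_imp_Liminf[symmetric, rotated]) simp
    qed
  qed
  also have "\<dots> \<le> liminf (\<lambda>n. \<integral>\<^sup>+x. ennreal ((u x)\<^sup>2 / ((norm x)\<^sup>2 + \<epsilon> n)) \<partial>lebesgue_on \<Omega>)"
    by (intro nn_integral_liminf) measurable
  also have "\<dots> \<le> liminf (\<lambda>n::nat. ennreal D)"
  proof (intro Liminf_mono always_eventually allI)
    fix n
    have "(\<integral>\<^sup>+x. ennreal ((u x)\<^sup>2 / ((norm x)\<^sup>2 + \<epsilon> n)) \<partial>lebesgue_on \<Omega>)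
      = ennreal (LINT x|lebesgue_on \<Omega>. (u x)\<^sup>2 / ((norm x)\<^sup>2 + \<epsilon> n))"
      using reg(2) N e less_imp_le[OF e] by (intro nn_integral_eq_integral) auto
    also have "\<dots> \<le> ennreal D"
      using reg(1)[of n] N c by (intro ennreal_leI) (simp add: D_def field_simps)
    finally show "(\<integral>\<^sup>+x. ennreal ((u x)\<^sup>2 / ((norm x)\<^sup>2 + \<epsilon> n)) \<partial>lebesgue_on \<Omega>) \<le> ennreal D" .
  qed
  also have "\<dots> = ennreal D" by (simp add: Liminf_const)
  finally have *: "(\<integral>\<^sup>+x. ennreal ((u x)\<^sup>2 / (norm x)\<^sup>2) \<partial>lebesgue_on \<Omega>) \<le> ennreal D" .
  show int: "integrable (lebesgue_on \<Omega>) (\<lambda>x. (u x)\<^sup>2 / (norm x)\<^sup>2)"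
    using * by (intro integrableI_bounded) (auto simp: ennreal_less_top intro: le_less_trans)
  have "ennreal (LINT x|lebesgue_on \<Omega>. (u x)\<^sup>2 / (norm x)\<^sup>2) \<le> ennreal D"
    using * int by (subst nn_integral_eq_integral[symmetric]) auto
  then have "(LINT x|lebesgue_on \<Omega>. (u x)\<^sup>2 / (norm x)\<^sup>2) \<le> D" using D0 by (simp add: ennreal_le_iff)
  then show "((real DIM('a) - 2) / 2)\<^sup>2 * (LINT x|lebesgue_on \<Omega>. (u x)\<^sup>2 / (norm x)\<^sup>2) \<le> dirichlet_form \<Omega> u u"
    using c by (simp add: D_def c_def[symmetric] field_simps)
qed

text \<open>\<open>hardy_const\<close> is minus the constant of Hardy's inequality, so an admissible
  negative potential is absorbed by the gradient term.\<close>

lemma hardy_form_nonneg: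
  assumes u: "u \<in> hardy_core \<Omega> \<mu>" and \<mu>: "\<mu> \<ge> 0 \<or> DIM('a) \<ge> 3 \<and> \<mu> \<ge> hardy_const DIM('a)"
  shows "0 \<le> hardy_form \<Omega> \<mu> u u"
proof (cases "\<mu> \<ge> 0")
  case True
  then show ?thesis
    using dirichlet_form_le_hardy_form[OF True core_tf[OF u]] dirichlet_form_self_nonneg[of u] by linarith
next
  case False
  then have N: "DIM('a) \<ge> 3" and \<mu>: "\<mu> \<ge> - (((real DIM('a) - 2) / 2)\<^sup>2)"
    using \<mu> by (auto simp: hardy_const_def power_divide)
  define S where "S = (LINT x|lebesgue_on \<Omega>. (u x)\<^sup>2 / (norm x)\<^sup>2)"
  have "S \<ge> 0" using singular_integral_nonneg[of u] by (simp add: S_def power2_eq_square)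
  then have "\<mu> * S \<ge> - (((real DIM('a) - 2) / 2)\<^sup>2) * S" using \<mu> by (intro mult_right_mono)
  then show ?thesis
    using hardy_inequality(2)[OF core_tf[OF u] N] core_tf[OF u]
    by (simp add: hardy_form_eq S_def power2_eq_square)
qed

end

subsection \<open>Eigenfunctions and the Rayleigh quotient\<close>

text \<open>In dimension 2 the critical constant is 0, so there too the disjunction admits every
  \<mu> from that constant on.\<close>

locale hardy_domain = bounded_open \<Omega> for \<Omega> :: "'a::euclidean_space set" +
  fixes \<mu> :: real
  assumes \<mu>_admissible: "\<mu> \<ge> 0 \<or> DIM('a) \<ge> 3 \<and> \<mu> \<ge> hardy_const DIM('a)"
begin

abbreviation Q where "Q \<equiv> hardy_form \<Omega> \<mu>"

lemma Q_nonneg: "u \<in> hardy_core \<Omega> \<mu> \<Longrightarrow> 0 \<le> Q u u"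
  by (rule hardy_form_nonneg[OF _ \<mu>_admissible])

text \<open>Replacing the norm by its square makes the Cauchy condition accessible to bilinear
  expansion.\<close>

lemma hardy_approx_iff:
  "hardy_approx \<Omega> \<mu> w u \<longleftrightarrow> (\<forall>n. w n \<in> hardy_core \<Omega> \<mu>) \<and> L2_lim \<Omega> w u \<and>
     (\<forall>e>0. \<exists>M. \<forall>m\<ge>M. \<forall>n\<ge>M. Q (\<lambda>x. w m x - w n x) (\<lambda>x. w m x - w n x) < e)"
proof -
  have "(\<forall>e>0. \<exists>M. \<forall>m\<ge>M. \<forall>n\<ge>M. hardy_norm \<Omega> \<mu> (\<lambda>x. w m x - w n x) < e) \<longleftrightarrow>
    (\<forall>e>0. \<exists>M. \<forall>m\<ge>M. \<forall>n\<ge>M. Q (\<lambda>x. w m x - w n x) (\<lambda>x. w m x - w n x) < e)" (is "?l = ?r")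
  proof
    assume l: ?l
    show ?r
    proof (intro allI impI)
      fix e :: real assume "e > 0"
      then have "sqrt e > 0" by simp
      from l[rule_format, OF this]
      show "\<exists>M. \<forall>m\<ge>M. \<forall>n\<ge>M. Q (\<lambda>x. w m x - w n x) (\<lambda>x. w m x - w n x) < e"
        unfolding hardy_norm_def real_sqrt_less_iff .
    qed
  next
    assume r: ?r
    show ?l
    proof (intro allI impI)
      fix e :: real assume "e > 0"
      then have "e\<^sup>2 > 0" by simp
      from r[rule_format, OF this]
      obtain M where M: "\<And>m n. m \<ge> M \<Longrightarrow> n \<ge> M \<Longrightarrow> Q (\<lambda>x. w m x - w n x) (\<lambda>x. w m x - w n x) < e\<^sup>2"
        by blast
      have "hardy_norm \<Omega> \<mu> (\<lambda>x. w m x - w n x) < e" if "m \<ge> M" "n \<ge> M" for m n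
        using real_sqrt_less_mono[OF M[OF that]] \<open>e > 0\<close> by (simp add: hardy_norm_def)
      then show "\<exists>M. \<forall>m\<ge>M. \<forall>n\<ge>M. hardy_norm \<Omega> \<mu> (\<lambda>x. w m x - w n x) < e" by blast
    qed
  qed
  then show ?thesis by (auto simp: hardy_approx_def L2_lim_def intro: core_L2[where \<mu>=\<mu>])
qed

lemma hardy_approx_core: "hardy_approx \<Omega> \<mu> w u \<Longrightarrow> w n \<in> hardy_core \<Omega> \<mu>"
  by (simp add: hardy_approx_iff)

lemma hardy_approx_L2_lim: "hardy_approx \<Omega> \<mu> w u \<Longrightarrow> L2_lim \<Omega> w u"
  by (simp add: hardy_approx_iff)

text \<open>Parallelogram law with the nonnegative value at \<open>u - v\<close> dropped. It
  replaces the triangle inequality in arguments about Cauchy sequences.\<close>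

lemma Q_add_le:
  assumes "u \<in> hardy_core \<Omega> \<mu>" "v \<in> hardy_core \<Omega> \<mu>"
  shows "Q (\<lambda>x. u x + v x) (\<lambda>x. u x + v x) \<le> 2 * Q u u + 2 * Q v v"
proof -
  have "0 \<le> Q (\<lambda>x. u x - v x) (\<lambda>x. u x - v x)" using assms by (intro Q_nonneg core_diff)
  then show ?thesis
    using assms
    by (simp add: hardy_form_diff_left hardy_form_diff_right hardy_form_add_left hardy_form_add_right
        core_add core_diff)
qed

lemma hardy_approx_zero: "hardy_approx \<Omega> \<mu> (\<lambda>n x. 0) (\<lambda>x. 0)"
  using hardy_form_scale_left[OF core_zero core_zero, of \<mu> 0]
  by (simp add: hardy_approx_iff core_zero L2_lim_const L2_on_zero)

lemma hardy_approx_scale: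
  assumes "hardy_approx \<Omega> \<mu> w u"
  shows "hardy_approx \<Omega> \<mu> (\<lambda>n x. c * w n x) (\<lambda>x. c * u x)"
proof (cases "c = 0")
  case True
  then show ?thesis using hardy_approx_zero by simp
next
  case False
  have core: "w n \<in> hardy_core \<Omega> \<mu>" for n using assms by (rule hardy_approx_core)
  have eq: "Q (\<lambda>x. c * w m x - c * w n x) (\<lambda>x. c * w m x - c * w n x)
      = c\<^sup>2 * Q (\<lambda>x. w m x - w n x) (\<lambda>x. w m x - w n x)" for m n
  proof -
    let ?d = "\<lambda>x. w m x - w n x"
    have d: "?d \<in> hardy_core \<Omega> \<mu>" using core by (intro core_diff)
    have "Q (\<lambda>x. c * ?d x) (\<lambda>x. c * ?d x) = c\<^sup>2 * Q ?d ?d"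
      using hardy_form_commute[of \<mu> ?d "\<lambda>x. c * ?d x"]
      by (simp only: hardy_form_scale_left[OF d core_scale[OF d]] hardy_form_scale_left[OF d d] power2_eq_square mult.assoc)
    then show ?thesis by (simp add: right_diff_distrib)
  qed
  have "\<exists>M. \<forall>m\<ge>M. \<forall>n\<ge>M. Q (\<lambda>x. c * w m x - c * w n x) (\<lambda>x. c * w m x - c * w n x) < e" if "e > 0" for e
  proof -
    have "e / c\<^sup>2 > 0" using that False by simp
    then obtain M where "\<And>m n. m \<ge> M \<Longrightarrow> n \<ge> M \<Longrightarrow> Q (\<lambda>x. w m x - w n x) (\<lambda>x. w m x - w n x) < e / c\<^sup>2"
      using assms unfolding hardy_approx_iff by blast
    then show ?thesis
      unfolding eq using False by (auto simp: field_simps)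
  qed
  with assms show ?thesis by (auto simp: hardy_approx_iff core_scale L2_lim_scale)
qed

lemma hardy_approx_add:
  assumes "hardy_approx \<Omega> \<mu> w u" "hardy_approx \<Omega> \<mu> z v"
  shows "hardy_approx \<Omega> \<mu> (\<lambda>n x. w n x + z n x) (\<lambda>x. u x + v x)"
proof -
  have core: "w n \<in> hardy_core \<Omega> \<mu>" "z n \<in> hardy_core \<Omega> \<mu>" for n using assms by (auto simp: hardy_approx_core)
  have "\<exists>M. \<forall>m\<ge>M. \<forall>n\<ge>M. Q (\<lambda>x. (w m x + z m x) - (w n x + z n x)) (\<lambda>x. (w m x + z m x) - (w n x + z n x)) < e"
    if "e > 0" for e
  proof -
    have "e / 4 > 0" using that by simp
    then obtain M N where
      M: "\<And>m n. m \<ge> M \<Longrightarrow> n \<ge> M \<Longrightarrow> Q (\<lambda>x. w m x - w n x) (\<lambda>x. w m x - w n x) < e / 4"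
      and N: "\<And>m n. m \<ge> N \<Longrightarrow> n \<ge> N \<Longrightarrow> Q (\<lambda>x. z m x - z n x) (\<lambda>x. z m x - z n x) < e / 4"
      using assms unfolding hardy_approx_iff by meson
    have "Q (\<lambda>x. (w m x + z m x) - (w n x + z n x)) (\<lambda>x. (w m x + z m x) - (w n x + z n x)) < e"
      if "m \<ge> max M N" "n \<ge> max M N" for m n
    proof -
      have "(\<lambda>x. (w m x + z m x) - (w n x + z n x)) = (\<lambda>x. (w m x - w n x) + (z m x - z n x))"
        by (simp add: fun_eq_iff)
      then show ?thesis
        using Q_add_le[of "\<lambda>x. w m x - w n x" "\<lambda>x. z m x - z n x"] core M[of m n] N[of m n] that
        by (simp add: core_diff)
    qed
    then show ?thesis by blast
  qed
  with assms show ?thesis by (auto simp: hardy_approx_iff core_add L2_lim_add)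
qed

lemma hardy_approx_diff:
  assumes "hardy_approx \<Omega> \<mu> w u" "hardy_approx \<Omega> \<mu> z v"
  shows "hardy_approx \<Omega> \<mu> (\<lambda>n x. w n x - z n x) (\<lambda>x. u x - v x)"
  using hardy_approx_add[OF assms(1) hardy_approx_scale[OF assms(2), of "-1"]] by simp

lemma hardy_approx_sum:
  "(\<And>i. i \<in> I \<Longrightarrow> hardy_approx \<Omega> \<mu> (w i) (u i)) \<Longrightarrow>
    hardy_approx \<Omega> \<mu> (\<lambda>n x. \<Sum>i\<in>I. w i n x) (\<lambda>x. \<Sum>i\<in>I. u i x)"
  by (induction I rule: infinite_finite_induct) (auto simp: hardy_approx_add hardy_approx_zero)

end

text \<open>Fixes one choice of the eigenfunctions whose existence
  \<open>dirichlet_eigenvalues\<close> asserts.\<close>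

locale hardy_eigensystem = hardy_domain \<Omega> \<mu> for \<Omega> :: "'a::euclidean_space set" and \<mu> +
  fixes lam :: "nat \<Rightarrow> real" and \<phi> :: "nat \<Rightarrow> 'a \<Rightarrow> real"
  assumes lam_Suc: "\<And>k. k \<ge> 1 \<Longrightarrow> lam k \<le> lam (Suc k)"
    and operator: "\<And>k. k \<ge> 1 \<Longrightarrow> hardy_operator \<Omega> \<mu> (\<phi> k) (\<lambda>x. lam k * \<phi> k x)"
    and orthonormal': "\<And>i j. i \<ge> 1 \<Longrightarrow> j \<ge> 1 \<Longrightarrow> L2_inner \<Omega> (\<phi> i) (\<phi> j) = (if i = j then 1 else 0)"
    and total': "\<And>u. u \<in> L2_on \<Omega> \<Longrightarrow> (\<And>k. k \<ge> 1 \<Longrightarrow> L2_inner \<Omega> u (\<phi> k) = 0) \<Longrightarrow>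
      AE x in lebesgue_on \<Omega>. u x = 0"
begin

lemma \<phi>_hardy_space: "k \<ge> 1 \<Longrightarrow> \<phi> k \<in> hardy_space \<Omega> \<mu>"
  using operator by (simp add: hardy_operator_def)

sublocale L2_orthonormal_basis \<Omega> \<phi>
  using \<phi>_hardy_space orthonormal' total'
  by unfold_locales (auto simp: lmeasurable_\<Omega> hardy_space_def hardy_approx_def)

lemma lam_mono:
  assumes "1 \<le> i" "i \<le> j"
  shows "lam i \<le> lam j"
  using assms(2)
proof (induction j rule: dec_induct)
  case (step j)
  then show ?case using lam_Suc[of j] assms(1) by simp
qed simp

lemma approximants:
  obtains w where "\<And>k. k \<ge> 1 \<Longrightarrow> hardy_approx \<Omega> \<mu> (w k) (\<phi> k)"
  using \<phi>_hardy_space unfolding hardy_space_def mem_Collect_eq by metis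

text \<open>The weak eigenvalue equation, in the only form in which it is used: \<open>z\<close> may
  approximate any element of the form domain.\<close>

lemma eigen_limit:
  assumes "k \<ge> 1" "hardy_approx \<Omega> \<mu> w (\<phi> k)" "hardy_approx \<Omega> \<mu> z v"
  shows "(\<lambda>n. Q (w n) (z n)) \<longlonglongrightarrow> lam k * L2_inner \<Omega> (\<phi> k) v"
  using operator[OF assms(1)] assms(2,3)
  unfolding hardy_operator_def hardy_form_value_def L2_inner_scale_left
  by (auto simp: hardy_space_def)

text \<open>Bessel's inequality for the form: expand \<open>Q\<close> at the difference of
  \<open>z n\<close> and an approximant of the projection of \<open>u\<close>, and take the limit.
  The majorant \<open>p\<close> allows for trial functions whose form is merely estimated, as
  happens when two potentials are compared.\<close>

lemma lam_weighted_Bessel: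
  assumes z: "hardy_approx \<Omega> \<mu> z u" and p: "\<And>n. Q (z n) (z n) \<le> p n" and q: "p \<longlonglongrightarrow> q"
  shows "(\<Sum>j\<in>{1..M}. lam j * (L2_inner \<Omega> u (\<phi> j))\<^sup>2) \<le> q"
proof -
  obtain w where w: "\<And>k. k \<ge> 1 \<Longrightarrow> hardy_approx \<Omega> \<mu> (w k) (\<phi> k)" using approximants by metis
  define c where "c j = L2_inner \<Omega> u (\<phi> j)" for j
  define I where "I = {1..M}"
  have I: "finite I" "\<And>i. i \<in> I \<Longrightarrow> i \<ge> 1" by (auto simp: I_def)
  have wc: "w j n \<in> hardy_core \<Omega> \<mu>" if "j \<in> I" for j n using w I that hardy_approx_core by blast
  have zc: "z n \<in> hardy_core \<Omega> \<mu>" for n using z hardy_approx_core by blast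
  define s where "s n = (\<lambda>x. \<Sum>j\<in>I. c j * w j n x)" for n
  have sc: "s n \<in> hardy_core \<Omega> \<mu>" for n unfolding s_def using wc by (intro core_sum core_scale)
  have "(\<lambda>n. p n - 2 * (\<Sum>j\<in>I. c j * Q (w j n) (z n))
        + (\<Sum>i\<in>I. c i * (\<Sum>j\<in>I. c j * Q (w i n) (w j n))))
    \<longlonglongrightarrow> q - 2 * (\<Sum>j\<in>I. c j * (lam j * L2_inner \<Omega> (\<phi> j) u))
        + (\<Sum>i\<in>I. c i * (\<Sum>j\<in>I. c j * (lam i * L2_inner \<Omega> (\<phi> i) (\<phi> j))))"
    using I by (intro tendsto_intros q eigen_limit w z) auto
  moreover have "(\<Sum>j\<in>I. c j * (lam j * L2_inner \<Omega> (\<phi> j) u)) = (\<Sum>j\<in>I. lam j * (c j)\<^sup>2)"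
    by (simp add: c_def L2_inner_commute[of _ u] power2_eq_square algebra_simps)
  moreover have "(\<Sum>i\<in>I. c i * (\<Sum>j\<in>I. c j * (lam i * L2_inner \<Omega> (\<phi> i) (\<phi> j)))) = (\<Sum>j\<in>I. lam j * (c j)\<^sup>2)"
  proof (rule sum.cong[OF refl])
    fix i assume i: "i \<in> I"
    have "(\<Sum>j\<in>I. c j * (lam i * L2_inner \<Omega> (\<phi> i) (\<phi> j))) = (\<Sum>j\<in>I. if i = j then c j * lam i else 0)"
      using i I by (intro sum.cong) (auto simp: orthonormal)
    then show "c i * (\<Sum>j\<in>I. c j * (lam i * L2_inner \<Omega> (\<phi> i) (\<phi> j))) = lam i * (c i)\<^sup>2"
      using i I by (simp add: power2_eq_square)
  qed
  moreover have "p n - 2 * (\<Sum>j\<in>I. c j * Q (w j n) (z n))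
        + (\<Sum>i\<in>I. c i * (\<Sum>j\<in>I. c j * Q (w i n) (w j n))) \<ge> 0" for n
  proof -
    have "0 \<le> Q (\<lambda>x. z n x - s n x) (\<lambda>x. z n x - s n x)" using zc sc by (intro Q_nonneg core_diff)
    also have "\<dots> = Q (z n) (z n) - 2 * Q (s n) (z n) + Q (s n) (s n)"
      using zc sc hardy_form_commute[of \<mu> "z n" "s n"]
      by (simp add: hardy_form_diff_left hardy_form_diff_right core_diff)
    also have "Q (s n) (z n) = (\<Sum>j\<in>I. c j * Q (w j n) (z n))"
      unfolding s_def by (intro hardy_form_sum_left wc zc)
    also have "Q (s n) (s n) = (\<Sum>i\<in>I. c i * Q (w i n) (s n))"
      unfolding s_def[of n] by (intro hardy_form_sum_left wc sc[unfolded s_def])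
    also have "\<dots> = (\<Sum>i\<in>I. c i * (\<Sum>j\<in>I. c j * Q (w i n) (w j n)))"
      unfolding s_def[of n] using wc by (intro sum.cong refl) (simp add: hardy_form_sum_right)
    finally show ?thesis using p[of n] by linarith
  qed
  \<comment> \<open>Cross term and square have the same limit, so half of the cross term
    survives.\<close>
  ultimately have "0 \<le> q - 2 * (\<Sum>j\<in>I. lam j * (c j)\<^sup>2) + (\<Sum>j\<in>I. lam j * (c j)\<^sup>2)"
    by (intro LIMSEQ_le_const) auto
  then show ?thesis by (simp add: c_def I_def)
qed

text \<open>The first k coefficients of \<open>u\<close> vanish and the remaining eigenvalues are at
  least \<open>lam (Suc k)\<close>. Parseval's identity removes the truncation at
  \<open>M\<close>.\<close>

lemma Rayleigh:
  assumes z: "hardy_approx \<Omega> \<mu> z u" and p: "\<And>n. Q (z n) (z n) \<le> p n" and q: "p \<longlonglongrightarrow> q"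
    and orth: "\<And>j. 1 \<le> j \<Longrightarrow> j \<le> k \<Longrightarrow> L2_inner \<Omega> u (\<phi> j) = 0"
  shows "lam (Suc k) * L2_inner \<Omega> u u \<le> q"
proof (rule LIMSEQ_le_const2)
  have u: "u \<in> L2_on \<Omega>" using z by (simp add: hardy_approx_def)
  show "(\<lambda>M. lam (Suc k) * (\<Sum>j\<in>{1..M}. (L2_inner \<Omega> u (\<phi> j))\<^sup>2)) \<longlonglongrightarrow> lam (Suc k) * L2_inner \<Omega> u u"
    by (intro tendsto_intros Parseval u)
  \<comment> \<open>For j up to k both sides vanish; beyond k monotonicity of the eigenvalues
    applies.\<close>
  have "lam (Suc k) * (L2_inner \<Omega> u (\<phi> j))\<^sup>2 \<le> lam j * (L2_inner \<Omega> u (\<phi> j))\<^sup>2" if "1 \<le> j" for j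
    using orth[OF that] lam_mono[of "Suc k" j] that
    by (cases "j \<le> k") (auto intro!: mult_right_mono)
  then have "lam (Suc k) * (\<Sum>j\<in>{1..M}. (L2_inner \<Omega> u (\<phi> j))\<^sup>2) \<le> q" for M
    unfolding sum_distrib_left
    by (intro order_trans[OF sum_mono lam_weighted_Bessel[OF z p q]]) auto
  then show "\<exists>N. \<forall>M\<ge>N. lam (Suc k) * (\<Sum>j\<in>{1..M}. (L2_inner \<Omega> u (\<phi> j))\<^sup>2) \<le> q" by blast
qed

lemma eigen_form_limit:
  assumes k: "k \<ge> 1" and w: "hardy_approx \<Omega> \<mu> w (\<phi> k)"
  shows "(\<lambda>n. Q (w n) (w n)) \<longlonglongrightarrow> lam k"
  using eigen_limit[OF k w w] orthonormal[OF k k] by simp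

lemma lam_nonneg:
  assumes k: "k \<ge> 1"
  shows "0 \<le> lam k"
proof -
  obtain w where w: "\<And>k. k \<ge> 1 \<Longrightarrow> hardy_approx \<Omega> \<mu> (w k) (\<phi> k)" using approximants by metis
  show ?thesis
    by (rule LIMSEQ_le_const[OF eigen_form_limit[OF k w[OF k]]])
      (use Q_nonneg[OF hardy_approx_core[OF w[OF k]]] in blast)
qed

end

subsection \<open>Yang's inequality\<close>

context bounded_open
begin

lemma pd_coord_mult:
  assumes "u \<in> test_functions \<Omega>"
  shows "pd c (\<lambda>x. (x \<bullet> b) * u x) x = (x \<bullet> b) * pd c u x + (c \<bullet> b) * u x"
proof -
  have "(\<lambda>x. x \<bullet> b) differentiable at x"
    unfolding differentiable_def by (auto intro!: exI derivative_eq_intros)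
  then show ?thesis using test_functions_differentiable[OF assms] by (simp add: pd_mult pd_coord)
qed

lemma L2_inner_coord_swap: "L2_inner \<Omega> (\<lambda>x. (x \<bullet> b) * u x) v = L2_inner \<Omega> u (\<lambda>x. (x \<bullet> b) * v x)"
  by (simp add: L2_inner_def mult_ac)

lemma dirichlet_form_coord_left:
  assumes u: "u \<in> test_functions \<Omega>" and v: "v \<in> test_functions \<Omega>" and b: "b \<in> Basis"
  shows "dirichlet_form \<Omega> (\<lambda>x. (x \<bullet> b) * u x) v
    = (\<Sum>c\<in>Basis. L2_inner \<Omega> (\<lambda>x. (x \<bullet> b) * pd c u x) (pd c v)) + L2_inner \<Omega> u (pd b v)"
proof -
  have "L2_inner \<Omega> (pd c (\<lambda>x. (x \<bullet> b) * u x)) (pd c v)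
    = L2_inner \<Omega> (\<lambda>x. (x \<bullet> b) * pd c u x) (pd c v) + (if c = b then L2_inner \<Omega> u (pd c v) else 0)"
    if c: "c \<in> Basis" for c
    using c b u v
    by (simp add: pd_coord_mult L2_inner_add_left L2_on_coord tf_L2 tf_pd_L2 L2_on_scale
        L2_inner_scale_left inner_Basis)
  then show ?thesis using b by (simp add: dirichlet_form_def sum.distrib)
qed

text \<open>The commutator [L, x_b] = -2 \<partial>_b in weak form. The potential terms on the two
  sides are literally equal; the gradient terms differ by two inner products that integration by
  parts merges.\<close>

lemma hardy_form_coord_swap:
  assumes u: "u \<in> test_functions \<Omega>" and v: "v \<in> test_functions \<Omega>" and b: "b \<in> Basis"
  shows "hardy_form \<Omega> \<mu> (\<lambda>x. (x \<bullet> b) * u x) v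
    = hardy_form \<Omega> \<mu> u (\<lambda>x. (x \<bullet> b) * v x) - 2 * L2_inner \<Omega> (pd b u) v"
proof -
  have "dirichlet_form \<Omega> u (\<lambda>x. (x \<bullet> b) * v x) = dirichlet_form \<Omega> (\<lambda>x. (x \<bullet> b) * v x) u"
    by (simp add: dirichlet_form_def L2_inner_commute)
  also have "\<dots> = (\<Sum>c\<in>Basis. L2_inner \<Omega> (\<lambda>x. (x \<bullet> b) * pd c u x) (pd c v)) + L2_inner \<Omega> (pd b u) v"
  proof -
    have "L2_inner \<Omega> (\<lambda>x. (x \<bullet> b) * pd c v x) (pd c u) = L2_inner \<Omega> (\<lambda>x. (x \<bullet> b) * pd c u x) (pd c v)" for c
      unfolding L2_inner_coord_swap[of b "pd c v"] by (rule L2_inner_commute)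
    then show ?thesis
      unfolding dirichlet_form_coord_left[OF v u b] by (simp add: L2_inner_commute[of _ v])
  qed
  finally have D: "dirichlet_form \<Omega> u (\<lambda>x. (x \<bullet> b) * v x)
    = (\<Sum>c\<in>Basis. L2_inner \<Omega> (\<lambda>x. (x \<bullet> b) * pd c u x) (pd c v)) + L2_inner \<Omega> (pd b u) v" .
  have S: "(LINT x|lebesgue_on \<Omega>. (x \<bullet> b) * u x * v x / (norm x)\<^sup>2)
      = (LINT x|lebesgue_on \<Omega>. u x * ((x \<bullet> b) * v x) / (norm x)\<^sup>2)"
    by (simp add: mult_ac)
  show ?thesis
    unfolding hardy_form_eq[OF test_functions_coord[OF u] v] hardy_form_eq[OF u test_functions_coord[OF v]]
      dirichlet_form_coord_left[OF u v b] D S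
    using pd_integration_by_parts[OF u v b] by simp
qed

lemma L2_inner_add_self_le:
  assumes "u \<in> L2_on \<Omega>" "v \<in> L2_on \<Omega>"
  shows "L2_inner \<Omega> (\<lambda>x. u x + v x) (\<lambda>x. u x + v x) \<le> 2 * L2_inner \<Omega> u u + 2 * L2_inner \<Omega> v v"
proof -
  have "0 \<le> L2_inner \<Omega> (\<lambda>x. u x - v x) (\<lambda>x. u x - v x)" by (rule L2_inner_self_nonneg)
  then show ?thesis
    using assms
    by (simp add: L2_inner_diff_left L2_inner_diff_right L2_inner_add_left L2_inner_add_right L2_on_intros)
qed

text \<open>Multiplication by a coordinate is bounded with respect to the form plus the L^2 norm,
  hence acts on the completion. The factors 2 come from (f + h)^2 \<le> 2 f^2 + 2 h^2 for the
  product rule.\<close>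

lemma hardy_form_coord_le:
  assumes \<mu>: "\<mu> \<ge> 0" and u: "u \<in> hardy_core \<Omega> \<mu>" and b: "b \<in> Basis"
    and R: "R \<ge> 0" "\<And>x b. x \<in> \<Omega> \<Longrightarrow> b \<in> Basis \<Longrightarrow> \<bar>x \<bullet> b\<bar> \<le> R"
  shows "hardy_form \<Omega> \<mu> (\<lambda>x. (x \<bullet> b) * u x) (\<lambda>x. (x \<bullet> b) * u x)
    \<le> 2 * R\<^sup>2 * hardy_form \<Omega> \<mu> u u + 2 * L2_inner \<Omega> u u"
proof -
  let ?v = "\<lambda>x. (x \<bullet> b) * u x"
  have ut: "u \<in> test_functions \<Omega>" using u by (rule core_tf)
  have R2: "(x \<bullet> b)\<^sup>2 \<le> R\<^sup>2" if "x \<in> \<Omega>" for x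
    using power_mono[OF R(2)[OF that b], of 2] by simp
  have gL: "L2_inner \<Omega> (\<lambda>x. (x \<bullet> b) * f x) (\<lambda>x. (x \<bullet> b) * f x) \<le> R\<^sup>2 * L2_inner \<Omega> f f"
    if "f \<in> L2_on \<Omega>" for f
    using power_mono[OF L2_norm_bounded_mult[OF that coord_measurable R(2)[OF _ b] R(1)] L2_norm_nonneg, of 2]
    by (simp add: power_mult_distrib L2_norm_power2)
  have "dirichlet_form \<Omega> ?v ?v \<le> (\<Sum>c\<in>Basis. 2 * R\<^sup>2 * L2_inner \<Omega> (pd c u) (pd c u)
      + (if c = b then 2 * L2_inner \<Omega> u u else 0))"
    unfolding dirichlet_form_def
  proof (rule sum_mono)
    fix c :: 'a assume c: "c \<in> Basis"
    let ?f = "\<lambda>x. (x \<bullet> b) * pd c u x" and ?h = "\<lambda>x. (c \<bullet> b) * u x"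
    have "L2_inner \<Omega> (pd c ?v) (pd c ?v) = L2_inner \<Omega> (\<lambda>x. ?f x + ?h x) (\<lambda>x. ?f x + ?h x)"
      using ut by (simp add: pd_coord_mult)
    also have "\<dots> \<le> 2 * L2_inner \<Omega> ?f ?f + 2 * L2_inner \<Omega> ?h ?h"
      using ut b c by (intro L2_inner_add_self_le L2_on_coord L2_on_scale tf_L2 tf_pd_L2)
    also have "L2_inner \<Omega> ?h ?h = (if c = b then L2_inner \<Omega> u u else 0)"
      unfolding L2_inner_scale_left L2_inner_scale_right using b c by (simp add: inner_Basis)
    also have "L2_inner \<Omega> ?f ?f \<le> R\<^sup>2 * L2_inner \<Omega> (pd c u) (pd c u)"
      using ut c by (intro gL tf_pd_L2)
    finally show "L2_inner \<Omega> (pd c ?v) (pd c ?v) \<le> 2 * R\<^sup>2 * L2_inner \<Omega> (pd c u) (pd c u)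
      + (if c = b then 2 * L2_inner \<Omega> u u else 0)" by (simp split: if_splits)
  qed
  also have "\<dots> = 2 * R\<^sup>2 * dirichlet_form \<Omega> u u + 2 * L2_inner \<Omega> u u"
    using b by (simp add: sum.distrib dirichlet_form_def sum_distrib_left)
  finally have D: "dirichlet_form \<Omega> ?v ?v \<le> 2 * R\<^sup>2 * dirichlet_form \<Omega> u u + 2 * L2_inner \<Omega> u u" .
  define S where "S f = (LINT x|lebesgue_on \<Omega>. f x * f x / (norm x)\<^sup>2)" for f :: "'a \<Rightarrow> real"
  have "\<mu> * S ?v \<le> \<mu> * (R\<^sup>2 * S u)"
  proof (cases "\<mu> = 0")
    case False
    have "S ?v \<le> (LINT x|lebesgue_on \<Omega>. R\<^sup>2 * (u x * u x / (norm x)\<^sup>2))"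
      unfolding S_def
    proof (rule integral_mono)
      show "integrable (lebesgue_on \<Omega>) (\<lambda>x. ?v x * ?v x / (norm x)\<^sup>2)"
        using False u b by (intro core_singular_integrable core_coord)
      show "integrable (lebesgue_on \<Omega>) (\<lambda>x. R\<^sup>2 * (u x * u x / (norm x)\<^sup>2))"
        using False u by (intro integrable_mult_right core_singular_integrable)
      show "?v x * ?v x / (norm x)\<^sup>2 \<le> R\<^sup>2 * (u x * u x / (norm x)\<^sup>2)"
        if "x \<in> space (lebesgue_on \<Omega>)" for x
      proof -
        have "(x \<bullet> b)\<^sup>2 * (u x * u x / (norm x)\<^sup>2) \<le> R\<^sup>2 * (u x * u x / (norm x)\<^sup>2)"
          using R2[of x] that by (intro mult_right_mono) auto
        then show ?thesis by (simp add: power2_eq_square mult_ac)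
      qed
    qed
    also have "\<dots> = R\<^sup>2 * S u" unfolding S_def by (rule integral_mult_right_zero)
    finally show ?thesis using \<mu> by (rule mult_left_mono)
  qed simp
  \<comment> \<open>A deliberate loss of a factor 2, to match the bound for the gradient
    term.\<close>
  also have "\<mu> * (R\<^sup>2 * S u) \<le> 2 * R\<^sup>2 * (\<mu> * S u)"
    using \<mu> singular_integral_nonneg[of u] by (simp add: S_def)
  finally have S: "\<mu> * S ?v \<le> 2 * R\<^sup>2 * (\<mu> * S u)" .
  have *: "hardy_form \<Omega> \<mu> f f = dirichlet_form \<Omega> f f + \<mu> * S f" if "f \<in> test_functions \<Omega>" for f
    using that by (simp add: hardy_form_eq S_def)
  show ?thesis
    unfolding *[OF ut] *[OF test_functions_coord[OF ut]] distrib_left using D S by linarith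
qed

end

context hardy_domain
begin

lemma hardy_approx_coord:
  assumes \<mu>: "\<mu> \<ge> 0" and w: "hardy_approx \<Omega> \<mu> w u" and b: "b \<in> Basis"
  shows "hardy_approx \<Omega> \<mu> (\<lambda>n x. (x \<bullet> b) * w n x) (\<lambda>x. (x \<bullet> b) * u x)"
proof -
  obtain R where R: "R \<ge> 0" "\<And>x b. x \<in> \<Omega> \<Longrightarrow> b \<in> Basis \<Longrightarrow> \<bar>x \<bullet> b\<bar> \<le> R"
    using coord_bound by metis
  have core: "w n \<in> hardy_core \<Omega> \<mu>" for n using w by (rule hardy_approx_core)
  have "\<exists>M. \<forall>m\<ge>M. \<forall>n\<ge>M. Q (\<lambda>x. (x \<bullet> b) * w m x - (x \<bullet> b) * w n x) (\<lambda>x. (x \<bullet> b) * w m x - (x \<bullet> b) * w n x) < e"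
    if e: "e > 0" for e
  proof -
    \<comment> \<open>The two contributions add up to (2 R^2 + 2) e'; the 3 makes the final
      inequality strict.\<close>
    define e' where "e' = e / (2 * R\<^sup>2 + 3)"
    have p: "2 * R\<^sup>2 + 3 > 0" by (simp add: add_nonneg_pos)
    have e': "e' > 0" "sqrt e' > 0" using e p by (auto simp: e'_def)
    obtain M where M: "\<And>m n. m \<ge> M \<Longrightarrow> n \<ge> M \<Longrightarrow> Q (\<lambda>x. w m x - w n x) (\<lambda>x. w m x - w n x) < e'"
      using w e'(1) unfolding hardy_approx_iff by meson
    obtain K where K: "\<And>m n. m \<ge> K \<Longrightarrow> n \<ge> K \<Longrightarrow> L2_norm \<Omega> (\<lambda>x. w m x - w n x) < sqrt e'"
      using L2_lim_Cauchy[OF hardy_approx_L2_lim[OF w] e'(2)] by meson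
    have "Q (\<lambda>x. (x \<bullet> b) * w m x - (x \<bullet> b) * w n x) (\<lambda>x. (x \<bullet> b) * w m x - (x \<bullet> b) * w n x) < e"
      if "m \<ge> max M K" "n \<ge> max M K" for m n
    proof -
      let ?d = "\<lambda>x. w m x - w n x"
      have "Q (\<lambda>x. (x \<bullet> b) * ?d x) (\<lambda>x. (x \<bullet> b) * ?d x) \<le> 2 * R\<^sup>2 * Q ?d ?d + 2 * L2_inner \<Omega> ?d ?d"
        using hardy_form_coord_le[OF \<mu> core_diff[OF core core] b R] .
      also have "\<dots> \<le> 2 * R\<^sup>2 * e' + 2 * e'"
      proof (intro add_mono mult_left_mono)
        show "Q ?d ?d \<le> e'" using M[of m n] that by simp
        show "L2_inner \<Omega> ?d ?d \<le> e'"
          using K[of m n] that by (simp add: L2_norm_def)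
      qed auto
      also have "\<dots> < (2 * R\<^sup>2 + 3) * e'" using e' by (simp add: algebra_simps)
      also have "\<dots> = e" using p by (simp add: e'_def)
      finally show ?thesis by (simp add: right_diff_distrib)
    qed
    then show ?thesis by blast
  qed
  with w core show ?thesis using b by (auto simp: hardy_approx_iff core_coord L2_lim_coord)
qed

text \<open>Provides a derivative for a function known only as a limit: the form dominates the
  Dirichlet form, so the derivatives of the approximants are Cauchy.\<close>

lemma hardy_approx_pd_lim:
  assumes \<mu>: "\<mu> \<ge> 0" and w: "hardy_approx \<Omega> \<mu> w u" and b: "b \<in> Basis"
  shows "\<exists>d. L2_lim \<Omega> (\<lambda>n. pd b (w n)) d"
proof (rule L2_complete[OF lmeasurable_\<Omega>])
  have core: "w n \<in> hardy_core \<Omega> \<mu>" for n using w by (rule hardy_approx_core)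
  then show "pd b (w n) \<in> L2_on \<Omega>" for n using b by (intro tf_pd_L2 core_tf)
  fix e :: real assume e: "e > 0"
  then have "e\<^sup>2 > 0" by simp
  then obtain M where M: "\<And>m n. m \<ge> M \<Longrightarrow> n \<ge> M \<Longrightarrow> Q (\<lambda>x. w m x - w n x) (\<lambda>x. w m x - w n x) < e\<^sup>2"
    using w unfolding hardy_approx_iff by meson
  have "L2_norm \<Omega> (\<lambda>x. pd b (w m) x - pd b (w n) x) < e" if "m \<ge> M" "n \<ge> M" for m n
  proof (rule power2_less_imp_less)
    let ?d = "\<lambda>x. w m x - w n x"
    have d: "?d \<in> test_functions \<Omega>" using core core_diff core_tf by blast
    have "(L2_norm \<Omega> (\<lambda>x. pd b (w m) x - pd b (w n) x))\<^sup>2 = L2_inner \<Omega> (pd b ?d) (pd b ?d)"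
      by (simp add: L2_norm_power2 pd_diff test_functions_differentiable[OF core_tf[OF core]])
    also have "\<dots> \<le> dirichlet_form \<Omega> ?d ?d"
      unfolding dirichlet_form_def using b by (intro member_le_sum L2_inner_self_nonneg) auto
    also have "\<dots> \<le> Q ?d ?d" using \<mu> d by (rule dirichlet_form_le_hardy_form)
    also have "\<dots> < e\<^sup>2" using M that by blast
    finally show "(L2_norm \<Omega> (\<lambda>x. pd b (w m) x - pd b (w n) x))\<^sup>2 < e\<^sup>2" .
  qed (use e in simp)
  then show "\<exists>M. \<forall>m\<ge>M. \<forall>n\<ge>M. L2_norm \<Omega> (\<lambda>x. pd b (w m) x - pd b (w n) x) < e" by blast
qed

end

text \<open>\<open>a i j\<close> and \<open>(l i - l j) * a i j / 2\<close> are the matrix entries of multiplication by a coordinate and of the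
  partial derivative. After symmetrisation in \<open>i, j\<close> the contributions of \<open>a\<close> on both sides cancel.\<close>

lemma yang_summation:
  fixes a :: "nat \<Rightarrow> nat \<Rightarrow> real" and l D :: "nat \<Rightarrow> real"
  assumes I: "finite I" and sym: "\<And>i j. i \<in> I \<Longrightarrow> j \<in> I \<Longrightarrow> a i j = a j i"
    and le: "\<And>i. i \<in> I \<Longrightarrow> l i \<le> L"
    and P: "\<And>i. i \<in> I \<Longrightarrow>
      (L - l i) * (1 + (\<Sum>j\<in>I. (l i - l j) * (a i j)\<^sup>2)) \<le> 4 * D i - (\<Sum>j\<in>I. (l i - l j)\<^sup>2 * (a i j)\<^sup>2)"
  shows "(\<Sum>i\<in>I. (L - l i)\<^sup>2) \<le> 4 * (\<Sum>i\<in>I. (L - l i) * D i)"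
proof -
  \<comment> \<open>The bracket factors as (L - l_i) (l_i - l_j) (L - l_j), which changes sign when
    i and j are exchanged; so the double sum vanishes.\<close>
  define f where "f i j = ((L - l i)\<^sup>2 * (l i - l j) + (L - l i) * (l i - l j)\<^sup>2) * (a i j)\<^sup>2" for i j
  have anti: "f i j = - f j i" if "i \<in> I" "j \<in> I" for i j
    unfolding f_def sym[OF that] by (simp add: power2_eq_square algebra_simps)
  have "(\<Sum>i\<in>I. \<Sum>j\<in>I. f i j) = (\<Sum>i\<in>I. \<Sum>j\<in>I. - f j i)"
    by (intro sum.cong refl anti)
  also have "\<dots> = - (\<Sum>i\<in>I. \<Sum>j\<in>I. f i j)"
    by (subst sum.swap) (simp add: sum_negf)
  finally have z: "(\<Sum>i\<in>I. \<Sum>j\<in>I. f i j) = 0" by simp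
  have "(L - l i)\<^sup>2 + (\<Sum>j\<in>I. f i j) \<le> 4 * ((L - l i) * D i)" if i: "i \<in> I" for i
  proof -
    have "(L - l i) * ((L - l i) * (1 + (\<Sum>j\<in>I. (l i - l j) * (a i j)\<^sup>2)))
      \<le> (L - l i) * (4 * D i - (\<Sum>j\<in>I. (l i - l j)\<^sup>2 * (a i j)\<^sup>2))"
      using P[OF i] le[OF i] by (intro mult_left_mono) auto
    moreover have "(\<Sum>j\<in>I. f i j) = (L - l i)\<^sup>2 * (\<Sum>j\<in>I. (l i - l j) * (a i j)\<^sup>2)
        + (L - l i) * (\<Sum>j\<in>I. (l i - l j)\<^sup>2 * (a i j)\<^sup>2)"
      by (simp add: f_def sum_distrib_left distrib_right sum.distrib mult.assoc)
    ultimately show ?thesis by (simp add: power2_eq_square algebra_simps)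
  qed
  then have "(\<Sum>i\<in>I. (L - l i)\<^sup>2 + (\<Sum>j\<in>I. f i j)) \<le> (\<Sum>i\<in>I. 4 * ((L - l i) * D i))"
    by (intro sum_mono)
  then show ?thesis using z by (simp add: sum.distrib sum_distrib_left)
qed

context hardy_eigensystem
begin

text \<open>For the trial function v, which is x_b \<phi>_i minus its projection, the commutator
  gives form value \<lambda>_i |v|^2 + P with P = -2 <\<partial>_b \<phi>_i, v>. The variational
  inequality bounds |v|^2 by P, Cauchy-Schwarz bounds P^2 by a multiple of |v|^2, and eliminating
  |v|^2 leaves the hypothesis of \<open>yang_summation\<close>.\<close>

lemma yang_coordinate:
  assumes \<mu>: "\<mu> \<ge> 0" and b: "b \<in> Basis"
    and w: "\<And>i. i \<ge> 1 \<Longrightarrow> hardy_approx \<Omega> \<mu> (w i) (\<phi> i)"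
    and d: "\<And>i. i \<ge> 1 \<Longrightarrow> L2_lim \<Omega> (\<lambda>n. pd b (w i n)) (d i)"
  shows "(\<Sum>i\<in>{1..k}. (lam (Suc k) - lam i)\<^sup>2)
    \<le> 4 * (\<Sum>i\<in>{1..k}. (lam (Suc k) - lam i) * L2_inner \<Omega> (d i) (d i))"
proof -
  define I where "I = {1..k}"
  have I: "finite I" "\<And>i. i \<in> I \<Longrightarrow> i \<ge> 1" by (auto simp: I_def)
  define L where "L = lam (Suc k)"
  define G where "G u = (\<lambda>x. (x \<bullet> b) * u x)" for u :: "'a \<Rightarrow> real"
  have Gsym: "L2_inner \<Omega> (G u) v = L2_inner \<Omega> u (G v)" for u v
    unfolding G_def by (rule L2_inner_coord_swap)
  have GL: "u \<in> L2_on \<Omega> \<Longrightarrow> G u \<in> L2_on \<Omega>" for u unfolding G_def by (rule L2_on_coord[OF b])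
  define a where "a i j = L2_inner \<Omega> (G (\<phi> i)) (\<phi> j)" for i j
  have asym: "a i j = a j i" for i j
    unfolding a_def Gsym[of "\<phi> i"] by (rule L2_inner_commute)
  define \<delta> where "\<delta> i j = L2_inner \<Omega> (d i) (\<phi> j)" for i j
  have wc: "w i n \<in> hardy_core \<Omega> \<mu>" if "i \<ge> 1" for i n using w[OF that] by (rule hardy_approx_core)
  have wt: "w i n \<in> test_functions \<Omega>" if "i \<ge> 1" for i n using wc[OF that] by (rule core_tf)
  have wL: "L2_lim \<Omega> (w i) (\<phi> i)" if "i \<ge> 1" for i using w[OF that] by (rule hardy_approx_L2_lim)
  have Gw: "hardy_approx \<Omega> \<mu> (\<lambda>n. G (z n)) (G u)" if "hardy_approx \<Omega> \<mu> z u" for z u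
    unfolding G_def by (rule hardy_approx_coord[OF \<mu> that b])
  have dL: "d i \<in> L2_on \<Omega>" if "i \<ge> 1" for i using d[OF that] by (simp add: L2_lim_def)
  have swap: "Q (G u) v = Q u (G v) - 2 * L2_inner \<Omega> (pd b u) v"
    if "u \<in> test_functions \<Omega>" "v \<in> test_functions \<Omega>" for u v
    unfolding G_def using that b by (rule hardy_form_coord_swap)
  \<comment> \<open>The commutator identity between two eigenfunctions expresses the matrix of the
    derivative through the matrix of the coordinate.\<close>
  have \<delta>_eq: "2 * \<delta> i j = (lam i - lam j) * a i j" if i: "i \<ge> 1" and j: "j \<ge> 1" for i j
  proof -
    have "(\<lambda>n. Q (w j n) (G (w i n))) \<longlonglongrightarrow> lam j * L2_inner \<Omega> (\<phi> j) (G (\<phi> i))"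
      by (rule eigen_limit[OF j w[OF j] Gw[OF w[OF i]]])
    moreover have "(\<lambda>n. Q (w i n) (G (w j n)) - 2 * L2_inner \<Omega> (pd b (w i n)) (w j n))
      \<longlonglongrightarrow> lam i * L2_inner \<Omega> (\<phi> i) (G (\<phi> j)) - 2 * L2_inner \<Omega> (d i) (\<phi> j)"
      by (intro tendsto_intros eigen_limit[OF i w[OF i] Gw[OF w[OF j]]] L2_lim_inner d wL i j)
    moreover have "Q (w j n) (G (w i n)) = Q (w i n) (G (w j n)) - 2 * L2_inner \<Omega> (pd b (w i n)) (w j n)" for n
      using swap[OF wt[OF i] wt[OF j]] by (simp add: hardy_form_commute[of \<mu> "w j n"])
    ultimately have "lam j * L2_inner \<Omega> (\<phi> j) (G (\<phi> i)) = lam i * L2_inner \<Omega> (\<phi> i) (G (\<phi> j)) - 2 * L2_inner \<Omega> (d i) (\<phi> j)"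
      using LIMSEQ_unique by simp
    then show ?thesis
      using Gsym[of "\<phi> i" "\<phi> j"] L2_inner_commute[of \<Omega> "\<phi> j" "G (\<phi> i)"]
      unfolding \<delta>_def a_def left_diff_distrib by simp
  qed
  \<comment> \<open>Integrating x_b \<partial>_b(\<phi>_i^2) by parts gives -1, by
    normalisation.\<close>
  have dG: "2 * L2_inner \<Omega> (d i) (G (\<phi> i)) = -1" if i: "i \<ge> 1" for i
  proof -
    have "2 * L2_inner \<Omega> (pd b (w i n)) (G (w i n)) = - L2_inner \<Omega> (w i n) (w i n)" for n
    proof -
      have t: "G (w i n) \<in> test_functions \<Omega>" unfolding G_def using wt[OF i] by (rule test_functions_coord)
      have "pd b (G (w i n)) = (\<lambda>x. G (pd b (w i n)) x + w i n x)"
        unfolding G_def using wt[OF i] b by (simp add: pd_coord_mult inner_Basis)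
      then have "L2_inner \<Omega> (pd b (w i n)) (G (w i n))
        = - L2_inner \<Omega> (w i n) (\<lambda>x. G (pd b (w i n)) x + w i n x)"
        using pd_integration_by_parts[OF wt[OF i] t b] by simp
      also have "\<dots> = - L2_inner \<Omega> (w i n) (G (pd b (w i n))) - L2_inner \<Omega> (w i n) (w i n)"
        using wt[OF i] b by (simp add: L2_inner_add_right GL tf_L2 tf_pd_L2)
      also have "L2_inner \<Omega> (w i n) (G (pd b (w i n))) = L2_inner \<Omega> (pd b (w i n)) (G (w i n))"
        by (simp add: L2_inner_commute flip: Gsym)
      finally show ?thesis by simp
    qed
    moreover have "(\<lambda>n. 2 * L2_inner \<Omega> (pd b (w i n)) (G (w i n))) \<longlonglongrightarrow> 2 * L2_inner \<Omega> (d i) (G (\<phi> i))"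
      by (intro tendsto_intros L2_lim_inner d i hardy_approx_L2_lim Gw w)
    moreover have "(\<lambda>n. - L2_inner \<Omega> (w i n) (w i n)) \<longlonglongrightarrow> - L2_inner \<Omega> (\<phi> i) (\<phi> i)"
      by (intro tendsto_intros L2_lim_inner wL i)
    ultimately show ?thesis using orthonormal[OF i i] LIMSEQ_unique by simp
  qed
  have "(L - lam i) * (1 + (\<Sum>j\<in>I. (lam i - lam j) * (a i j)\<^sup>2))
      \<le> 4 * L2_inner \<Omega> (d i) (d i) - (\<Sum>j\<in>I. (lam i - lam j)\<^sup>2 * (a i j)\<^sup>2)" if "i \<in> I" for i
  proof -
    have i: "i \<ge> 1" using I that by blast
    have iL: "lam i \<le> L" using that by (auto simp: L_def I_def intro!: lam_mono)
    define y where "y n = (\<lambda>x. G (w i n) x - (\<Sum>j\<in>I. a i j * w j n x))" for n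
    define v where "v = (\<lambda>x. G (\<phi> i) x - (\<Sum>j\<in>I. a i j * \<phi> j x))"
    have yv: "hardy_approx \<Omega> \<mu> y v"
      unfolding y_def v_def by (intro hardy_approx_diff hardy_approx_sum hardy_approx_scale Gw w i I)
    have yc: "y n \<in> hardy_core \<Omega> \<mu>" for n using yv by (rule hardy_approx_core)
    have Gwc: "G (w i n) \<in> hardy_core \<Omega> \<mu>" for n using Gw[OF w[OF i]] by (rule hardy_approx_core)
    have vL: "v \<in> L2_on \<Omega>" using hardy_approx_L2_lim[OF yv] by (simp add: L2_lim_def)
    have sL: "(\<lambda>x. \<Sum>j\<in>I. c j * \<phi> j x) \<in> L2_on \<Omega>" for c
      using I by (intro L2_on_sum L2_on_scale \<phi>_L2)
    have vo: "L2_inner \<Omega> v (\<phi> j) = 0" if j: "1 \<le> j" "j \<le> k" for j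
      unfolding v_def using inner_sum_basis[OF I j(1), of "\<lambda>j. a i j"] j GL[OF \<phi>_L2[OF i]] sL[of "a i"]
      by (simp add: L2_inner_diff_left \<phi>_L2 a_def I_def)
    have vs: "L2_inner \<Omega> v (\<lambda>x. \<Sum>j\<in>I. c j * \<phi> j x) = 0" for c
      using vo I vL by (subst L2_inner_sum_right)
        (auto simp: \<phi>_L2 L2_on_scale L2_inner_scale_right I_def intro!: sum.neutral)
    have vG: "L2_inner \<Omega> (G (\<phi> i)) v = L2_inner \<Omega> v v"
    proof -
      have "L2_inner \<Omega> v v = L2_inner \<Omega> (G (\<phi> i)) v - L2_inner \<Omega> (\<lambda>x. \<Sum>j\<in>I. a i j * \<phi> j x) v"
        using vL GL[OF \<phi>_L2[OF i]] sL[of "a i"] unfolding v_def by (intro L2_inner_diff_left)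
      then show ?thesis
        using vs[of "a i"] L2_inner_commute[of \<Omega> v "\<lambda>x. \<Sum>j\<in>I. a i j * \<phi> j x"] by simp
    qed
    define P where "P = - 2 * L2_inner \<Omega> (d i) v"
    have "(\<lambda>n. (Q (w i n) (G (y n)) - 2 * L2_inner \<Omega> (pd b (w i n)) (y n)) - (\<Sum>j\<in>I. a i j * Q (w j n) (y n)))
      \<longlonglongrightarrow> (lam i * L2_inner \<Omega> (\<phi> i) (G v) - 2 * L2_inner \<Omega> (d i) v)
        - (\<Sum>j\<in>I. a i j * (lam j * L2_inner \<Omega> (\<phi> j) v))"
      by (intro tendsto_intros eigen_limit[OF i w[OF i] Gw[OF yv]] L2_lim_inner d i
          hardy_approx_L2_lim[OF yv] eigen_limit[OF _ w yv] I)
    moreover have "(\<Sum>j\<in>I. a i j * (lam j * L2_inner \<Omega> (\<phi> j) v)) = 0"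
      using vo by (auto simp: I_def L2_inner_commute[of _ _ v] intro!: sum.neutral)
    moreover have "Q (y n) (y n) = (Q (w i n) (G (y n)) - 2 * L2_inner \<Omega> (pd b (w i n)) (y n))
        - (\<Sum>j\<in>I. a i j * Q (w j n) (y n))" for n
    proof -
      have "Q (y n) (y n) = Q (G (w i n)) (y n) - Q (\<lambda>x. \<Sum>j\<in>I. a i j * w j n x) (y n)"
        using Gwc[of n] yc[of n] wc I unfolding y_def
        by (intro hardy_form_diff_left core_sum core_scale) auto
      also have "Q (\<lambda>x. \<Sum>j\<in>I. a i j * w j n x) (y n) = (\<Sum>j\<in>I. a i j * Q (w j n) (y n))"
        using wc I yc by (intro hardy_form_sum_left) auto
      also have "Q (G (w i n)) (y n) = Q (w i n) (G (y n)) - 2 * L2_inner \<Omega> (pd b (w i n)) (y n)"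
        by (intro swap wt i core_tf[OF yc])
      finally show ?thesis .
    qed
    ultimately have "(\<lambda>n. Q (y n) (y n)) \<longlonglongrightarrow> lam i * L2_inner \<Omega> v v + P"
      by (simp add: P_def vG flip: Gsym)
    from Rayleigh[OF yv order_refl this vo]
    \<comment> \<open>\<open>v\<close> is orthogonal to the first k eigenfunctions, so its form
      value is at least \<lambda>_(k+1) |v|^2.\<close>
    have R: "(L - lam i) * L2_inner \<Omega> v v \<le> P" by (simp add: L_def algebra_simps)
    have P_eq: "P = 1 + (\<Sum>j\<in>I. (lam i - lam j) * (a i j)\<^sup>2)"
    proof -
      have "L2_inner \<Omega> (d i) v = L2_inner \<Omega> (d i) (G (\<phi> i)) - L2_inner \<Omega> (d i) (\<lambda>x. \<Sum>j\<in>I. a i j * \<phi> j x)"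
        unfolding v_def by (intro L2_inner_diff_right dL GL \<phi>_L2 i sL)
      also have "L2_inner \<Omega> (d i) (\<lambda>x. \<Sum>j\<in>I. a i j * \<phi> j x) = (\<Sum>j\<in>I. a i j * \<delta> i j)"
        using I dL[OF i] by (subst L2_inner_sum_right)
          (auto simp: \<phi>_L2 L2_on_scale L2_inner_scale_right \<delta>_def)
      finally have "P = 1 + 2 * (\<Sum>j\<in>I. a i j * \<delta> i j)"
        using dG[OF i] by (simp add: P_def)
      also have "2 * (\<Sum>j\<in>I. a i j * \<delta> i j) = (\<Sum>j\<in>I. a i j * (2 * \<delta> i j))"
        by (simp add: sum_distrib_left mult_ac)
      also have "(\<Sum>j\<in>I. a i j * (2 * \<delta> i j)) = (\<Sum>j\<in>I. (lam i - lam j) * (a i j)\<^sup>2)"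
        using \<delta>_eq[OF i] I by (intro sum.cong refl) (simp add: power2_eq_square)
      finally show ?thesis .
    qed
    \<comment> \<open>As \<open>v\<close> is orthogonal to all \<phi>_j with j in \<open>I\<close>,
      the derivative may be replaced by its own remainder \<open>r\<close> in P. This sharpens
      Cauchy-Schwarz by the sum of squares that the symmetrisation needs.\<close>
    define r where "r = (\<lambda>x. d i x - (\<Sum>j\<in>I. \<delta> i j * \<phi> j x))"
    have rL: "r \<in> L2_on \<Omega>" unfolding r_def by (intro L2_on_diff dL i sL)
    have rr: "L2_inner \<Omega> r r = L2_inner \<Omega> (d i) (d i) - (\<Sum>j\<in>I. (\<delta> i j)\<^sup>2)"
      unfolding r_def \<delta>_def by (rule Bessel_identity[OF I dL[OF i]])
    have "P = - 2 * L2_inner \<Omega> r v"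
    proof -
      have "L2_inner \<Omega> v r = L2_inner \<Omega> v (d i) - L2_inner \<Omega> v (\<lambda>x. \<Sum>j\<in>I. \<delta> i j * \<phi> j x)"
        unfolding r_def by (intro L2_inner_diff_right dL i sL vL)
      then show ?thesis
        using vs[of "\<delta> i"] by (simp add: P_def L2_inner_commute[of \<Omega> v])
    qed
    then have "P\<^sup>2 = 4 * (L2_inner \<Omega> r v)\<^sup>2" by (simp add: power_mult_distrib)
    also have "\<dots> \<le> 4 * (L2_inner \<Omega> r r * L2_inner \<Omega> v v)"
      using L2_Cauchy_Schwarz_power2[OF rL vL] by simp
    finally have CS: "P\<^sup>2 \<le> 4 * L2_inner \<Omega> r r * L2_inner \<Omega> v v" by simp
    have P0: "P \<ge> 0"
      using R iL L2_inner_self_nonneg[of \<Omega> v] by (smt (verit) mult_nonneg_nonneg)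
    \<comment> \<open>A factor P is cancelled below, so P = 0 is treated on its own.\<close>
    have "(L - lam i) * P \<le> 4 * L2_inner \<Omega> r r"
    proof (cases "P = 0")
      case True
      then show ?thesis using L2_inner_self_nonneg[of \<Omega> r] by simp
    next
      case False
      have "(L - lam i) * P\<^sup>2 \<le> (L - lam i) * (4 * L2_inner \<Omega> r r * L2_inner \<Omega> v v)"
        using CS iL by (intro mult_left_mono) auto
      also have "\<dots> = 4 * L2_inner \<Omega> r r * ((L - lam i) * L2_inner \<Omega> v v)" by simp
      also have "\<dots> \<le> 4 * L2_inner \<Omega> r r * P"
        using R L2_inner_self_nonneg[of \<Omega> r] by (intro mult_left_mono) auto
      finally have "((L - lam i) * P) * P \<le> (4 * L2_inner \<Omega> r r) * P" by (simp add: power2_eq_square)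
      then show ?thesis using P0 False by (simp add: mult_le_cancel_right)
    qed
    moreover have "4 * (\<Sum>j\<in>I. (\<delta> i j)\<^sup>2) = (\<Sum>j\<in>I. (lam i - lam j)\<^sup>2 * (a i j)\<^sup>2)"
    proof -
      have "4 * (\<delta> i j)\<^sup>2 = (lam i - lam j)\<^sup>2 * (a i j)\<^sup>2" if "j \<in> I" for j
      proof -
        have "4 * (\<delta> i j)\<^sup>2 = (2 * \<delta> i j)\<^sup>2" by (simp add: power_mult_distrib)
        then show ?thesis using \<delta>_eq[OF i I(2)[OF that]] by (simp add: power_mult_distrib)
      qed
      then show ?thesis by (simp add: sum_distrib_left)
    qed
    ultimately show ?thesis unfolding P_eq rr by simp
  qed
  then have "(\<Sum>i\<in>I. (L - lam i)\<^sup>2) \<le> 4 * (\<Sum>i\<in>I. (L - lam i) * L2_inner \<Omega> (d i) (d i))"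
    by (intro yang_summation[where a=a] I asym) (auto simp: I_def L_def intro!: lam_mono)
  then show ?thesis by (simp add: I_def L_def)
qed

text \<open>The left-hand side of the coordinate inequality does not depend on the coordinate, so
  the sum over all of them produces the factor N.\<close>

theorem yang_inequality:
  assumes \<mu>: "\<mu> \<ge> 0"
  shows "real DIM('a) * (\<Sum>i\<in>{1..k}. (lam (Suc k) - lam i)\<^sup>2)
    \<le> 4 * (\<Sum>i\<in>{1..k}. (lam (Suc k) - lam i) * lam i)"
proof -
  obtain w where w: "\<And>k. k \<ge> 1 \<Longrightarrow> hardy_approx \<Omega> \<mu> (w k) (\<phi> k)" using approximants by metis
  have "\<forall>b i. b \<in> Basis \<longrightarrow> i \<ge> 1 \<longrightarrow> (\<exists>d. L2_lim \<Omega> (\<lambda>n. pd b (w i n)) d)"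
    using hardy_approx_pd_lim[OF \<mu> w] by blast
  then obtain d where d: "\<And>b i. b \<in> Basis \<Longrightarrow> i \<ge> 1 \<Longrightarrow> L2_lim \<Omega> (\<lambda>n. pd b (w i n)) (d b i)"
    by metis
  \<comment> \<open>The total gradient is controlled by the eigenvalue because the nonnegative
    potential term is discarded.\<close>
  have D: "(\<Sum>b\<in>Basis. L2_inner \<Omega> (d b i) (d b i)) \<le> lam i" if i: "i \<ge> 1" for i
  proof (rule LIMSEQ_le)
    show "(\<lambda>n. dirichlet_form \<Omega> (w i n) (w i n)) \<longlonglongrightarrow> (\<Sum>b\<in>Basis. L2_inner \<Omega> (d b i) (d b i))"
      unfolding dirichlet_form_def by (intro tendsto_sum L2_lim_inner d i)
    show "(\<lambda>n. Q (w i n) (w i n)) \<longlonglongrightarrow> lam i" by (rule eigen_form_limit[OF i w[OF i]])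
    show "\<exists>N. \<forall>n\<ge>N. dirichlet_form \<Omega> (w i n) (w i n) \<le> Q (w i n) (w i n)"
      using dirichlet_form_le_hardy_form[OF \<mu> core_tf[OF hardy_approx_core[OF w[OF i]]]] by blast
  qed
  have "real DIM('a) * (\<Sum>i\<in>{1..k}. (lam (Suc k) - lam i)\<^sup>2)
    = (\<Sum>b\<in>(Basis::'a set). \<Sum>i\<in>{1..k}. (lam (Suc k) - lam i)\<^sup>2)" by simp
  also have "\<dots> \<le> (\<Sum>b\<in>Basis. 4 * (\<Sum>i\<in>{1..k}. (lam (Suc k) - lam i) * L2_inner \<Omega> (d b i) (d b i)))"
    by (intro sum_mono yang_coordinate[OF \<mu> _ w d])
  also have "\<dots> = 4 * (\<Sum>i\<in>{1..k}. (lam (Suc k) - lam i) * (\<Sum>b\<in>Basis. L2_inner \<Omega> (d b i) (d b i)))"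
    by (simp add: sum_distrib_left sum.swap[of _ Basis])
  also have "\<dots> \<le> 4 * (\<Sum>i\<in>{1..k}. (lam (Suc k) - lam i) * lam i)"
    using D by (intro mult_left_mono sum_mono) (auto intro!: lam_mono)
  finally show ?thesis .
qed

end

subsection \<open>The Cheng-Yang recursion\<close>

text \<open>The cubic Taylor polynomial of \<open>(1 - \<beta>) powr - e\<close>, all of whose coefficients are positive.\<close>

lemma powr_neg_cubic_lower_bound:
  fixes e \<beta> :: real
  assumes e: "e > 0" and \<beta>: "0 \<le> \<beta>" "\<beta> < 1"
  shows "1 + e * \<beta> + e * (e + 1) / 2 * \<beta>\<^sup>2 + e * (e + 1) * (e + 2) / 6 * \<beta>^3 \<le> (1 - \<beta>) powr (- e)"
proof -
  define p where "p x = 1 + e * x + e * (e + 1) / 2 * x\<^sup>2 + e * (e + 1) * (e + 2) / 6 * x^3" for x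
  define p' where "p' x = e + e * (e + 1) * x + e * (e + 1) * (e + 2) / 2 * x\<^sup>2" for x
  have dp: "(p has_real_derivative p' x) (at x)" for x
    unfolding p_def p'_def by (auto intro!: derivative_eq_intros simp: field_simps power2_eq_square)
  \<comment> \<open>The product with the inverse power is nonincreasing: in (1 - x) p' - e p the
    terms below degree three cancel, and one negative cubic term remains.\<close>
  have "p \<beta> * (1 - \<beta>) powr e \<le> p 0 * (1 - 0) powr e"
  proof (rule DERIV_nonpos_imp_nonincreasing[OF \<beta>(1)])
    fix x assume x: "0 \<le> x" "x \<le> \<beta>"
    have x1: "1 - x > 0" using x \<beta> by simp
    have "((\<lambda>x. p x * (1 - x) powr e) has_real_derivative
        p' x * (1 - x) powr e + p x * (e * (1 - x) powr (e - 1) * (-1))) (at x)"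
      using x1 by (auto intro!: derivative_eq_intros dp)
    moreover have "p' x * (1 - x) powr e + p x * (e * (1 - x) powr (e - 1) * (-1))
      = (1 - x) powr (e - 1) * (p' x * (1 - x) - e * p x)"
      using x1 by (simp add: powr_diff field_simps)
    moreover have "p' x * (1 - x) - e * p x
      = - (e * (e + 1) * (e + 2) / 2 + e * (e * (e + 1) * (e + 2) / 6)) * x^3"
      unfolding p_def p'_def by (simp add: field_simps power2_eq_square power3_eq_cube)
    moreover have "\<dots> \<le> 0"
    proof (rule mult_nonpos_nonneg)
      have "0 \<le> e * (e + 1) * (e + 2) / 2 + e * (e * (e + 1) * (e + 2) / 6)" using e by simp
      then show "- (e * (e + 1) * (e + 2) / 2 + e * (e * (e + 1) * (e + 2) / 6)) \<le> 0" by linarith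
    qed (use x in simp)
    ultimately show "\<exists>y. ((\<lambda>x. p x * (1 - x) powr e) has_real_derivative y) (at x) \<and> y \<le> 0"
      by (metis mult_nonneg_nonpos powr_ge_zero)
  qed
  then have "p \<beta> * (1 - \<beta>) powr e \<le> 1" by (simp add: p_def)
  then show ?thesis
    using \<beta> unfolding p_def[symmetric] by (simp add: powr_minus field_simps)
qed

lemma binary_quadratic_form_nonneg:
  fixes a b c :: real
  assumes "a > 0" "b\<^sup>2 \<le> a * c"
  shows "0 \<le> a * x\<^sup>2 - 2 * b * x * y + c * y\<^sup>2"
proof -
  have "a * (a * x\<^sup>2 - 2 * b * x * y + c * y\<^sup>2) = (a * x - b * y)\<^sup>2 + (a * c - b\<^sup>2) * y\<^sup>2"
    by (simp add: power2_eq_square algebra_simps)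
  moreover have "\<dots> \<ge> 0" using assms by (intro add_nonneg_nonneg mult_nonneg_nonneg) auto
  ultimately have "0 \<le> a * (a * x\<^sup>2 - 2 * b * x * y + c * y\<^sup>2)" by simp
  then show ?thesis using assms(1) by (simp add: zero_le_mult_iff)
qed

text \<open>Here \<open>d = 2/N\<close> and \<open>\<beta> = 1/(k + 1)\<close>, \<open>\<Lambda>\<close> is the mean of the first \<open>k\<close> eigenvalues, \<open>x\<close> is the next
  one, and \<open>F\<close> is \<open>(1 + d) \<Lambda>\<^sup>2\<close> minus the mean of the squares. The left-hand side is the value of \<open>F\<close> for
  \<open>k + 1\<close> eigenvalues. Eliminating \<open>F\<close> leaves a quadratic form in \<open>x\<close> and \<open>\<Lambda>\<close>.\<close>

lemma cheng_yang_step: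
  fixes d \<beta> x \<Lambda> F :: real
  assumes d: "d > 0" and \<beta>: "0 < \<beta>" "\<beta> \<le> 1/2"
    and yang: "x\<^sup>2 - 2 * (1 + d) * \<Lambda> * x + (1 + d) * (1 + 2 * d) * \<Lambda>\<^sup>2 \<le> (1 + 2 * d) * F"
  shows "(1 + d) * ((1 - \<beta>) * \<Lambda> + \<beta> * x)\<^sup>2 - ((1 - \<beta>) * ((1 + d) * \<Lambda>\<^sup>2 - F) + \<beta> * x\<^sup>2)
    \<le> (1 - \<beta>) powr (- 2 * d) * F"
proof -
  define e where "e = 2 * d"
  have e: "e > 0" using d by (simp add: e_def)
  define r where "r = (1 - \<beta>) powr (- e)"
  \<comment> \<open>The multiplier of the hypothesis for which the terms in \<open>F\<close> on both
    sides of the claim agree.\<close>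
  define A where "A = (r - (1 - \<beta>)) / (1 + e)"
  define h where "h = e * (e + 2) / 6"
  \<comment> \<open>\<open>A0\<close> is \<open>A\<close> with the power \<open>r\<close> replaced
    by its cubic Taylor polynomial.\<close>
  define A0 where "A0 = \<beta> + e / 2 * \<beta>\<^sup>2 + h * \<beta>^3"
  have h: "h > 0" using e by (simp add: h_def)
  have A0: "A0 \<le> A"
  proof -
    have "A0 * (1 + e) = (1 + e * \<beta> + e * (e + 1) / 2 * \<beta>\<^sup>2 + e * (e + 1) * (e + 2) / 6 * \<beta>^3) - (1 - \<beta>)"
      unfolding A0_def h_def by (simp add: field_simps power2_eq_square power3_eq_cube)
    also have "\<dots> \<le> r - (1 - \<beta>)"
      using powr_neg_cubic_lower_bound[OF e, of \<beta>] \<beta> by (simp add: r_def)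
    finally show ?thesis using e by (simp add: A_def pos_le_divide_eq)
  qed
  have b2: "\<beta>\<^sup>2 \<le> \<beta>" using \<beta> by (simp add: power2_eq_square)
  have A0b: "A0 \<ge> \<beta> + e / 2 * \<beta>\<^sup>2" using h \<beta> by (simp add: A0_def)
  \<comment> \<open>The terms of order two and three in \<beta> cancel. With h = 0 the quartic
    coefficient would be negative, hence the cubic Taylor term; what remains is nonnegative because
    \<beta> \<le> 1/2.\<close>
  have disc0: "0 \<le> A0\<^sup>2 - (1 + e) * \<beta>\<^sup>2 * A0 - \<beta>\<^sup>2 * (1 - \<beta>)"
  proof -
    have "6 * h = e * (e + 2)" by (simp add: h_def)
    then have ee: "e\<^sup>2 = 6 * h - 2 * e" by (simp add: power2_eq_square algebra_simps)
    have "A0\<^sup>2 - (1 + e) * \<beta>\<^sup>2 * A0 - \<beta>\<^sup>2 * (1 - \<beta>)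
      = \<beta>^4 * (2 * h - e / 2 - e\<^sup>2 / 4 - h * \<beta> + h\<^sup>2 * \<beta>\<^sup>2)"
      unfolding A0_def by (simp add: power2_eq_square power3_eq_cube power4_eq_xxxx field_simps)
    also have "2 * h - e / 2 - e\<^sup>2 / 4 - h * \<beta> + h\<^sup>2 * \<beta>\<^sup>2 = h * (1/2 - \<beta>) + h\<^sup>2 * \<beta>\<^sup>2"
      unfolding ee by (simp add: field_simps)
    also have "\<beta>^4 * \<dots> \<ge> 0" using h \<beta> by (intro mult_nonneg_nonneg add_nonneg_nonneg) auto
    finally show ?thesis .
  qed
  \<comment> \<open>Passing from \<open>A0\<close> up to \<open>A\<close> only increases the
    quadratic polynomial, since the sum \<open>A + A0\<close> is at least its linear
    coefficient.\<close>
  have disc: "0 \<le> A\<^sup>2 - (1 + e) * \<beta>\<^sup>2 * A - \<beta>\<^sup>2 * (1 - \<beta>)"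
  proof -
    have "(A - A0) * (A + A0 - (1 + e) * \<beta>\<^sup>2) \<ge> 0"
      using A0 A0b b2 \<beta> by (intro mult_nonneg_nonneg) (auto simp: algebra_simps)
    then show ?thesis using disc0 by (simp add: power2_eq_square algebra_simps)
  qed
  have Apos: "A > 0"
  proof -
    have "0 < \<beta> + e / 2 * \<beta>\<^sup>2" using \<beta> e by (intro add_pos_nonneg) auto
    then show ?thesis using A0 A0b by linarith
  qed
  \<comment> \<open>The discriminant condition of the form in x and \<Lambda>; up to the factors d
    and 1 + d its slack is the expression in \<open>disc\<close>.\<close>
  have "((1 + d) * (A + \<beta> * (1 - \<beta>)))\<^sup>2
    \<le> (A - (1 + d) * \<beta>\<^sup>2 + \<beta>) * ((1 + d) * (A * (1 + e) + (1 - \<beta>) * \<beta>))"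
  proof -
    have "(A - (1 + d) * \<beta>\<^sup>2 + \<beta>) * (A * (1 + e) + (1 - \<beta>) * \<beta>) - (1 + d) * (A + \<beta> * (1 - \<beta>))\<^sup>2
      = d * (A\<^sup>2 - (1 + e) * \<beta>\<^sup>2 * A - \<beta>\<^sup>2 * (1 - \<beta>))"
      unfolding e_def by (simp add: power2_eq_square algebra_simps)
    then have "(1 + d) * (A + \<beta> * (1 - \<beta>))\<^sup>2 \<le> (A - (1 + d) * \<beta>\<^sup>2 + \<beta>) * (A * (1 + e) + (1 - \<beta>) * \<beta>)"
      using disc d by (smt (verit) mult_nonneg_nonneg)
    then have "(1 + d) * ((1 + d) * (A + \<beta> * (1 - \<beta>))\<^sup>2)
      \<le> (1 + d) * ((A - (1 + d) * \<beta>\<^sup>2 + \<beta>) * (A * (1 + e) + (1 - \<beta>) * \<beta>))"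
      using d by (intro mult_left_mono) auto
    then show ?thesis by (simp add: power_mult_distrib power2_eq_square mult_ac)
  qed
  moreover have "A - (1 + d) * \<beta>\<^sup>2 + \<beta> > 0"
  proof -
    have "A \<ge> \<beta> + d * \<beta>\<^sup>2" using A0 A0b by (simp add: e_def)
    then show ?thesis using b2 \<beta> by (simp add: algebra_simps)
  qed
  ultimately have form: "0 \<le> (A - (1 + d) * \<beta>\<^sup>2 + \<beta>) * x\<^sup>2 - 2 * ((1 + d) * (A + \<beta> * (1 - \<beta>))) * x * \<Lambda>
      + ((1 + d) * (A * (1 + e) + (1 - \<beta>) * \<beta>)) * \<Lambda>\<^sup>2"
    by (intro binary_quadratic_form_nonneg)
  \<comment> \<open>Multiplied by \<open>A\<close>, the hypothesis differs from the claim exactly by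
    the quadratic form just shown to be nonnegative.\<close>
  have "A * (x\<^sup>2 - 2 * (1 + d) * \<Lambda> * x + (1 + d) * (1 + e) * \<Lambda>\<^sup>2) \<le> A * ((1 + e) * F)"
    using yang Apos by (intro mult_left_mono) (auto simp: e_def)
  also have "A * ((1 + e) * F) = (r - (1 - \<beta>)) * F" using e by (simp add: A_def)
  finally have "A * (x\<^sup>2 - 2 * (1 + d) * \<Lambda> * x + (1 + d) * (1 + e) * \<Lambda>\<^sup>2) \<le> (r - (1 - \<beta>)) * F" .
  moreover have "A * (x\<^sup>2 - 2 * (1 + d) * \<Lambda> * x + (1 + d) * (1 + e) * \<Lambda>\<^sup>2)
      - ((1 + d) * ((1 - \<beta>) * \<Lambda> + \<beta> * x)\<^sup>2 - ((1 - \<beta>) * ((1 + d) * \<Lambda>\<^sup>2) + \<beta> * x\<^sup>2))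
    = (A - (1 + d) * \<beta>\<^sup>2 + \<beta>) * x\<^sup>2 - 2 * ((1 + d) * (A + \<beta> * (1 - \<beta>))) * x * \<Lambda>
      + ((1 + d) * (A * (1 + e) + (1 - \<beta>) * \<beta>)) * \<Lambda>\<^sup>2"
    by (simp add: power2_eq_square algebra_simps)
  ultimately have "(1 + d) * ((1 - \<beta>) * \<Lambda> + \<beta> * x)\<^sup>2 - ((1 - \<beta>) * ((1 + d) * \<Lambda>\<^sup>2) + \<beta> * x\<^sup>2)
    \<le> (r - (1 - \<beta>)) * F" using form by linarith
  then show ?thesis by (simp add: r_def e_def algebra_simps)
qed

text \<open>\<open>F k\<close> divided by k^(2d) is nonincreasing and equals d l_1^2 at k = 1; the
  next eigenvalue is then bounded through \<open>F k\<close> alone.\<close>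

theorem cheng_yang_recursion:
  fixes l :: "nat \<Rightarrow> real" and N :: real
  assumes N: "N > 0" and l1: "l 1 \<ge> 0"
    and yang: "\<And>k. k \<ge> 1 \<Longrightarrow>
      N * (\<Sum>i\<in>{1..k}. (l (Suc k) - l i)\<^sup>2) \<le> 4 * (\<Sum>i\<in>{1..k}. (l (Suc k) - l i) * l i)"
    and k: "k \<ge> 1"
  shows "l (Suc k) \<le> (1 + 4 / N) * real k powr (2 / N) * l 1"
proof -
  define d where "d = 2 / N"
  have d: "d > 0" using N by (simp add: d_def)
  have d2: "4 / N = 2 * d" by (simp add: d_def)
  define S where "S k = (\<Sum>i\<in>{1..k}. l i)" for k
  define T where "T k = (\<Sum>i\<in>{1..k}. (l i)\<^sup>2)" for k
  define F where "F k = (1 + d) * (S k / real k)\<^sup>2 - T k / real k" for k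
  \<comment> \<open>Yang's inequality divided by k, read as a quadratic inequality in the next
    eigenvalue with the mean as parameter.\<close>
  have quad: "(l (Suc k))\<^sup>2 - 2 * (1 + d) * (S k / real k) * l (Suc k)
      + (1 + d) * (1 + 2 * d) * (S k / real k)\<^sup>2 \<le> (1 + 2 * d) * F k" if k: "k \<ge> 1" for k
  proof -
    define x where "x = l (Suc k)"
    have 1: "(\<Sum>i\<in>{1..k}. (x - l i)\<^sup>2) = real k * x\<^sup>2 - 2 * x * S k + T k"
      by (simp add: power2_diff sum.distrib sum_subtractf S_def T_def sum_distrib_left mult.assoc)
    have 2: "(\<Sum>i\<in>{1..k}. (x - l i) * l i) = x * S k - T k"
      by (simp add: left_diff_distrib sum_subtractf S_def T_def sum_distrib_left power2_eq_square)
    have "N * (real k * x\<^sup>2 - 2 * x * S k + T k) \<le> 4 * (x * S k - T k)"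
      using yang[OF k] unfolding x_def[symmetric] 1 2 .
    then have "real k * x\<^sup>2 - 2 * x * S k + T k \<le> 2 * d * (x * S k - T k)"
      using N by (simp add: d_def field_simps)
    then have "(real k * x\<^sup>2 - 2 * x * S k + T k) / real k \<le> (2 * d * (x * S k - T k)) / real k"
      by (rule divide_right_mono) simp
    then have "x\<^sup>2 - 2 * x * (S k / real k) + T k / real k \<le> 2 * d * (x * (S k / real k) - T k / real k)"
      using k by (simp add: add_divide_distrib diff_divide_distrib right_diff_distrib)
    then show ?thesis unfolding F_def x_def[symmetric] by (simp add: algebra_simps)
  qed
  have step: "F (Suc k) \<le> (real (Suc k) / real k) powr (2 * d) * F k" if k: "k \<ge> 1" for k
  proof -
    define \<beta> where "\<beta> = 1 / real (Suc k)"
    have \<beta>: "0 < \<beta>" "\<beta> \<le> 1/2" using k by (auto simp: \<beta>_def field_simps)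
    have b1: "1 - \<beta> = real k / real (Suc k)" by (simp add: \<beta>_def field_simps)
    have SS: "S (Suc k) / real (Suc k) = (1 - \<beta>) * (S k / real k) + \<beta> * l (Suc k)"
      unfolding b1 using k by (simp add: S_def \<beta>_def add_divide_distrib)
    have TT: "T (Suc k) / real (Suc k) = (1 - \<beta>) * ((1 + d) * (S k / real k)\<^sup>2 - F k) + \<beta> * (l (Suc k))\<^sup>2"
      unfolding b1 F_def using k by (simp add: T_def \<beta>_def add_divide_distrib)
    have "F (Suc k) \<le> (1 - \<beta>) powr (- 2 * d) * F k"
      unfolding F_def[of "Suc k"] SS TT by (rule cheng_yang_step[OF d \<beta> quad[OF k]])
    also have "(1 - \<beta>) powr (- 2 * d) = (real (Suc k) / real k) powr (2 * d)"
      unfolding b1 using k by (simp add: powr_minus powr_divide)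
    finally show ?thesis .
  qed
  have F: "F k \<le> real k powr (2 * d) * (d * (l 1)\<^sup>2)"
    using k
  proof (induction k rule: dec_induct)
    case base
    then show ?case by (simp add: F_def S_def T_def algebra_simps)
  next
    case (step n)
    have "F (Suc n) \<le> (real (Suc n) / real n) powr (2 * d) * F n"
      using step by (intro \<open>\<And>k. 1 \<le> k \<Longrightarrow> F (Suc k) \<le> _\<close>)
    also have "\<dots> \<le> (real (Suc n) / real n) powr (2 * d) * (real n powr (2 * d) * (d * (l 1)\<^sup>2))"
      using step by (intro mult_left_mono) auto
    also have "\<dots> = real (Suc n) powr (2 * d) * (d * (l 1)\<^sup>2)"
      using step by (simp add: powr_divide)
    finally show ?case .
  qed
  have pp: "real k powr (2 * d) = (real k powr d)\<^sup>2"
    by (simp only: power2_eq_square mult_2 powr_add)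
  define x where "x = l (Suc k)"
  define L where "L = S k / real k"
  \<comment> \<open>Completing the square in the mean eliminates it from
    \<open>quad\<close>.\<close>
  have "d * x\<^sup>2 \<le> (1 + 2 * d)\<^sup>2 * F k"
  proof -
    have "0 \<le> (1 + d) * (x - (1 + 2 * d) * L)\<^sup>2" using d by simp
    also have "\<dots> = (1 + 2 * d) * (x\<^sup>2 - 2 * (1 + d) * L * x + (1 + d) * (1 + 2 * d) * L\<^sup>2) - d * x\<^sup>2"
      by (simp add: power2_eq_square algebra_simps)
    also have "\<dots> \<le> (1 + 2 * d) * ((1 + 2 * d) * F k) - d * x\<^sup>2"
      using quad[OF k] d unfolding x_def L_def by (intro diff_right_mono mult_left_mono) auto
    finally show ?thesis by (simp add: power2_eq_square mult.assoc)
  qed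
  also have "\<dots> \<le> (1 + 2 * d)\<^sup>2 * (real k powr (2 * d) * (d * (l 1)\<^sup>2))"
    using F by (intro mult_left_mono) auto
  also have "\<dots> = d * ((1 + 2 * d) * real k powr d * l 1)\<^sup>2"
    unfolding pp by (simp add: power_mult_distrib)
  finally have "x\<^sup>2 \<le> ((1 + 2 * d) * real k powr d * l 1)\<^sup>2" using d by simp
  moreover have "0 \<le> (1 + 2 * d) * real k powr d * l 1" using d l1 by simp
  ultimately have "x \<le> (1 + 2 * d) * real k powr d * l 1" using power2_le_imp_le by blast
  then show ?thesis by (simp add: x_def d2) (simp add: d_def)
qed

subsection \<open>Comparison with the Dirichlet Laplacian for negative potentials\<close>

text \<open>Gaussian elimination, one equation at a time. It will produce a combination of k Laplace
  eigenfunctions orthogonal to k - 1 given functions.\<close>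

lemma underdetermined_homogeneous_system:
  fixes A :: "'i \<Rightarrow> 'j \<Rightarrow> real"
  assumes "finite J" "finite I" "card J < card I"
  shows "\<exists>c. (\<exists>i\<in>I. c i \<noteq> 0) \<and> (\<forall>j\<in>J. (\<Sum>i\<in>I. c i * A i j) = 0)"
  using assms
proof (induction J arbitrary: I A rule: finite_induct)
  case empty
  then have "I \<noteq> {}" by auto
  then show ?case by (intro exI[of _ "\<lambda>_. 1"]) auto
next
  case (insert j J)
  have fI: "finite I" using insert.prems by simp
  show ?case
  proof (cases "\<forall>i\<in>I. A i j = 0")
    case True
    obtain c where c: "\<exists>i\<in>I. c i \<noteq> 0" "\<forall>j\<in>J. (\<Sum>i\<in>I. c i * A i j) = 0"
      using insert.IH[of I A] insert.prems insert.hyps by auto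
    then show ?thesis using True by (intro exI[of _ c]) auto
  next
    case False
    then obtain p where p: "p \<in> I" "A p j \<noteq> 0" by blast
    \<comment> \<open>The coefficients left after equation \<open>j\<close> has been solved for the
      pivot unknown \<open>p\<close>.\<close>
    define B where "B i m = A i m - A i j / A p j * A p m" for i m
    have "card J < card (I - {p})" using insert.prems insert.hyps p by simp
    then obtain c where c: "\<exists>i\<in>I - {p}. c i \<noteq> 0"
      and c0: "\<And>m. m \<in> J \<Longrightarrow> (\<Sum>i\<in>I - {p}. c i * B i m) = 0"
      using insert.IH[of "I - {p}" B] fI by auto
    define s where "s = (\<Sum>i\<in>I - {p}. c i * (A i j / A p j))"
    define c' where "c' = c(p := - s)"
    have sum: "(\<Sum>i\<in>I. c' i * A i m) = - s * A p m + (\<Sum>i\<in>I - {p}. c i * A i m)" for m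
      using p fI by (subst sum.remove[of _ p]) (auto simp: c'_def intro!: sum.cong)
    have "(\<Sum>i\<in>I. c' i * A i m) = 0" if m: "m \<in> insert j J" for m
    proof (cases "m = j")
      case True
      then show ?thesis unfolding sum s_def using p by (simp add: sum_distrib_right)
    next
      case False
      then have "0 = (\<Sum>i\<in>I - {p}. c i * B i m)" using c0 m by simp
      also have "\<dots> = (\<Sum>i\<in>I - {p}. c i * A i m) - s * A p m"
        by (simp add: B_def s_def right_diff_distrib sum_subtractf sum_distrib_right mult.assoc)
      finally show ?thesis unfolding sum by simp
    qed
    moreover have "\<exists>i\<in>I. c' i \<noteq> 0" using c by (auto simp: c'_def)
    ultimately show ?thesis by blast
  qed
qed

text \<open>The ray leaving \<open>x\<close> away from the origin meets the frontier, and the norm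
  increases along it.\<close>

lemma norm_le_Sup_norm_frontier:
  fixes \<Omega> :: "'a::euclidean_space set"
  assumes \<Omega>: "open \<Omega>" "bounded \<Omega>" and x: "x \<in> \<Omega>"
  shows "norm x \<le> (SUP y\<in>frontier \<Omega>. norm y)"
proof -
  have bdd: "bdd_above (norm ` frontier \<Omega>)"
    using bounded_closure[OF \<Omega>(2)] by (auto simp: bounded_iff bdd_above_def frontier_def)
  obtain l :: 'a where l: "l \<noteq> 0" "x = norm x *\<^sub>R l"
  proof (cases "x = 0")
    case True
    \<comment> \<open>At the origin every direction points outward.\<close>
    then show ?thesis using that[OF nonzero_Basis[OF SOME_Basis]] by simp
  next
    case False
    then show ?thesis using that[of "x /\<^sub>R norm x"] by simp
  qed
  obtain t where t: "0 < t" "x + t *\<^sub>R l \<in> frontier \<Omega>"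
    using ray_to_frontier[OF \<Omega>(2) _ l(1), of x] x \<Omega>(1) by (auto simp: interior_open)
  have "norm x \<le> norm (x + t *\<^sub>R l)"
  proof -
    have "x + t *\<^sub>R l = (norm x + t) *\<^sub>R l" using l(2) by (simp add: scaleR_add_left)
    then have "norm (x + t *\<^sub>R l) = (norm x + t) * norm l" using t by simp
    moreover have "norm x = norm x * norm l" using l(2) by (metis norm_scaleR abs_norm_cancel)
    ultimately show ?thesis using t by (simp add: distrib_right)
  qed
  also have "\<dots> \<le> (SUP y\<in>frontier \<Omega>. norm y)" using t bdd by (intro cSUP_upper)
  finally show ?thesis .
qed

context bounded_open
begin

lemma hardy_core_eq_test_functions: "DIM('a) \<ge> 3 \<Longrightarrow> hardy_core \<Omega> \<mu> = test_functions \<Omega>"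
  using hardy_inequality(1) by (auto simp: hardy_core_def)

text \<open>On \<Omega> the weight 1/|x|^2 is at least 1/D^2, and the negative \<mu> reverses the
  inequality between the integrals. Hardy's inequality guarantees that the singular one is
  finite.\<close>

lemma hardy_form_le_shifted_dirichlet_form:
  assumes N: "DIM('a) \<ge> 3" and \<mu>: "\<mu> < 0" and u: "u \<in> test_functions \<Omega>"
    and D: "D > 0" "\<And>x. x \<in> \<Omega> \<Longrightarrow> norm x \<le> D"
  shows "hardy_form \<Omega> \<mu> u u \<le> hardy_form \<Omega> 0 u u + \<mu> / D\<^sup>2 * L2_inner \<Omega> u u"
proof -
  have "L2_inner \<Omega> u u / D\<^sup>2 = (LINT x|lebesgue_on \<Omega>. u x * u x / D\<^sup>2)"
    by (simp add: L2_inner_def)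
  also have "\<dots> \<le> (LINT x|lebesgue_on \<Omega>. u x * u x / (norm x)\<^sup>2)"
  proof (rule integral_mono_AE)
    show "integrable (lebesgue_on \<Omega>) (\<lambda>x. u x * u x / D\<^sup>2)"
      using u by (simp add: L2_on_integrable_mult tf_L2)
    show "integrable (lebesgue_on \<Omega>) (\<lambda>x. u x * u x / (norm x)\<^sup>2)"
      using hardy_inequality(1)[OF u N] by (simp add: power2_eq_square)
    have "AE x in lebesgue_on \<Omega>. x \<in> \<Omega>" by (rule AE_I2) simp
    with AE_nonzero show "AE x in lebesgue_on \<Omega>. u x * u x / D\<^sup>2 \<le> u x * u x / (norm x)\<^sup>2"
    proof eventually_elim
      fix x assume "x \<noteq> 0" "x \<in> \<Omega>"
      then show "u x * u x / D\<^sup>2 \<le> u x * u x / (norm x)\<^sup>2"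
        using D by (intro divide_left_mono power_mono) auto
    qed
  qed
  finally have "\<mu> * (LINT x|lebesgue_on \<Omega>. u x * u x / (norm x)\<^sup>2) \<le> \<mu> * (L2_inner \<Omega> u u / D\<^sup>2)"
    using \<mu> by (intro mult_left_mono_neg) auto
  then show ?thesis using u by (simp add: hardy_form_eq)
qed

text \<open>Turns Cauchy sequences for the Laplacian into Cauchy sequences for the negative
  potential.\<close>

lemma hardy_form_le_dirichlet_form:
  assumes "\<mu> < 0" "u \<in> test_functions \<Omega>"
  shows "hardy_form \<Omega> \<mu> u u \<le> hardy_form \<Omega> 0 u u"
  using assms singular_integral_nonneg[of u] by (simp add: hardy_form_eq mult_nonpos_nonneg)

end

text \<open>The min-max argument: the span of the first k Laplace eigenfunctions contains a nonzero
  function orthogonal to the first k - 1 eigenfunctions of the other operator, and it serves as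
  trial function there.\<close>

lemma eigenvalue_comparison:
  fixes \<Omega> :: "'a::euclidean_space set"
  assumes E: "hardy_eigensystem \<Omega> \<mu> lam \<phi>" and E0: "hardy_eigensystem \<Omega> 0 lam0 \<phi>0"
    and N: "DIM('a) \<ge> 3" and \<mu>: "\<mu> < 0"
    and D: "D > 0" "\<And>x. x \<in> \<Omega> \<Longrightarrow> norm x \<le> D" and k: "k \<ge> 1"
  shows "lam k \<le> lam0 k + \<mu> / D\<^sup>2"
proof -
  interpret H: hardy_eigensystem \<Omega> \<mu> lam \<phi> by fact
  interpret Z: hardy_eigensystem \<Omega> 0 lam0 \<phi>0 by fact
  define I where "I = {1..k}"
  have I: "finite I" "\<And>i. i \<in> I \<Longrightarrow> i \<ge> 1" by (auto simp: I_def)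
  obtain c0 where c0: "\<exists>i\<in>I. c0 i \<noteq> 0"
    and o0: "\<And>j. j \<in> {1..<k} \<Longrightarrow> (\<Sum>i\<in>I. c0 i * L2_inner \<Omega> (\<phi>0 i) (\<phi> j)) = 0"
  proof -
    have "finite {1..<k}" "finite I" "card {1..<k} < card I" using k by (auto simp: I_def)
    from underdetermined_homogeneous_system[OF this, of "\<lambda>i j. L2_inner \<Omega> (\<phi>0 i) (\<phi> j)"] that
    show thesis by blast
  qed
  define s where "s = (\<Sum>i\<in>I. (c0 i)\<^sup>2)"
  have s: "s > 0" unfolding s_def using c0 I by (auto intro!: sum_pos2)
  define u where "u = (\<lambda>x. \<Sum>i\<in>I. c0 i * \<phi>0 i x)"
  have uu: "L2_inner \<Omega> u u = s" unfolding u_def s_def by (rule Z.inner_sum_self[OF I])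
  obtain w where w: "\<And>k. k \<ge> 1 \<Longrightarrow> hardy_approx \<Omega> 0 (w k) (\<phi>0 k)" using Z.approximants by metis
  define z where "z n = (\<lambda>x. \<Sum>i\<in>I. c0 i * w i n x)" for n
  have z0: "hardy_approx \<Omega> 0 z u"
    unfolding z_def u_def by (intro Z.hardy_approx_sum Z.hardy_approx_scale w I)
  have zt: "z n \<in> test_functions \<Omega>" for n using H.core_tf[OF Z.hardy_approx_core[OF z0]] .
  have zL: "L2_lim \<Omega> z u" using Z.hardy_approx_L2_lim[OF z0] .
  \<comment> \<open>One sequence serves both forms: the cores coincide for N \<ge> 3, and the
    smaller form inherits the Cauchy condition.\<close>
  have z: "hardy_approx \<Omega> \<mu> z u"
    unfolding H.hardy_approx_iff
  proof (intro conjI allI impI)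
    show "z n \<in> hardy_core \<Omega> \<mu>" for n using zt H.hardy_core_eq_test_functions[OF N] by simp
    show "L2_lim \<Omega> z u" by fact
    fix e :: real assume "e > 0"
    then obtain M where M: "\<And>m n. m \<ge> M \<Longrightarrow> n \<ge> M \<Longrightarrow>
        hardy_form \<Omega> 0 (\<lambda>x. z m x - z n x) (\<lambda>x. z m x - z n x) < e"
      using z0 unfolding Z.hardy_approx_iff by meson
    then show "\<exists>M. \<forall>m\<ge>M. \<forall>n\<ge>M. hardy_form \<Omega> \<mu> (\<lambda>x. z m x - z n x) (\<lambda>x. z m x - z n x) < e"
      using H.hardy_form_le_dirichlet_form[OF \<mu> test_functions_diff[OF zt zt]]
      by (meson order_le_less_trans)
  qed
  have lim0: "(\<lambda>n. hardy_form \<Omega> 0 (z n) (z n)) \<longlonglongrightarrow> (\<Sum>i\<in>I. lam0 i * (c0 i)\<^sup>2)"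
  proof -
    have "(\<lambda>n. \<Sum>i\<in>I. c0 i * hardy_form \<Omega> 0 (w i n) (z n))
      \<longlonglongrightarrow> (\<Sum>i\<in>I. c0 i * (lam0 i * L2_inner \<Omega> (\<phi>0 i) u))"
      using I by (intro tendsto_intros Z.eigen_limit[OF _ w z0]) auto
    moreover have "hardy_form \<Omega> 0 (z n) (z n) = (\<Sum>i\<in>I. c0 i * hardy_form \<Omega> 0 (w i n) (z n))" for n
      unfolding z_def[of n]
      using Z.hardy_approx_core[OF w] I by (intro H.hardy_form_sum_left H.core_sum H.core_scale) auto
    moreover have "(\<Sum>i\<in>I. c0 i * (lam0 i * L2_inner \<Omega> (\<phi>0 i) u)) = (\<Sum>i\<in>I. lam0 i * (c0 i)\<^sup>2)"
    proof (rule sum.cong[OF refl])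
      fix i assume i: "i \<in> I"
      have "L2_inner \<Omega> u (\<phi>0 i) = c0 i"
        unfolding u_def using Z.inner_sum_basis[OF I I(2)[OF i], of c0] i by simp
      then have "L2_inner \<Omega> (\<phi>0 i) u = c0 i" using L2_inner_commute by metis
      then show "c0 i * (lam0 i * L2_inner \<Omega> (\<phi>0 i) u) = lam0 i * (c0 i)\<^sup>2"
        by (simp add: power2_eq_square)
    qed
    ultimately show ?thesis by simp
  qed
  \<comment> \<open>The majorant for \<open>Rayleigh\<close>: the form at \<mu> is only estimated
    along \<open>z\<close>, but this upper bound has a computable limit.\<close>
  have limz: "(\<lambda>n. hardy_form \<Omega> 0 (z n) (z n) + \<mu> / D\<^sup>2 * L2_inner \<Omega> (z n) (z n))
      \<longlonglongrightarrow> (\<Sum>i\<in>I. lam0 i * (c0 i)\<^sup>2) + \<mu> / D\<^sup>2 * s"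
    unfolding uu[symmetric] by (intro tendsto_add tendsto_mult lim0 L2_lim_inner zL tendsto_const)
  have le: "hardy_form \<Omega> \<mu> (z n) (z n) \<le> hardy_form \<Omega> 0 (z n) (z n) + \<mu> / D\<^sup>2 * L2_inner \<Omega> (z n) (z n)" for n
    by (rule H.hardy_form_le_shifted_dirichlet_form[OF N \<mu> zt D])
  have orth: "L2_inner \<Omega> u (\<phi> j) = 0" if j: "1 \<le> j" "j \<le> k - 1" for j
  proof -
    have "L2_inner \<Omega> u (\<phi> j) = (\<Sum>i\<in>I. c0 i * L2_inner \<Omega> (\<phi>0 i) (\<phi> j))"
      unfolding u_def using I j H.\<phi>_L2 Z.\<phi>_L2
      by (subst L2_inner_sum_left) (auto simp: L2_on_scale L2_inner_scale_left)
    then show ?thesis using o0[of j] j k by simp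
  qed
  have "lam k * s \<le> (\<Sum>i\<in>I. lam0 i * (c0 i)\<^sup>2) + \<mu> / D\<^sup>2 * s"
    using H.Rayleigh[OF z le limz, of "k - 1"] orth k uu by simp
  also have "(\<Sum>i\<in>I. lam0 i * (c0 i)\<^sup>2) \<le> (\<Sum>i\<in>I. lam0 k * (c0 i)\<^sup>2)"
    by (intro sum_mono mult_right_mono Z.lam_mono) (auto simp: I_def)
  also have "\<dots> = lam0 k * s" by (simp add: s_def sum_distrib_left)
  finally have "lam k * s \<le> (lam0 k + \<mu> / D\<^sup>2) * s" by (simp add: distrib_right)
  then show ?thesis using s by (simp add: mult_le_cancel_right)
qed

lemma hardy_eigensystem_exists:
  fixes \<Omega> :: "'a::euclidean_space set"
  assumes "open \<Omega>" "bounded \<Omega>" "dirichlet_eigenvalues \<Omega> \<mu> lam"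
    and "\<mu> \<ge> 0 \<or> DIM('a) \<ge> 3 \<and> \<mu> \<ge> hardy_const DIM('a)"
  obtains \<phi> where "hardy_eigensystem \<Omega> \<mu> lam \<phi>"
proof -
  interpret hardy_domain \<Omega> \<mu> using assms by unfold_locales auto
  obtain \<phi> where "\<forall>k\<ge>1. hardy_operator \<Omega> \<mu> (\<phi> k) (\<lambda>x. lam k * \<phi> k x)"
    "\<forall>i\<ge>1. \<forall>j\<ge>1. L2_inner \<Omega> (\<phi> i) (\<phi> j) = (if i = j then 1 else 0)"
    "\<forall>u\<in>L2_on \<Omega>. (\<forall>k\<ge>1. L2_inner \<Omega> u (\<phi> k) = 0) \<longrightarrow> (AE x in lebesgue_on \<Omega>. u x = 0)"
    using assms(3) unfolding dirichlet_eigenvalues_def by blast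
  moreover have "\<forall>k\<ge>1. lam k \<le> lam (Suc k)"
    using assms(3) unfolding dirichlet_eigenvalues_def by blast
  ultimately have "hardy_eigensystem \<Omega> \<mu> lam \<phi>"
    by unfold_locales blast+
  then show ?thesis by (rule that)
qed

text \<open>The recursion bounds eigenvalue number k + 1 with the power of k; monotonicity gives the
  same bound for number k, including k = 1.\<close>

lemma (in hardy_eigensystem) eigenvalue_bound:
  assumes \<mu>: "\<mu> \<ge> 0" and k: "k \<ge> 1"
  shows "lam k \<le> (1 + 4 / real DIM('a)) * real k powr (2 / real DIM('a)) * lam 1"
proof -
  have "lam k \<le> lam (Suc k)" by (rule lam_Suc[OF k])
  also have "\<dots> \<le> (1 + 4 / real DIM('a)) * real k powr (2 / real DIM('a)) * lam 1"
    using yang_inequality[OF \<mu>] lam_nonneg k by (intro cheng_yang_recursion) auto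
  finally show ?thesis .
qed

theorem theorem1p3:
  fixes \<Omega> :: "(real ^ 'n) set"
    and lam :: "real \<Rightarrow> nat \<Rightarrow> real"
    and D0 :: real
  assumes "smooth_bounded_domain \<Omega>"
    and "0 \<in> \<Omega>"
    and "D0 = (SUP x\<in>frontier \<Omega>. norm x)"
    and "CARD('n) \<ge> 2"
    and "\<And>\<mu>. \<mu> \<ge> hardy_const CARD('n) \<Longrightarrow> dirichlet_eigenvalues \<Omega> \<mu> (lam \<mu>)"
  shows "(\<forall>\<mu>\<ge>0. \<forall>k\<ge>1.
            lam \<mu> k \<le> (1 + 4 / real CARD('n)) * real k powr (2 / real CARD('n)) * lam \<mu> 1) \<and>
         (CARD('n) \<ge> 3 \<longrightarrow> (\<forall>\<mu>. hardy_const CARD('n) \<le> \<mu> \<and> \<mu> < 0 \<longrightarrow> (\<forall>k\<ge>1.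
            lam \<mu> k \<le> (1 + 4 / real CARD('n)) * real k powr (2 / real CARD('n)) * lam 0 1
                        + \<mu> / D0\<^sup>2)))"
proof (intro conjI allI impI)
  have \<Omega>: "open \<Omega>" "bounded \<Omega>" using assms(1) by (auto simp: smooth_bounded_domain_def)
  have const: "hardy_const CARD('n) \<le> 0" by (simp add: hardy_const_def)
  show nonneg: "lam \<mu> k \<le> (1 + 4 / real CARD('n)) * real k powr (2 / real CARD('n)) * lam \<mu> 1"
    if \<mu>: "0 \<le> \<mu>" and k: "1 \<le> k" for \<mu> k
  proof -
    have "dirichlet_eigenvalues \<Omega> \<mu> (lam \<mu>)" using const \<mu> by (intro assms(5)) simp
    then obtain \<phi> where "hardy_eigensystem \<Omega> \<mu> (lam \<mu>) \<phi>"
      using hardy_eigensystem_exists[OF \<Omega>] \<mu> by blast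
    from hardy_eigensystem.eigenvalue_bound[OF this \<mu> k] show ?thesis by simp
  qed
  show "lam \<mu> k \<le> (1 + 4 / real CARD('n)) * real k powr (2 / real CARD('n)) * lam 0 1 + \<mu> / D0\<^sup>2"
    if N: "3 \<le> CARD('n)" and \<mu>: "hardy_const CARD('n) \<le> \<mu> \<and> \<mu> < 0" and k: "1 \<le> k" for \<mu> k
  proof -
    have N': "DIM(real ^ 'n) \<ge> 3" using N by simp
    obtain \<phi> where E: "hardy_eigensystem \<Omega> \<mu> (lam \<mu>) \<phi>"
      using hardy_eigensystem_exists[OF \<Omega> assms(5)[of \<mu>]] \<mu> N by auto
    obtain \<phi>0 where E0: "hardy_eigensystem \<Omega> 0 (lam 0) \<phi>0"
      using hardy_eigensystem_exists[OF \<Omega> assms(5)[of 0]] const by auto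
    have le: "norm x \<le> D0" if "x \<in> \<Omega>" for x
      unfolding assms(3) by (rule norm_le_Sup_norm_frontier[OF \<Omega> that])
    \<comment> \<open>The open set \<Omega> is not the singleton {0}. A nonzero point forces D0 > 0,
      so the division by \<open>D0\<^sup>2\<close> is genuine.\<close>
    obtain x where "x \<in> \<Omega>" "x \<noteq> 0"
      using open_delete[OF \<Omega>(1), of 0] \<Omega>(1) assms(2) not_open_singleton[of "0 :: real ^ 'n"]
      by (metis insertI1 singletonD subsetI subset_antisym subset_singletonD)
    then have D: "D0 > 0" using le[of x] by (smt (verit) zero_less_norm_iff)
    have "lam \<mu> k \<le> lam 0 k + \<mu> / D0\<^sup>2"
      using \<mu> by (intro eigenvalue_comparison[OF E E0 N' _ D le k]) auto
    \<comment> \<open>The first part at \<mu> = 0 finishes the comparison.\<close>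
    also have "lam 0 k \<le> (1 + 4 / real CARD('n)) * real k powr (2 / real CARD('n)) * lam 0 1"
      by (rule nonneg[OF order_refl k])
    finally show ?thesis by simp
  qed
qed

end
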